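(* Let $\alpha>0$, $\ell\ge1$ and $t>0$, and let $Z$ be a centred Gaussian process (Gaussian random element of $W_{\alpha,2}(\mathbb S^2)$) with the same covariance operator as $T_{\ell;t}$, the latter regarded as a random element of $W_{\alpha,2}(\mathbb S^2)$. Then $$d_{3,W_{\alpha,2}}(T_{\ell;t},Z)\le\frac{\sqrt\pi\left(1+\sqrt{\ell(\ell+1)}\right)^{2\alpha}}{2\sqrt{\nu_t}}+\frac{2\pi\left(1+\sqrt{\ell(\ell+1)}\right)^{3\alpha}}{\sqrt{\nu_t}}.$$
   Context: Let $\mu$ be the Lebesgue (surface) measure on the unit sphere $\mathbb S^2\subset\mathbb R^3$, so $\mu(\mathbb S^2)=4\pi$. For $t>0$ let $\nu_t>0$ be the rate and let $N_t$ be a Poisson random measure on $\mathbb S^2$ with intensity measure $\nu_t\,\mu$. Let $P_\ell$ be the Legendre polynomial of degree $\ell$ (normalized by $P_\ell(1)=1$). The Poisson spherical random wave is $$T_{\ell;t}(x)=\frac{1}{\sqrt{\nu_t}}\int_{\mathbb S^2}\sqrt{\frac{2\ell+1}{4\pi}}\,P_\ell(\langle x,\xi\rangle)\,dN_t(\xi),\qquad x\in\mathbb S^2.$$ Let $\{Y_{\ell m}\}_{\ell\ge0,\,-\ell\le m\le\ell}$ be the real spherical harmonics, an orthonormal basis of $L^2(\mathbb S^2,\mu)$ with $\Delta_{\mathbb S^2}Y_{\ell m}=-\ell(\ell+1)Y_{\ell m}$. The Sobolev space $W_{\alpha,2}(\mathbb S^2)$ consists of the $f=\sum_{\ell,m}a_{\ell,m}Y_{\ell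 m}\in L^2(\mathbb S^2)$ with finite norm $$\|f\|^2_{W_{\alpha,2}(\mathbb S^2)}=\sum_{\ell\ge0}\sum_{m=-\ell}^{\ell}\left(1+\sqrt{\ell(\ell+1)}\right)^{2\alpha}|a_{\ell,m}|^2.$$ The covariance operator of a centred $K$-valued random variable $X$ ($K$ a separable Hilbert space, $\mathbb E\|X\|_K^2<\infty$) is $Su=\mathbb E[\langle X,u\rangle_KX]$. For a Hilbert space $K$, $C_b^3(K)$ is the class of real-valued functions on $K$ with bounded Fréchet derivatives up to order three, with $\|h\|_{C_b^3(K)}=\sup_{j=1,2,3}\sup_{x\in K}\|D^jh(x)\|_{K^{\otimes j}}$. For random elements $X,Y$ of $K$, $d_{3,K}(X,Y)=\sup\{|\mathbb E[h(X)]-\mathbb E[h(Y)]|:h\in C_b^3(K),\ \|h\|_{C_b^3(K)}\le1\}$, and $d_{3,W_{\alpha,2}}$ denotes this metric for $K=W_{\alpha,2}(\mathbb S^2)$. *)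

theory Defs
  imports
    "HOL-Probability.Probability"
    "HOL-Computational_Algebra.Polynomial"
begin

section \<open>The unit sphere\<close>

text \<open>
  The surface measure as cone measure: the area of a Borel set \<open>A\<close> of the sphere is three times the
  volume of the cone \<open>{y. 0 < norm y \<le> 1, y / norm y \<in> A}\<close>, so that the whole sphere has
  measure \<open>4 * pi\<close>.
\<close>

definition sphere_measure :: "(real ^ 3) measure" where
  "sphere_measure =
     scale_measure 3
       (distr (restrict_space lborel (cball 0 1 - {0})) (restrict_space borel (sphere 0 1)) sgn)"

lemma emeasure_sphere_measure: "emeasure sphere_measure (sphere 0 1) = ennreal (4 * pi)"
proof -
  let ?C = "cball (0 :: real ^ 3) 1 - {0}"
  have [measurable]: "(sgn :: real ^ 3 \<Rightarrow> real ^ 3) \<in> borel_measurable borel"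
    by (simp add: sgn_div_norm[abs_def])
  have m: "sgn \<in> measurable (restrict_space lborel ?C) (restrict_space borel (sphere 0 1))"
    by (intro measurable_restrict_space2 measurable_restrict_space1)
       (auto simp: space_restrict_space norm_sgn)
  have "sgn -` sphere 0 1 \<inter> ?C = ?C"
    by (auto simp: norm_sgn)
  moreover have "emeasure lborel ?C = emeasure lborel (cball (0 :: real ^ 3) 1)"
    by (intro emeasure_Diff_null_set) auto
  moreover have "emeasure lborel (cball (0 :: real ^ 3) 1) = ennreal (4 / 3 * pi)"
    by (subst emeasure_cball) (auto simp: unit_ball_vol_3)
  moreover have "sphere 0 1 \<in> sets (restrict_space borel (sphere (0 :: real ^ 3) 1))"
    by (simp add: sets_restrict_space_iff)
  ultimately have "emeasure (distr (restrict_space lborel ?C) (restrict_space borel (sphere 0 1)) sgn)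
      (sphere 0 1) = ennreal (4 / 3 * pi)"
    by (subst emeasure_distr[OF m]) (auto simp: space_restrict_space emeasure_restrict_space)
  then show ?thesis
    unfolding sphere_measure_def by (simp add: flip: ennreal_numeral ennreal_mult')
qed

definition sphere_L2 :: "(real ^ 3 \<Rightarrow> real) set" where
  "sphere_L2 =
     {f. f \<in> borel_measurable sphere_measure \<and> integrable sphere_measure (\<lambda>x. (f x)\<^sup>2)}"

text \<open>
  The function \<open>f\<close> is twice continuously differentiable on the sphere and \<open>g\<close> is its
  Laplace-Beltrami image: at a point of the sphere, the Laplace-Beltrami operator is the Euclidean
  Laplacian of the extension \<open>\<lambda>y. f (y / norm y)\<close>, which is homogeneous of degree 0.
\<close>

definition has_sphere_laplacian :: "(real ^ 3 \<Rightarrow> real) \<Rightarrow> (real ^ 3 \<Rightarrow> real) \<Rightarrow> bool" where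
  "has_sphere_laplacian f g \<longleftrightarrow>
     (\<exists>(D1 :: real ^ 3 \<Rightarrow> (real ^ 3) \<Rightarrow>\<^sub>L real)
      (D2 :: real ^ 3 \<Rightarrow> (real ^ 3) \<Rightarrow>\<^sub>L (real ^ 3) \<Rightarrow>\<^sub>L real).
        (\<forall>y. y \<noteq> 0 \<longrightarrow>
           ((\<lambda>y. f (sgn y)) has_derivative blinfun_apply (D1 y)) (at y) \<and>
           (D1 has_derivative blinfun_apply (D2 y)) (at y)) \<and>
        continuous_on (- {0}) D2 \<and>
        (\<forall>x\<in>sphere 0 1. g x = (\<Sum>b\<in>Basis. D2 x b b)))"


section \<open>Legendre polynomials and spherical harmonics\<close>

text \<open>Rodrigues' formula.\<close>

definition legendre :: "nat \<Rightarrow> real poly" where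
  "legendre l = smult (1 / (2 ^ l * fact l)) ((pderiv ^^ l) ([:- 1, 0, 1:] ^ l))"

definition sphere_coeff ::
  "(nat \<Rightarrow> int \<Rightarrow> real ^ 3 \<Rightarrow> real) \<Rightarrow> (real ^ 3 \<Rightarrow> real) \<Rightarrow> nat \<Rightarrow> int \<Rightarrow> real" where
  "sphere_coeff Y f l m = (\<integral>x. f x * Y l m x \<partial>sphere_measure)"

text \<open>
  Only the indices \<open>- l \<le> m \<le> l\<close> matter. An orthonormal basis of real eigenfunctions is determined
  up to an orthogonal change of basis in each eigenspace; the Sobolev norms below do not depend on
  this choice.
\<close>

definition real_spherical_harmonics :: "(nat \<Rightarrow> int \<Rightarrow> real ^ 3 \<Rightarrow> real) \<Rightarrow> bool" where
  "real_spherical_harmonics Y \<longleftrightarrow>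
     (\<forall>l. \<forall>m\<in>{- int l..int l}.
        has_sphere_laplacian (Y l m) (\<lambda>x. - (real l * (real l + 1)) * Y l m x)) \<and>
     (\<forall>l l'. \<forall>m\<in>{- int l..int l}. \<forall>m'\<in>{- int l'..int l'}.
        sphere_coeff Y (Y l m) l' m' = (if l = l' \<and> m = m' then 1 else 0)) \<and>
     (\<forall>f\<in>sphere_L2.
        (\<lambda>n. \<integral>x. (f x - (\<Sum>l<n. \<Sum>m\<in>{- int l..int l}. sphere_coeff Y f l m * Y l m x))\<^sup>2
               \<partial>sphere_measure) \<longlonglongrightarrow> 0)"


section \<open>Sobolev spaces on the sphere\<close>

definition sobolev_term ::
  "(nat \<Rightarrow> int \<Rightarrow> real ^ 3 \<Rightarrow> real) \<Rightarrow> real \<Rightarrow> (real ^ 3 \<Rightarrow> real) \<Rightarrow> nat \<Rightarrow> real" where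
  "sobolev_term Y \<alpha> f l =
     (\<Sum>m\<in>{- int l..int l}.
        (1 + sqrt (real l * (real l + 1))) powr (2 * \<alpha>) * \<bar>sphere_coeff Y f l m\<bar>\<^sup>2)"

definition sobolev_functions ::
  "(nat \<Rightarrow> int \<Rightarrow> real ^ 3 \<Rightarrow> real) \<Rightarrow> real \<Rightarrow> (real ^ 3 \<Rightarrow> real) set" where
  "sobolev_functions Y \<alpha> = {f \<in> sphere_L2. summable (sobolev_term Y \<alpha> f)}"

definition sobolev_norm ::
  "(nat \<Rightarrow> int \<Rightarrow> real ^ 3 \<Rightarrow> real) \<Rightarrow> real \<Rightarrow> (real ^ 3 \<Rightarrow> real) \<Rightarrow> real" where
  "sobolev_norm Y \<alpha> f = sqrt (\<Sum>l. sobolev_term Y \<alpha> f l)"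

text \<open>
  The elements of the Sobolev space are almost everywhere classes of functions, and the space
  depends on the real number \<open>\<alpha>\<close>, so it cannot be a single type. Instead, the type \<open>'k\<close> is the
  Sobolev space of order \<open>\<alpha>\<close>, with \<open>J f\<close> the class of the function \<open>f\<close>: the map \<open>J\<close> is linear and
  onto, and \<open>norm (J f)\<close> is the Sobolev norm, whence \<open>J f = J g\<close> precisely if \<open>f = g\<close> almost
  everywhere. Outside \<open>sobolev_functions Y \<alpha>\<close>, the values of \<open>J\<close> are irrelevant.
\<close>

definition sobolev_class_map ::
  "(nat \<Rightarrow> int \<Rightarrow> real ^ 3 \<Rightarrow> real) \<Rightarrow> real \<Rightarrow> ((real ^ 3 \<Rightarrow> real) \<Rightarrow> 'k::real_inner) \<Rightarrow> bool" where
  "sobolev_class_map Y \<alpha> J \<longleftrightarrow>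
     (\<forall>f\<in>sobolev_functions Y \<alpha>. \<forall>g\<in>sobolev_functions Y \<alpha>. \<forall>a b.
        J (\<lambda>x. a * f x + b * g x) = a *\<^sub>R J f + b *\<^sub>R J g) \<and>
     (\<forall>f\<in>sobolev_functions Y \<alpha>. norm (J f) = sobolev_norm Y \<alpha> f) \<and>
     J ` sobolev_functions Y \<alpha> = UNIV"


section \<open>Poisson random measures and Poisson spherical waves\<close>

text \<open>
  For a finite intensity measure \<open>L\<close>; the realisations of \<open>N\<close> are then almost surely finite, and, as
  usual for a random element of the space of finite measures, they are required to be finite
  everywhere.
\<close>

definition poisson_random_measure ::
  "'a measure \<Rightarrow> 'b measure \<Rightarrow> ('a \<Rightarrow> 'b measure) \<Rightarrow> bool" where
  "poisson_random_measure M L N \<longleftrightarrow>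
     finite_measure L \<and>
     (\<forall>\<omega>\<in>space M. sets (N \<omega>) = sets L \<and> finite_measure (N \<omega>)) \<and>
     (\<forall>A\<in>sets L. (\<lambda>\<omega>. measure (N \<omega>) A) \<in> borel_measurable M) \<and>
     (\<forall>A\<in>sets L. \<forall>n::nat.
        measure M {\<omega> \<in> space M. measure (N \<omega>) A = real n} =
          exp (- measure L A) * measure L A ^ n / fact n) \<and>
     (\<forall>(n::nat) A. A ` {..<n} \<subseteq> sets L \<and> disjoint_family_on A {..<n} \<longrightarrow>
        prob_space.indep_vars M (\<lambda>_. borel) (\<lambda>i \<omega>. measure (N \<omega>) (A i)) {..<n})"

definition poisson_wave :: "nat \<Rightarrow> real \<Rightarrow> (real ^ 3) measure \<Rightarrow> real ^ 3 \<Rightarrow> real" where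
  "poisson_wave l \<nu> N x =
     1 / sqrt \<nu> * (\<integral>\<xi>. sqrt ((2 * real l + 1) / (4 * pi)) * poly (legendre l) (x \<bullet> \<xi>) \<partial>N)"


section \<open>Random elements of a Hilbert space\<close>

definition covariance_operator ::
  "'a measure \<Rightarrow> ('a \<Rightarrow> 'k::{real_inner, banach, second_countable_topology}) \<Rightarrow> 'k \<Rightarrow> 'k" where
  "covariance_operator M X u = (\<integral>\<omega>. (X \<omega> \<bullet> u) *\<^sub>R X \<omega> \<partial>M)"

text \<open>The case \<open>\<sigma> = 0\<close> covers degenerate one-dimensional projections.\<close>

definition centred_gaussian :: "'a measure \<Rightarrow> ('a \<Rightarrow> 'k::real_inner) \<Rightarrow> bool" where
  "centred_gaussian M Z \<longleftrightarrow>
     Z \<in> borel_measurable M \<and>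
     (\<forall>u. \<exists>\<sigma>. distr M borel (\<lambda>\<omega>. Z \<omega> \<bullet> u) = distr std_normal_distribution borel (\<lambda>x. \<sigma> * x))"

definition fderiv ::
  "('k::real_normed_vector \<Rightarrow> 'b::real_normed_vector) \<Rightarrow> 'k \<Rightarrow> 'k \<Rightarrow>\<^sub>L 'b" where
  "fderiv h x = Blinfun (frechet_derivative h (at x))"

text \<open>
  The Hilbert tensor (Hilbert-Schmidt) norm of a \<open>j\<close>-linear form, whose arguments are passed as a list
  of length \<open>j\<close>. The squared norm is the sum of the squared values on all \<open>j\<close>-tuples from an
  orthonormal basis, and this is the supremum of such sums over finite orthonormal sets.
\<close>

definition tensor_norm :: "nat \<Rightarrow> ('k::real_inner list \<Rightarrow> real) \<Rightarrow> ennreal" where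
  "tensor_norm j A =
     (SUP E\<in>{E. finite E \<and> pairwise orthogonal E \<and> (\<forall>e\<in>E. norm e = 1)}.
        ennreal (sqrt (\<Sum>es\<in>{es. set es \<subseteq> E \<and> length es = j}. (A es)\<^sup>2)))"

definition Cb3_norm :: "('k::real_inner \<Rightarrow> real) \<Rightarrow> ennreal" where
  "Cb3_norm h =
     (SUP x. Max {tensor_norm 1 (\<lambda>es. fderiv h x (es ! 0)),
                  tensor_norm 2 (\<lambda>es. fderiv (fderiv h) x (es ! 0) (es ! 1)),
                  tensor_norm 3 (\<lambda>es. fderiv (fderiv (fderiv h)) x (es ! 0) (es ! 1) (es ! 2))})"

definition Cb3 :: "('k::real_inner \<Rightarrow> real) set" where
  "Cb3 =
     {h. (\<forall>x. h differentiable (at x) \<and> fderiv h differentiable (at x) \<and>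
              fderiv (fderiv h) differentiable (at x)) \<and>
         Cb3_norm h < \<infinity>}"

text \<open>
  The two random elements may live on different probability spaces. As \<open>h \<in> Cb3\<close> is Lipschitz, the
  expectations exist as soon as the norms of \<open>X\<close> and \<open>X'\<close> are integrable.
\<close>

definition d3 ::
  "'a measure \<Rightarrow> ('a \<Rightarrow> 'k::real_inner) \<Rightarrow> 'b measure \<Rightarrow> ('b \<Rightarrow> 'k) \<Rightarrow> ennreal" where
  "d3 M X M' X' =
     (SUP h\<in>{h \<in> Cb3. Cb3_norm h \<le> 1}.
        ennreal \<bar>(\<integral>\<omega>. h (X \<omega>) \<partial>M) - (\<integral>\<omega>. h (X' \<omega>) \<partial>M')\<bar>)"

end

theory Submission
  imports Defs
begin

text \<open>
  The Poisson wave is an integral \<open>T = (\<integral>\<xi>. \<phi> \<xi> \<partial>N)\<close>, where \<open>\<phi> \<xi>\<close> is the Sobolev class of a multiple of the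
  Legendre function \<open>x \<longmapsto> P\<^sub>l (x \<bullet> \<xi>)\<close>. All these functions belong to degree \<open>l\<close>, where the Sobolev norm is
  \<open>C = (1 + sqrt (l (l + 1))) powr \<alpha>\<close> times the \<open>L\<^sup>2\<close> norm; hence \<open>norm (\<phi> \<xi>) \<le> C / sqrt \<nu>\<close> for every \<open>\<xi>\<close>,
  while the intensity has total mass \<open>4 pi \<nu>\<close>. The theorem is an instance of \<open>poisson_gaussian_bound\<close>:
  if \<open>norm \<phi> \<le> c\<close> and \<open>\<phi>\<close> has mean zero under the intensity \<open>L\<close>, then
  \<open>\<bar>E h(T) - E h(Z)\<bar> \<le> pi / 8 * L(S) * c\<^sup>3\<close> for all test functions \<open>h\<close>. With the values above the right
  hand side is \<open>pi\<^sup>2 / 2 * C\<^sup>3 / sqrt \<nu>\<close>, which is at most \<open>2 pi C\<^sup>3 / sqrt \<nu>\<close> because \<open>pi < 4\<close>.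

  The general bound follows from an interpolation (\<open>smart_path_bound\<close>). Let \<open>X\<close> be a finite sum of
  compensated independent Poisson variables with vector coefficients \<open>a\<^sub>i\<close>, independent of \<open>Z\<close>, and differentiate
  \<open>\<theta> \<longmapsto> E h (cos \<theta> X + sin \<theta> Z)\<close>. Gaussian integration by parts turns the \<open>Z\<close> term into the
  second derivative of \<open>h\<close> contracted with the covariance of \<open>Z\<close>. Poisson integration by parts turns
  the \<open>X\<close> term into increments of \<open>Dh\<close> in the directions \<open>a\<^sub>i\<close>; their linear part is the second
  derivative contracted with the covariance of \<open>X\<close>, and the remainder is controlled by the third derivative.
  If the covariances agree up to \<open>\<delta>\<close>, only \<open>\<delta>\<close> and the third moments survive. The integral \<open>T\<close> itself is
  approximated by such sums \<open>X\<close>, with \<open>a\<^sub>i\<close> the value of \<open>\<phi>\<close> at one point of the \<open>i\<close>-th cell of a fine partition.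

  Of \<open>Z\<close>, only the laws of the real variables \<open>Z \<bullet> u\<close> are given. Its covariance operator shows that \<open>Z\<close> lives
  in the finite-dimensional span of \<open>\<phi>\<close>. A Gram-Schmidt process for the covariance form
  then writes \<open>Z\<close> as a sum of uncorrelated Gaussian multiples of fixed vectors, and these are independent
  because the joint characteristic function factorises (Kac's theorem, \<open>indep_vars_if_char_factors\<close>, which is
  reduced to the uniqueness theorem on the real line).

  On the sphere, the Laplace-Beltrami operator is the sum of the squares of the derivatives along the
  rotations about the three coordinate axes. Rotations preserve the cone measure, so each such
  derivative has integral zero. This makes the Laplacian symmetric, whence the Legendre functions of
  degree \<open>l\<close> are orthogonal to the harmonics of other degrees; applied to polynomials in \<open>x \<bullet> \<xi>\<close> it
  also yields the mean zero (for \<open>l \<ge> 1\<close>) and the squared \<open>L\<^sup>2\<close> norm \<open>4 pi / (2 l + 1)\<close> of the Legendre function.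
\<close>

section \<open>The surface measure and rotations\<close>

lemma space_sphere_measure [simp]: "space sphere_measure = sphere 0 1"
  by (simp add: sphere_measure_def space_scale_measure space_restrict_space)

lemma sets_sphere_measure [simp, measurable_cong]:
  "sets sphere_measure = sets (restrict_space borel (sphere 0 1))"
  by (simp add: sphere_measure_def)

lemma finite_sphere_measure: "finite_measure sphere_measure"
  by (rule finite_measureI) (simp add: emeasure_sphere_measure)

lemma measure_sphere_measure: "measure sphere_measure (sphere 0 1) = 4 * pi"
  by (simp add: measure_def emeasure_sphere_measure)

lemma measurable_continuous_on_sphere:
  "continuous_on (sphere 0 1) f \<Longrightarrow> f \<in> borel_measurable sphere_measure"
  by (simp add: measurable_cong_sets[OF sets_sphere_measure refl] borel_measurable_continuous_on_restrict)

lemma integrable_continuous_on_sphere: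
  fixes f :: "real ^ 3 \<Rightarrow> real"
  assumes "continuous_on (sphere 0 1) f"
  shows "integrable sphere_measure f"
proof -
  have "compact (f ` sphere 0 1)"
    using assms by (intro compact_continuous_image) auto
  then obtain B where "\<And>x. x \<in> sphere 0 1 \<Longrightarrow> norm (f x) \<le> B"
    by (meson bounded_iff compact_imp_bounded imageI)
  then show ?thesis
    by (intro finite_measure.integrable_const_bound[OF finite_sphere_measure, of _ B]
          measurable_continuous_on_sphere assms) auto
qed

text \<open>
  Lebesgue measure of images is invariant under orthogonal maps; the preimage form is the one that
  push-forwards need, and it follows because the inverse is again orthogonal.
\<close>

lemma lborel_orthogonal_vimage:
  fixes f :: "real ^ 3 \<Rightarrow> real ^ 3"
  assumes f: "orthogonal_transformation f" and S: "S \<in> sets borel" "emeasure lborel S < \<infinity>"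
  shows "emeasure lborel (f -` S) = emeasure lborel S"
proof -
  have inv: "orthogonal_transformation (inv f)" "f -` S = inv f ` S"
    using f by (auto simp: orthogonal_transformation_inv orthogonal_transformation_bij bij_vimage_eq_inv_image)
  have Sm: "S \<in> lmeasurable"
    using S by (intro fmeasurableI) (auto simp: emeasure_completion)
  have "f \<in> borel_measurable borel"
    using f by (intro borel_measurable_continuous_onI linear_continuous_on)
      (simp add: orthogonal_transformation_linear linear_conv_bounded_linear[symmetric])
  then have "f -` S \<in> sets borel"
    using S measurable_sets[of f borel borel S] by simp
  moreover have m: "f -` S \<in> lmeasurable" "measure lebesgue (f -` S) = measure lebesgue S"
    unfolding inv(2) using measurable_orthogonal_image[OF inv(1) Sm] measure_orthogonal_image[OF inv(1) Sm]
    by auto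
  moreover have e: "emeasure lborel A = ennreal (measure lebesgue A)" if "A \<in> sets borel" "A \<in> lmeasurable" for A
    using that emeasure_eq_measure2[OF that(2)] by (simp add: emeasure_completion main_part_sets)
  ultimately show ?thesis
    using e[of S] e[of "f -` S"] S(1) Sm m(2) by presburger
qed

lemma emeasure_sphere_measure_cone:
  assumes A: "A \<in> sets sphere_measure"
  shows "emeasure sphere_measure A = 3 * emeasure lborel {y \<in> cball 0 1 - {0}. sgn y \<in> A}"
    and "{y \<in> cball 0 1 - {0}. sgn y \<in> A} \<in> sets borel"
proof -
  let ?C = "cball (0 :: real ^ 3) 1 - {0}"
  have [measurable]: "(sgn :: real ^ 3 \<Rightarrow> real ^ 3) \<in> borel_measurable borel"
    by (simp add: sgn_div_norm[abs_def])
  have m: "sgn \<in> measurable (restrict_space lborel ?C) (restrict_space borel (sphere 0 1))"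
    by (intro measurable_restrict_space2 measurable_restrict_space1)
       (auto simp: space_restrict_space norm_sgn)
  have A': "A \<in> sets (restrict_space borel (sphere 0 1))" "A \<in> sets borel" "A \<subseteq> sphere 0 1"
    using A by (auto simp: sets_restrict_space_iff)
  have eq: "sgn -` A \<inter> ?C = {y \<in> ?C. sgn y \<in> A}"
    by auto
  have "sgn -` A \<inter> space borel \<in> sets (borel :: (real ^ 3) measure)"
    using A'(2) by (rule measurable_sets[rotated]) measurable
  then have "sgn -` A \<inter> ?C \<in> sets borel"
    by auto
  then show "{y \<in> ?C. sgn y \<in> A} \<in> sets borel"
    by (simp add: eq)
  then show "emeasure sphere_measure A = 3 * emeasure lborel {y \<in> ?C. sgn y \<in> A}"
    unfolding sphere_measure_def
    by (simp only: emeasure_distr[OF m A'(1)] emeasure_scale_measure space_restrict_space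
      space_lborel Int_UNIV_right) (subst emeasure_restrict_space, auto simp del: Diff_iff simp: eq)
qed

text \<open>
  An orthogonal map commutes with \<open>sgn\<close>, so the cone over the preimage of a set is the preimage of the cone.
\<close>

lemma distr_sphere_measure_orthogonal:
  assumes f: "orthogonal_transformation f"
  shows "f \<in> measurable sphere_measure sphere_measure"
    and "distr sphere_measure sphere_measure f = sphere_measure"
proof -
  have nf: "norm (f x) = norm x" for x
    using f by (simp add: orthogonal_transformation)
  have lin: "linear f"
    using f by (simp add: orthogonal_transformation_linear)
  have cont: "continuous_on S f" for S
    using lin by (simp add: linear_continuous_on linear_conv_bounded_linear[symmetric])
  have "f \<in> measurable (restrict_space borel (sphere 0 1)) (restrict_space borel (sphere 0 1))"
    by (intro measurable_restrict_space2 borel_measurable_continuous_on_restrict cont)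
      (auto simp: space_restrict_space nf)
  then show m: "f \<in> measurable sphere_measure sphere_measure"
    by (simp add: measurable_cong_sets[OF sets_sphere_measure sets_sphere_measure])
  show "distr sphere_measure sphere_measure f = sphere_measure"
  proof (rule measure_eqI)
    fix A assume "A \<in> sets (distr sphere_measure sphere_measure f)"
    then have A: "A \<in> sets sphere_measure" by simp
    let ?C = "cball (0 :: real ^ 3) 1 - {0}"
    let ?S = "{y \<in> ?C. sgn y \<in> A}"
    have B: "f -` A \<inter> sphere 0 1 \<in> sets sphere_measure"
      using measurable_sets[OF m A] by simp
    have "sgn (f y) = f (sgn y)" for y
      using lin by (simp add: sgn_div_norm nf linear_scale)
    moreover have "f y = 0 \<longleftrightarrow> y = 0" for y
      by (metis nf norm_eq_zero)
    ultimately have "{y \<in> ?C. sgn y \<in> f -` A \<inter> sphere 0 1} = f -` ?S"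
      by (auto simp: nf norm_sgn)
    moreover have "emeasure lborel (f -` ?S) = emeasure lborel ?S"
    proof (rule lborel_orthogonal_vimage[OF f emeasure_sphere_measure_cone(2)[OF A]])
      have "emeasure lborel ?S \<le> emeasure lborel (cball (0 :: real ^ 3) 1)"
        by (intro emeasure_mono) auto
      also have "\<dots> < \<infinity>" using emeasure_bounded_finite[OF bounded_cball] by simp
      finally show "emeasure lborel ?S < \<infinity>" .
    qed
    ultimately show "emeasure (distr sphere_measure sphere_measure f) A = emeasure sphere_measure A"
      by (simp add: emeasure_distr[OF m A] emeasure_sphere_measure_cone(1)[OF A]
        emeasure_sphere_measure_cone(1)[OF B])
  qed simp
qed

lemma integral_sphere_measure_orthogonal:
  fixes f :: "real ^ 3 \<Rightarrow> real"
  assumes R: "orthogonal_transformation R" and f: "f \<in> borel_measurable sphere_measure"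
  shows "(\<integral>x. f (R x) \<partial>sphere_measure) = (\<integral>x. f x \<partial>sphere_measure)"
  using integral_distr[OF distr_sphere_measure_orthogonal(1)[OF R] f]
  by (simp add: distr_sphere_measure_orthogonal(2)[OF R])

text \<open>
  Rodrigues' formula for the rotation by \<open>\<theta>\<close> about the axis spanned by the unit vector \<open>a\<close>.
\<close>

definition axis_rotation :: "real ^ 3 \<Rightarrow> real \<Rightarrow> real ^ 3 \<Rightarrow> real ^ 3" where
  "axis_rotation a \<theta> x =
     cos \<theta> *\<^sub>R x + sin \<theta> *\<^sub>R cross3 a x + ((1 - cos \<theta>) * (a \<bullet> x)) *\<^sub>R a"

lemma axis_rotation_0 [simp]: "axis_rotation a 0 x = x"
  by (simp add: axis_rotation_def)

lemma norm_axis_rotation: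
  assumes "norm a = 1"
  shows "norm (axis_rotation a \<theta> x) = norm x"
proof -
  let ?c = "cos \<theta>" and ?s = "sin \<theta>"
  have a: "a \<bullet> a = 1" using assms by (simp add: norm_eq_1)
  have n: "cross3 a x \<bullet> cross3 a x = x \<bullet> x - (a \<bullet> x)\<^sup>2"
    using norm_cross_dot[of a x] assms by (simp add: power2_norm_eq_inner)
  have s: "?s\<^sup>2 = 1 - ?c\<^sup>2" by (simp add: sin_squared_eq)
  have "(norm (axis_rotation a \<theta> x))\<^sup>2 =
      ?c\<^sup>2 * (x \<bullet> x) + ?s\<^sup>2 * (x \<bullet> x - (a \<bullet> x)\<^sup>2) + ((1 - ?c) * (a \<bullet> x))\<^sup>2
      + 2 * ?c * (1 - ?c) * (a \<bullet> x)\<^sup>2"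
    unfolding power2_norm_eq_inner axis_rotation_def
    by (simp add: inner_add_left inner_add_right dot_cross_self n a inner_commute[of x a]
      inner_commute[of x "cross3 a x"]) (simp add: power2_eq_square algebra_simps)
  also have "\<dots> = (norm x)\<^sup>2"
    unfolding s power2_norm_eq_inner by (simp add: power2_eq_square algebra_simps)
  finally show ?thesis by (simp add: power2_eq_iff_nonneg)
qed

lemma orthogonal_transformation_axis_rotation:
  assumes "norm a = 1"
  shows "orthogonal_transformation (axis_rotation a \<theta>)"
  unfolding orthogonal_transformation
  by (auto intro!: linearI simp: norm_axis_rotation assms)
    (auto simp: axis_rotation_def cross_add_right cross_mult_right algebra_simps inner_add_right)

lemma axis_rotation_has_vector_derivative:
  assumes "norm a = 1"
  shows "((\<lambda>\<theta>. axis_rotation a \<theta> x) has_vector_derivative cross3 a (axis_rotation a \<theta> x)) (at \<theta>)"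
proof -
  have "cross3 a (cross3 a x) = (a \<bullet> x) *\<^sub>R a - x"
    using assms by (simp add: Lagrange norm_eq_1)
  then have **: "cross3 a (cross3 a x) = (a \<bullet> x) *\<^sub>R a - x" .
  have *: "cross3 a (axis_rotation a \<theta> x) =
      - sin \<theta> *\<^sub>R x + cos \<theta> *\<^sub>R cross3 a x + (sin \<theta> * (a \<bullet> x)) *\<^sub>R a"
    by (simp add: axis_rotation_def cross_add_right cross_mult_right ** scaleR_diff_right)
  show ?thesis unfolding *
    unfolding axis_rotation_def has_vector_derivative_def
    by (auto intro!: derivative_eq_intros simp: algebra_simps)
qed

text \<open>
  Differentiation under the integral sign: a common bound on the derivatives bounds all difference quotients,
  so dominated convergence applies along every sequence of increments.
\<close>

lemma has_real_derivative_integral: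
  fixes f f' :: "real \<Rightarrow> 'a \<Rightarrow> real"
  assumes int: "\<And>t. integrable M (f t)" and g: "integrable M g"
    and meas: "f' s \<in> borel_measurable M"
    and deriv: "\<And>t x. x \<in> space M \<Longrightarrow> ((\<lambda>t. f t x) has_real_derivative f' t x) (at t)"
    and bound: "\<And>t x. x \<in> space M \<Longrightarrow> \<bar>f' t x\<bar> \<le> g x"
  shows "((\<lambda>t. \<integral>x. f t x \<partial>M) has_real_derivative (\<integral>x. f' s x \<partial>M)) (at s)"
  unfolding DERIV_def tendsto_at_iff_sequentially comp_def
proof (intro allI impI)
  fix X :: "nat \<Rightarrow> real" assume X: "\<forall>i. X i \<in> UNIV - {0}" "X \<longlonglongrightarrow> 0"
  have lip: "\<bar>f (s + h) x - f s x\<bar> \<le> g x * \<bar>h\<bar>" if "x \<in> space M" for x h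
    using field_differentiable_bound[of UNIV "\<lambda>t. f t x" "\<lambda>t. f' t x" "g x" "s + h" s]
      deriv[OF that] bound[OF that] by (auto simp: has_field_derivative_at_within)
  have "(\<lambda>i. \<integral>x. (f (s + X i) x - f s x) / X i \<partial>M) \<longlonglongrightarrow> (\<integral>x. f' s x \<partial>M)"
  proof (rule integral_dominated_convergence[OF meas _ g])
    show "AE x in M. (\<lambda>i. (f (s + X i) x - f s x) / X i) \<longlonglongrightarrow> f' s x"
    proof (rule AE_I2)
      fix x assume "x \<in> space M"
      then have "((\<lambda>h. (f (s + h) x - f s x) / h) \<longlongrightarrow> f' s x) (at 0)"
        using deriv unfolding DERIV_def by blast
      then show "(\<lambda>i. (f (s + X i) x - f s x) / X i) \<longlonglongrightarrow> f' s x"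
        using X unfolding tendsto_at_iff_sequentially comp_def by blast
    qed
    show "AE x in M. norm ((f (s + X i) x - f s x) / X i) \<le> g x" for i
      using lip[of _ "X i"] X(1) by (intro AE_I2) (auto simp: field_simps)
  qed (use int in auto)
  then show "(\<lambda>i. ((\<integral>x. f (s + X i) x \<partial>M) - (\<integral>x. f s x \<partial>M)) / X i) \<longlonglongrightarrow> (\<integral>x. f' s x \<partial>M)"
    using int by simp
qed


section \<open>The Laplacian as a sum of squared rotational derivatives\<close>

lemma sum_Basis_3: "(\<Sum>a\<in>(Basis :: (real ^ 3) set). f a) = f (axis 1 1) + f (axis 2 1) + f (axis 3 1)"
proof -
  have B: "(Basis :: (real ^ 3) set) = (\<lambda>i. axis i 1) ` UNIV"
    by (auto simp: Basis_vec_def)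
  have inj: "inj (\<lambda>i :: 3. axis i (1 :: real))"
    by (auto simp: inj_def axis_eq_axis)
  show ?thesis
    unfolding B sum.reindex[OF inj] by (simp add: sum_3)
qed

text \<open>
  The function \<open>g\<close> is the derivative of \<open>f\<close> along the vector field \<open>x \<longmapsto> cross3 a x\<close>, which generates the
  rotations about \<open>a\<close>. Only values on the sphere enter, so no extension of \<open>f\<close> to the space is involved.
\<close>

definition has_rotation_derivative ::
  "real ^ 3 \<Rightarrow> (real ^ 3 \<Rightarrow> real) \<Rightarrow> (real ^ 3 \<Rightarrow> real) \<Rightarrow> bool" where
  "has_rotation_derivative a f g \<longleftrightarrow>
     continuous_on (sphere 0 1) f \<and> continuous_on (sphere 0 1) g \<and>
     (\<forall>x\<in>sphere 0 1. \<forall>\<theta>. ((\<lambda>\<theta>. f (axis_rotation a \<theta> x)) has_real_derivative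
        g (axis_rotation a \<theta> x)) (at \<theta>))"

text \<open>
  The integral of \<open>f\<close> over the rotated sphere is constant in the angle, and its derivative at angle zero
  is the integral of \<open>g\<close>.
\<close>

lemma integral_rotation_derivative_eq_0:
  assumes a: "norm a = 1" and fg: "has_rotation_derivative a f g"
  shows "(\<integral>x. g x \<partial>sphere_measure) = 0"
proof -
  note R = orthogonal_transformation_axis_rotation[OF a]
  have cont: "continuous_on (sphere 0 1) (\<lambda>x. h (axis_rotation a t x))"
    if "continuous_on (sphere 0 1) h" for h :: "real ^ 3 \<Rightarrow> real" and t
  proof (rule continuous_on_compose2[OF that])
    show "continuous_on (sphere 0 1) (axis_rotation a t)"
      using R[of t] by (intro linear_continuous_on)
        (simp add: orthogonal_transformation_linear linear_conv_bounded_linear[symmetric])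
  qed (auto simp: norm_axis_rotation a)
  have f: "continuous_on (sphere 0 1) f" and g: "continuous_on (sphere 0 1) g"
    using fg by (auto simp: has_rotation_derivative_def)
  have "compact (g ` sphere 0 1)"
    using g by (intro compact_continuous_image) auto
  then obtain B where B: "\<And>x. x \<in> sphere 0 1 \<Longrightarrow> norm (g x) \<le> B"
    by (meson bounded_iff compact_imp_bounded imageI)
  have "((\<lambda>t. \<integral>x. f (axis_rotation a t x) \<partial>sphere_measure) has_real_derivative
          (\<integral>x. g (axis_rotation a 0 x) \<partial>sphere_measure)) (at 0)"
  proof (rule has_real_derivative_integral[where g = "\<lambda>_. B"])
    show "integrable sphere_measure (\<lambda>x. f (axis_rotation a t x))" for t
      by (intro integrable_continuous_on_sphere cont f)
    show "(\<lambda>x. g (axis_rotation a 0 x)) \<in> borel_measurable sphere_measure"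
      by (intro measurable_continuous_on_sphere cont g)
    show "integrable sphere_measure (\<lambda>_. B)"
      by (intro integrable_continuous_on_sphere continuous_intros)
  qed (use fg B in \<open>auto simp: has_rotation_derivative_def norm_axis_rotation a\<close>)
  moreover have "(\<lambda>t. \<integral>x. f (axis_rotation a t x) \<partial>sphere_measure) = (\<lambda>t. \<integral>x. f x \<partial>sphere_measure)"
    by (intro ext integral_sphere_measure_orthogonal[OF R] measurable_continuous_on_sphere f)
  ultimately show ?thesis
    using DERIV_unique[OF _ DERIV_const] by simp
qed

lemma has_rotation_derivative_mult:
  assumes "has_rotation_derivative a f f'" "has_rotation_derivative a g g'"
  shows "has_rotation_derivative a (\<lambda>x. f x * g x) (\<lambda>x. f' x * g x + f x * g' x)"
  using assms unfolding has_rotation_derivative_def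
  by (auto intro!: continuous_intros derivative_eq_intros)

lemma integral_rotation_by_parts:
  assumes a: "norm a = 1"
    and f: "has_rotation_derivative a f f'" and g: "has_rotation_derivative a g g'"
  shows "(\<integral>x. f' x * g x \<partial>sphere_measure) = - (\<integral>x. f x * g' x \<partial>sphere_measure)"
proof -
  have "integrable sphere_measure (\<lambda>x. f' x * g x)" "integrable sphere_measure (\<lambda>x. f x * g' x)"
    using f g unfolding has_rotation_derivative_def
    by (auto intro!: integrable_continuous_on_sphere continuous_intros)
  then show ?thesis
    using integral_rotation_derivative_eq_0[OF a has_rotation_derivative_mult[OF f g]]
    by simp
qed

lemma integral_rotation_green:
  assumes "norm a = 1"
    and "has_rotation_derivative a f f1" "has_rotation_derivative a f1 f2"
    and "has_rotation_derivative a g g1" "has_rotation_derivative a g1 g2"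
  shows "(\<integral>x. f2 x * g x \<partial>sphere_measure) = (\<integral>x. f x * g2 x \<partial>sphere_measure)"
  using integral_rotation_by_parts[OF assms(1,3,4)] integral_rotation_by_parts[OF assms(1,2,5)]
  by simp

definition has_rotation_laplacian :: "(real ^ 3 \<Rightarrow> real) \<Rightarrow> (real ^ 3 \<Rightarrow> real) \<Rightarrow> bool" where
  "has_rotation_laplacian f g \<longleftrightarrow>
     (\<exists>f1 f2. (\<forall>a\<in>Basis. has_rotation_derivative a f (f1 a) \<and> has_rotation_derivative a (f1 a) (f2 a)) \<and>
        (\<forall>x\<in>sphere 0 1. g x = (\<Sum>a\<in>Basis. f2 a x)))"

text \<open>
  Integrating by parts twice about each axis gives Green's identity on the sphere.
\<close>

lemma has_rotation_laplacian_self_adjoint: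
  assumes "has_rotation_laplacian f f'" "has_rotation_laplacian g g'"
  shows "(\<integral>x. f' x * g x \<partial>sphere_measure) = (\<integral>x. f x * g' x \<partial>sphere_measure)"
proof -
  obtain f1 f2 where f: "\<forall>a\<in>Basis. has_rotation_derivative a f (f1 a) \<and> has_rotation_derivative a (f1 a) (f2 a)"
      and f3: "\<forall>x\<in>sphere 0 1. f' x = (\<Sum>a\<in>Basis. f2 a x)"
    using assms(1) unfolding has_rotation_laplacian_def by blast
  obtain g1 g2 where g: "\<forall>a\<in>Basis. has_rotation_derivative a g (g1 a) \<and> has_rotation_derivative a (g1 a) (g2 a)"
      and g3: "\<forall>x\<in>sphere 0 1. g' x = (\<Sum>a\<in>Basis. g2 a x)"
    using assms(2) unfolding has_rotation_laplacian_def by blast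
  have int: "integrable sphere_measure (\<lambda>x. f2 a x * g x)" "integrable sphere_measure (\<lambda>x. f x * g2 a x)"
    if "a \<in> Basis" for a
    using bspec[OF f that] bspec[OF g that] unfolding has_rotation_derivative_def
    by (auto intro!: integrable_continuous_on_sphere continuous_intros)
  have "(\<integral>x. f' x * g x \<partial>sphere_measure) = (\<integral>x. (\<Sum>a\<in>Basis. f2 a x * g x) \<partial>sphere_measure)"
    by (intro Bochner_Integration.integral_cong) (auto simp: f3 sum_distrib_right)
  also have "\<dots> = (\<Sum>a\<in>Basis. \<integral>x. f2 a x * g x \<partial>sphere_measure)"
    by (intro Bochner_Integration.integral_sum int)
  also have "\<dots> = (\<Sum>a\<in>Basis. \<integral>x. f x * g2 a x \<partial>sphere_measure)"
  proof (rule sum.cong[OF refl])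
    fix a :: "real ^ 3" assume "a \<in> Basis"
    then show "(\<integral>x. f2 a x * g x \<partial>sphere_measure) = (\<integral>x. f x * g2 a x \<partial>sphere_measure)"
      using integral_rotation_green f g norm_Basis by blast
  qed
  also have "\<dots> = (\<integral>x. (\<Sum>a\<in>Basis. f x * g2 a x) \<partial>sphere_measure)"
    by (intro Bochner_Integration.integral_sum[symmetric] int)
  also have "\<dots> = (\<integral>x. f x * g' x \<partial>sphere_measure)"
    by (intro Bochner_Integration.integral_cong) (auto simp: g3 sum_distrib_left)
  finally show ?thesis .
qed

lemma sum_cross3_cross3: "(\<Sum>a\<in>Basis. cross3 a (cross3 a x)) = - 2 *\<^sub>R x"
proof -
  have "axis i 1 \<bullet> x = x $ i" for i
    by (subst inner_commute) (simp add: inner_axis)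
  then show ?thesis
    by (simp add: sum_Basis_3 Lagrange vec_eq_iff forall_3) (simp add: axis_def)
qed

text \<open>
  By the triple product identity the summands are the squared coordinates of \<open>cross3 x \<xi>\<close>.
\<close>

lemma sum_square_cross3_inner:
  assumes "norm x = 1" "norm \<xi> = 1"
  shows "(\<Sum>a\<in>Basis. (cross3 a x \<bullet> \<xi>)\<^sup>2) = 1 - (x \<bullet> \<xi>)\<^sup>2"
proof -
  have "(\<Sum>a\<in>Basis. (cross3 a x \<bullet> \<xi>)\<^sup>2) = (\<Sum>a\<in>Basis. (cross3 x \<xi> \<bullet> a) * (cross3 x \<xi> \<bullet> a))"
    by (intro sum.cong refl) (simp add: cross_triple power2_eq_square)
  also have "\<dots> = cross3 x \<xi> \<bullet> cross3 x \<xi>"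
    by (simp add: euclidean_inner[symmetric])
  also have "\<dots> = 1 - (x \<bullet> \<xi>)\<^sup>2"
    using norm_cross_dot[of x \<xi>] assms by (simp add: power2_norm_eq_inner)
  finally show ?thesis .
qed

lemma has_rotation_derivative_inner:
  assumes "norm a = 1" and L: "bounded_linear L"
  shows "has_rotation_derivative a L (\<lambda>x. L (cross3 a x))"
proof -
  have "bounded_linear (cross3 a)"
    using bilinear_cross by (simp add: bilinear_def linear_conv_bounded_linear)
  then have "continuous_on S (cross3 a)" for S
    by (rule linear_continuous_on)
  then have c: "continuous_on S (\<lambda>x. L (cross3 a x))" for S
    by (rule continuous_on_compose2[OF linear_continuous_on[OF L]]) auto
  have "((\<lambda>\<theta>. L (axis_rotation a \<theta> x)) has_real_derivative L (cross3 a (axis_rotation a \<theta> x))) (at \<theta>)" for x \<theta>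
    using bounded_linear.has_vector_derivative[OF L axis_rotation_has_vector_derivative[OF assms(1)]]
    by (simp add: has_real_derivative_iff_has_vector_derivative)
  then show ?thesis
    using c linear_continuous_on[OF L] by (auto simp: has_rotation_derivative_def)
qed

lemma has_rotation_derivative_poly:
  assumes "has_rotation_derivative a f f'"
  shows "has_rotation_derivative a (\<lambda>x. poly p (f x)) (\<lambda>x. poly (pderiv p) (f x) * f' x)"
  using assms unfolding has_rotation_derivative_def
  by (auto intro!: continuous_intros DERIV_chain2[OF poly_DERIV])

lemma has_rotation_derivative_zonal:
  assumes "norm a = 1"
  shows "has_rotation_derivative a (\<lambda>x. poly p (x \<bullet> \<xi>)) (\<lambda>x. poly (pderiv p) (x \<bullet> \<xi>) * (cross3 a x \<bullet> \<xi>))"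
    and "has_rotation_derivative a (\<lambda>x. poly p (x \<bullet> \<xi>) * (cross3 a x \<bullet> \<xi>))
      (\<lambda>x. poly (pderiv p) (x \<bullet> \<xi>) * (cross3 a x \<bullet> \<xi>)\<^sup>2 + poly p (x \<bullet> \<xi>) * (cross3 a (cross3 a x) \<bullet> \<xi>))"
proof -
  have "bounded_linear (cross3 a)"
    using bilinear_cross by (simp add: bilinear_def linear_conv_bounded_linear)
  then have L: "bounded_linear (\<lambda>x. cross3 a x \<bullet> \<xi>)"
    by (rule bounded_linear_compose[OF bounded_linear_inner_left])
  note 1 = has_rotation_derivative_inner[OF assms bounded_linear_inner_left[of \<xi>]]
  note 2 = has_rotation_derivative_inner[OF assms L]
  show 3: "has_rotation_derivative a (\<lambda>x. poly p (x \<bullet> \<xi>)) (\<lambda>x. poly (pderiv p) (x \<bullet> \<xi>) * (cross3 a x \<bullet> \<xi>))" for p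
    by (rule has_rotation_derivative_poly[OF 1])
  show "has_rotation_derivative a (\<lambda>x. poly p (x \<bullet> \<xi>) * (cross3 a x \<bullet> \<xi>))
      (\<lambda>x. poly (pderiv p) (x \<bullet> \<xi>) * (cross3 a x \<bullet> \<xi>)\<^sup>2 + poly p (x \<bullet> \<xi>) * (cross3 a (cross3 a x) \<bullet> \<xi>))"
    using has_rotation_derivative_mult[OF 3[of p] 2] by (simp add: power2_eq_square mult.assoc)
qed

lemma sum_zonal:
  assumes "norm x = 1" "norm \<xi> = 1"
  shows "(\<Sum>a\<in>Basis. q * (cross3 a x \<bullet> \<xi>)\<^sup>2 + r * (cross3 a (cross3 a x) \<bullet> \<xi>)) =
    q * (1 - (x \<bullet> \<xi>)\<^sup>2) - 2 * r * (x \<bullet> \<xi>)"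
proof -
  have "(\<Sum>a\<in>Basis. cross3 a (cross3 a x) \<bullet> \<xi>) = - 2 * (x \<bullet> \<xi>)"
    by (simp add: sum_cross3_cross3 flip: inner_sum_left)
  then show ?thesis
    by (simp add: sum.distrib flip: sum_distrib_left sum_square_cross3_inner[OF assms])
qed

lemma poly_pderiv_weighted:
  "poly (pderiv ([:1, 0, -1:] * p)) s = poly (pderiv p) s * (1 - s\<^sup>2) - 2 * poly p s * (s :: real)"
  unfolding pderiv_mult by (simp add: pderiv_pCons algebra_simps power2_eq_square)

text \<open>
  On functions of \<open>s = x \<bullet> \<xi>\<close> the Laplacian is the Legendre operator \<open>p \<longmapsto> ((1 - s\<^sup>2) p')'\<close>.
\<close>

lemma has_rotation_laplacian_zonal:
  assumes "norm \<xi> = 1"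
  shows "has_rotation_laplacian (\<lambda>x. poly p (x \<bullet> \<xi>)) (\<lambda>x. poly (pderiv ([:1, 0, -1:] * pderiv p)) (x \<bullet> \<xi>))"
  unfolding has_rotation_laplacian_def
proof (rule exI[of _ "\<lambda>a x. poly (pderiv p) (x \<bullet> \<xi>) * (cross3 a x \<bullet> \<xi>)"],
    rule exI[of _ "\<lambda>a x. poly (pderiv (pderiv p)) (x \<bullet> \<xi>) * (cross3 a x \<bullet> \<xi>)\<^sup>2
      + poly (pderiv p) (x \<bullet> \<xi>) * (cross3 a (cross3 a x) \<bullet> \<xi>)"], intro conjI ballI)
  fix x :: "real ^ 3" assume "x \<in> sphere 0 1"
  then show "poly (pderiv ([:1, 0, -1:] * pderiv p)) (x \<bullet> \<xi>) =
    (\<Sum>a\<in>Basis. poly (pderiv (pderiv p)) (x \<bullet> \<xi>) * (cross3 a x \<bullet> \<xi>)\<^sup>2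
      + poly (pderiv p) (x \<bullet> \<xi>) * (cross3 a (cross3 a x) \<bullet> \<xi>))"
    using assms by (simp only: sum_zonal mem_sphere_0)
      (simp only: poly_pderiv_weighted)
qed (auto intro!: has_rotation_derivative_zonal)

text \<open>
  The integrand is the divergence of the tangential field \<open>p (x \<bullet> \<xi>) * (cross3 a x \<bullet> \<xi>)\<close>, summed over the axes.
  In substance this is the hat-box theorem of Archimedes: \<open>p \<longmapsto> (\<integral>x. poly p (x \<bullet> \<xi>))\<close> is a multiple of integration over
  \<open>{-1..1}\<close>, because it vanishes on derivatives of polynomials that vanish at both end points.
\<close>

lemma integral_zonal_divergence:
  assumes "norm \<xi> = 1"
  shows "(\<integral>x. poly (pderiv ([:1, 0, -1:] * p)) (x \<bullet> \<xi>) \<partial>sphere_measure) = 0"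
proof -
  let ?g = "\<lambda>a x. poly (pderiv p) (x \<bullet> \<xi>) * (cross3 a x \<bullet> \<xi>)\<^sup>2
      + poly p (x \<bullet> \<xi>) * (cross3 a (cross3 a x) \<bullet> \<xi>)"
  have d: "has_rotation_derivative a (\<lambda>x. poly p (x \<bullet> \<xi>) * (cross3 a x \<bullet> \<xi>)) (?g a)"
    if "a \<in> Basis" for a
    using that by (intro has_rotation_derivative_zonal) auto
  have "(\<integral>x. poly (pderiv ([:1, 0, -1:] * p)) (x \<bullet> \<xi>) \<partial>sphere_measure) =
    (\<integral>x. (\<Sum>a\<in>Basis. ?g a x) \<partial>sphere_measure)"
  proof (intro Bochner_Integration.integral_cong refl)
    fix x :: "real ^ 3" assume "x \<in> space sphere_measure"
    then show "poly (pderiv ([:1, 0, -1:] * p)) (x \<bullet> \<xi>) = (\<Sum>a\<in>Basis. ?g a x)"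
      using assms by (simp only: sum_zonal mem_sphere_0 space_sphere_measure)
        (simp only: poly_pderiv_weighted)
  qed
  also have "\<dots> = (\<Sum>a\<in>Basis. \<integral>x. ?g a x \<partial>sphere_measure)"
    using d by (intro Bochner_Integration.integral_sum integrable_continuous_on_sphere)
      (auto simp: has_rotation_derivative_def)
  also have "\<dots> = 0"
    by (intro sum.neutral ballI integral_rotation_derivative_eq_0[OF _ d]) auto
  finally show ?thesis .
qed


text \<open>
  For a unit vector \<open>x\<close>, the fields \<open>cross3 a x\<close> resolve the tangent plane at \<open>x\<close>, so that
  the sum is the trace of \<open>B\<close> over that plane.
\<close>

lemma sum_cross3_blinfun:
  fixes B :: "(real ^ 3) \<Rightarrow>\<^sub>L (real ^ 3) \<Rightarrow>\<^sub>L real"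
  shows "(\<Sum>a\<in>Basis. B (cross3 a x) (cross3 a x)) = (x \<bullet> x) * (\<Sum>b\<in>Basis. B b b) - B x x"
proof -
  define e1 e2 e3 :: "real ^ 3" where e: "e1 = axis 1 1" "e2 = axis 2 1" "e3 = axis 3 1"
  define x1 x2 x3 where xi: "x1 = x $ 1" "x2 = x $ 2" "x3 = x $ 3"
  have x: "x = x1 *\<^sub>R e1 + x2 *\<^sub>R e2 + x3 *\<^sub>R e3"
    by (simp add: e xi vec_eq_iff forall_3) (simp add: axis_def)
  have c: "cross3 e1 x = x2 *\<^sub>R e3 - x3 *\<^sub>R e2" "cross3 e2 x = x3 *\<^sub>R e1 - x1 *\<^sub>R e3"
    "cross3 e3 x = x1 *\<^sub>R e2 - x2 *\<^sub>R e1"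
    by (simp_all add: e xi vec_eq_iff forall_3 cross_components) (simp_all add: axis_def)
  have xx: "x \<bullet> x = x1\<^sup>2 + x2\<^sup>2 + x3\<^sup>2"
    by (simp add: xi inner_vec_def sum_3 power2_eq_square)
  have Bxx: "B x x = x1 * (x1 * B e1 e1 + x2 * B e1 e2 + x3 * B e1 e3)
      + x2 * (x1 * B e2 e1 + x2 * B e2 e2 + x3 * B e2 e3)
      + x3 * (x1 * B e3 e1 + x2 * B e3 e2 + x3 * B e3 e3)"
    by (subst (1 2) x) (simp add: blinfun.bilinear_simps algebra_simps)
  show ?thesis
    unfolding sum_Basis_3 e[symmetric] c xx Bxx
    by (simp add: blinfun.bilinear_simps algebra_simps power2_eq_square)
qed

text \<open>
  The squared rotational derivatives of the degree 0 extension sum up to its second derivative traced over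
  the tangent plane minus twice its radial derivative. Both the radial derivative and the second radial
  derivative of the extension vanish by homogeneity, so what remains is the Euclidean Laplacian.
\<close>

lemma has_sphere_laplacian_imp_rotation:
  assumes "has_sphere_laplacian f g"
  shows "has_rotation_laplacian f g"
proof -
  obtain D1 :: "real ^ 3 \<Rightarrow> (real ^ 3) \<Rightarrow>\<^sub>L real"
    and D2 :: "real ^ 3 \<Rightarrow> (real ^ 3) \<Rightarrow>\<^sub>L (real ^ 3) \<Rightarrow>\<^sub>L real" where
    D1: "\<And>y. y \<noteq> 0 \<Longrightarrow> ((\<lambda>y. f (sgn y)) has_derivative blinfun_apply (D1 y)) (at y)" and
    D2: "\<And>y. y \<noteq> 0 \<Longrightarrow> (D1 has_derivative blinfun_apply (D2 y)) (at y)" and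
    cD2: "continuous_on (- {0}) D2" and g: "\<And>x. x \<in> sphere 0 1 \<Longrightarrow> g x = (\<Sum>b\<in>Basis. D2 x b b)"
    using assms unfolding has_sphere_laplacian_def by blast
  have sgn: "sgn x = x" if "x \<in> sphere 0 1" for x :: "real ^ 3"
    using that by (simp add: sgn_div_norm)
  \<comment> \<open>The extension is constant on rays.\<close>
  have radial1: "D1 y y = 0" if "y \<noteq> 0" for y
  proof -
    have "((\<lambda>s. s *\<^sub>R y) has_vector_derivative y) (at 1)"
      by (auto intro!: derivative_eq_intros simp: has_vector_derivative_def)
    then have "(((\<lambda>y. f (sgn y)) \<circ> (\<lambda>s. s *\<^sub>R y)) has_vector_derivative D1 y y) (at (1::real))"
      using D1[OF that] by (intro vector_derivative_diff_chain_within) (auto intro: has_derivative_at_withinI)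
    moreover have "(((\<lambda>y. f (sgn y)) \<circ> (\<lambda>s. s *\<^sub>R y)) has_vector_derivative 0) (at (1::real))"
      by (rule has_vector_derivative_transform_within_open[of "\<lambda>_. f (sgn y)" _ _ "{0<..}"])
        (auto simp: sgn_scaleR)
    ultimately show ?thesis
      by (rule vector_derivative_unique_at)
  qed
  \<comment> \<open>Differentiate the identity for the radial derivative once more along the ray.\<close>
  have radial2: "D2 y y y = 0" if "y \<noteq> 0" for y
  proof -
    have "((\<lambda>y. D1 y y) has_derivative (\<lambda>h. D1 y h + D2 y h y)) (at y)"
      using bounded_bilinear.FDERIV[OF bounded_bilinear_blinfun_apply D2[OF that] has_derivative_ident] .
    moreover have "((\<lambda>y. D1 y y) has_derivative (\<lambda>h. 0)) (at y)"
      by (rule has_derivative_transform_within_open[of "\<lambda>_. 0" _ _ _ "- {0}"])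
        (use that radial1 in auto)
    ultimately have "(\<lambda>h. D1 y h + D2 y h y) = (\<lambda>h. 0)"
      by (rule has_derivative_unique)
    from fun_cong[OF this, of y] show ?thesis
      using radial1[OF that] by simp
  qed
  have c1: "continuous_on (sphere 0 1) D1"
    by (rule has_derivative_continuous_on, rule has_derivative_at_withinI, rule D2) auto
  have c2: "continuous_on (sphere 0 1) D2"
    by (rule continuous_on_subset[OF cD2]) auto
  have "continuous_on (sphere 0 1) (\<lambda>y. f (sgn y))"
    by (rule has_derivative_continuous_on, rule has_derivative_at_withinI, rule D1) auto
  then have c0: "continuous_on (sphere 0 1) f"
    by (rule continuous_on_eq) (simp add: sgn)
  have cc: "continuous_on S (\<lambda>x. cross3 a (h x))" if "continuous_on S h" for S a and h :: "real ^ 3 \<Rightarrow> real ^ 3"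
    using that by (intro continuous_on_cross continuous_on_const)
  note ccs = bounded_bilinear.continuous_on[OF bounded_bilinear_blinfun_apply]
  let ?f1 = "\<lambda>a x. D1 x (cross3 a x)"
  let ?f2 = "\<lambda>a x. D2 x (cross3 a x) (cross3 a x) + D1 x (cross3 a (cross3 a x))"
  have *: "has_rotation_derivative a f (?f1 a)" "has_rotation_derivative a (?f1 a) (?f2 a)"
    if "a \<in> Basis" for a
  proof -
    have a: "norm a = 1" using that by simp
    note R = norm_axis_rotation[OF a]
    have nz: "axis_rotation a \<theta> x \<noteq> 0" if "x \<in> sphere 0 1" for x \<theta>
      using R[of \<theta> x] that by auto
    have "((\<lambda>\<theta>. f (sgn (axis_rotation a \<theta> x))) has_real_derivative
        ?f1 a (axis_rotation a \<theta> x)) (at \<theta>)" if "x \<in> sphere 0 1" for x \<theta>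
      using vector_derivative_diff_chain_within[OF axis_rotation_has_vector_derivative[OF a]
          has_derivative_at_withinI[OF D1[OF nz[OF that]]]]
      by (simp add: o_def has_real_derivative_iff_has_vector_derivative)
    moreover have "sgn (axis_rotation a \<theta> x) = axis_rotation a \<theta> x" if "x \<in> sphere 0 1" for x \<theta>
      using that by (intro sgn) (simp add: R)
    moreover have c1': "continuous_on (sphere 0 1) (?f1 a)"
      by (intro ccs c1 cc continuous_on_id)
    ultimately show "has_rotation_derivative a f (?f1 a)"
      using c0 by (simp add: has_rotation_derivative_def)
    have lin: "bounded_linear (cross3 a)"
      using bilinear_cross by (simp add: bilinear_def linear_conv_bounded_linear)
    have dd: "(?f1 a has_derivative (\<lambda>h. D1 y (cross3 a h) + D2 y h (cross3 a y))) (at y)" if "y \<noteq> 0" for y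
      using bounded_bilinear.FDERIV[OF bounded_bilinear_blinfun_apply D2[OF that]
          bounded_linear.has_derivative[OF lin has_derivative_ident]] .
    have "((\<lambda>\<theta>. ?f1 a (axis_rotation a \<theta> x)) has_real_derivative
        ?f2 a (axis_rotation a \<theta> x)) (at \<theta>)" if "x \<in> sphere 0 1" for x \<theta>
      using vector_derivative_diff_chain_within[OF axis_rotation_has_vector_derivative[OF a]
          has_derivative_at_withinI[OF dd[OF nz[OF that]]]]
      by (simp add: o_def has_real_derivative_iff_has_vector_derivative add.commute)
    moreover have "continuous_on (sphere 0 1) (?f2 a)"
      by (intro continuous_on_add ccs c1 c2 cc continuous_on_id)
    ultimately show "has_rotation_derivative a (?f1 a) (?f2 a)"
      using c1' by (simp add: has_rotation_derivative_def)
  qed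
  have "g x = (\<Sum>a\<in>Basis. ?f2 a x)" if x: "x \<in> sphere 0 1" for x
  proof -
    have x0: "x \<noteq> 0" and xx: "x \<bullet> x = 1" using x by (auto simp: norm_eq_1)
    have "(\<Sum>a\<in>Basis. D1 x (cross3 a (cross3 a x))) = D1 x (\<Sum>a\<in>Basis. cross3 a (cross3 a x))"
      by (simp add: blinfun.sum_right)
    also have "\<dots> = 0"
      by (simp only: sum_cross3_cross3 blinfun.scaleR_right radial1[OF x0] scaleR_zero_right)
    finally show ?thesis
      by (simp add: sum.distrib sum_cross3_blinfun xx radial2[OF x0] g[OF x])
  qed
  with * show ?thesis
    unfolding has_rotation_laplacian_def
    by - (rule exI[of _ ?f1], rule exI[of _ ?f2], blast)
qed

section \<open>Legendre functions on the sphere\<close>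

lemma higher_pderiv_mult_linear:
  fixes u :: "real poly"
  shows "(pderiv ^^ Suc n) ([:0, 1:] * u) =
    [:0, 1:] * (pderiv ^^ Suc n) u + smult (real (Suc n)) ((pderiv ^^ n) u)"
proof (induction n)
  case 0
  show ?case unfolding pderiv_mult by (simp add: pderiv_mult pderiv_pCons)
next
  case (Suc n)
  have "(pderiv ^^ Suc (Suc n)) ([:0, 1:] * u) = pderiv ((pderiv ^^ Suc n) ([:0, 1:] * u))"
    by simp
  also have "\<dots> = pderiv ([:0, 1:] * (pderiv ^^ Suc n) u + smult (real (Suc n)) ((pderiv ^^ n) u))"
    unfolding Suc ..
  also have "\<dots> = [:0, 1:] * (pderiv ^^ Suc (Suc n)) u + smult (real (Suc (Suc n))) ((pderiv ^^ Suc n) u)"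
    unfolding pderiv_add pderiv_mult pderiv_smult
    by (rule poly_eq_poly_eq_iff[THEN iffD1], rule ext) (simp add: pderiv_pCons algebra_simps)
  finally show ?case .
qed


lemma higher_pderiv_mult_quadratic:
  fixes u :: "real poly"
  shows "(pderiv ^^ Suc (Suc n)) ([:-1, 0, 1:] * u) =
    [:-1, 0, 1:] * (pderiv ^^ Suc (Suc n)) u + smult (2 * real (Suc (Suc n))) ([:0, 1:] * (pderiv ^^ Suc n) u)
    + smult (real (Suc (Suc n)) * real (Suc n)) ((pderiv ^^ n) u)"
proof (induction n)
  case 0
  have 1: "pderiv ([:-1, 0, 1:] * v) = [:-1, 0, 1:] * pderiv v + smult 2 ([:0, 1:] * v)" for v :: "real poly"
    unfolding pderiv_mult by (simp add: pderiv_pCons)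
  have 2: "pderiv ([:0, 1:] * v) = [:0, 1:] * pderiv v + v" for v :: "real poly"
    unfolding pderiv_mult by (simp add: pderiv_pCons)
  show ?case
    unfolding funpow.simps o_apply id_apply 1 pderiv_add pderiv_smult 2
    by (rule poly_eq_poly_eq_iff[THEN iffD1], rule ext) (simp add: algebra_simps)
next
  case (Suc n)
  have "(pderiv ^^ Suc (Suc (Suc n))) ([:-1, 0, 1:] * u) = pderiv ((pderiv ^^ Suc (Suc n)) ([:-1, 0, 1:] * u))"
    by simp
  also have "\<dots> = pderiv ([:-1, 0, 1:] * (pderiv ^^ Suc (Suc n)) u + smult (2 * real (Suc (Suc n))) ([:0, 1:] * (pderiv ^^ Suc n) u)
    + smult (real (Suc (Suc n)) * real (Suc n)) ((pderiv ^^ n) u))"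
    unfolding Suc ..
  also have "\<dots> = [:-1, 0, 1:] * (pderiv ^^ Suc (Suc (Suc n))) u + smult (2 * real (Suc (Suc (Suc n)))) ([:0, 1:] * (pderiv ^^ Suc (Suc n)) u)
    + smult (real (Suc (Suc (Suc n))) * real (Suc (Suc n))) ((pderiv ^^ Suc n) u)"
    unfolding pderiv_add pderiv_mult pderiv_smult
    by (rule poly_eq_poly_eq_iff[THEN iffD1], rule ext) (simp add: pderiv_pCons algebra_simps)
  finally show ?case .
qed

text \<open>
  The polynomial \<open>w = (s\<^sup>2 - 1)\<^sup>l\<close> satisfies \<open>(s\<^sup>2 - 1) w' = 2 l s w\<close>. Differentiating this \<open>l + 1\<close> times by
  Leibniz' rule gives the Legendre equation for the \<open>l\<close>-th derivative of \<open>w\<close>.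
\<close>

lemma legendre_ode:
  "pderiv ([:1, 0, -1:] * pderiv (legendre l)) = smult (- (real l * (real l + 1))) (legendre l)"
proof (cases l)
  case 0
  then show ?thesis by (simp add: legendre_def)
next
  case (Suc n)
  let ?q = "[:-1, 0, 1:] :: real poly"
  define w where "w = ?q ^ l"
  have "?q * pderiv w = smult (2 * real l) ([:0, 1:] * w)"
    unfolding w_def Suc pderiv_power_Suc
    by (rule poly_eq_poly_eq_iff[THEN iffD1], rule ext) (simp add: pderiv_pCons algebra_simps)
  then have "(pderiv ^^ Suc (Suc n)) (?q * pderiv w) = smult (2 * real l) ((pderiv ^^ Suc (Suc n)) ([:0, 1:] * w))"
    by (simp only: higher_pderiv_smult)
  then have ode: "?q * (pderiv ^^ Suc (Suc n)) (pderiv w)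
      + smult (2 * real (Suc (Suc n))) ([:0, 1:] * (pderiv ^^ Suc n) (pderiv w))
      + smult (real (Suc (Suc n)) * real (Suc n)) ((pderiv ^^ n) (pderiv w)) =
    smult (2 * real l) ([:0, 1:] * (pderiv ^^ Suc (Suc n)) w + smult (real (Suc (Suc n))) ((pderiv ^^ Suc n) w))"
    unfolding higher_pderiv_mult_quadratic higher_pderiv_mult_linear .
  define P where "P = (pderiv ^^ l) w"
  have P: "(pderiv ^^ n) (pderiv w) = P" "(pderiv ^^ Suc n) w = P" "(pderiv ^^ Suc n) (pderiv w) = pderiv P"
    "(pderiv ^^ Suc (Suc n)) w = pderiv P" "(pderiv ^^ Suc (Suc n)) (pderiv w) = pderiv (pderiv P)"
    unfolding P_def Suc by (simp_all add: funpow_swap1)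
  have ode': "?q * pderiv (pderiv P) + smult (2 * real (Suc (Suc n))) ([:0, 1:] * pderiv P)
      + smult (real (Suc (Suc n)) * real (Suc n)) P =
    smult (2 * real l) ([:0, 1:] * pderiv P + smult (real (Suc (Suc n))) P)"
    using ode unfolding P .
  have "poly (pderiv ([:1, 0, -1:] * pderiv P)) s = - (real l * (real l + 1)) * poly P s" for s
    using arg_cong[OF ode', of "\<lambda>p. poly p s"] unfolding poly_pderiv_weighted Suc
    by (simp add: algebra_simps power2_eq_square)
  then have "pderiv ([:1, 0, -1:] * pderiv P) = smult (- (real l * (real l + 1))) P"
    by (intro poly_eq_poly_eq_iff[THEN iffD1] ext) simp
  moreover have "legendre l = smult (1 / (2 ^ l * fact l)) P"
    by (simp add: legendre_def P_def w_def)
  ultimately show ?thesis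
    by (simp only: pderiv_smult mult_smult_right smult_smult mult.commute)
qed

lemma continuous_on_zonal: "continuous_on S (\<lambda>x. poly p (x \<bullet> \<xi>) :: real)"
  by (intro continuous_intros)

lemma integrable_zonal: "integrable sphere_measure (\<lambda>x. poly p (x \<bullet> \<xi>))"
  by (intro integrable_continuous_on_sphere continuous_on_zonal)

text \<open>
  By the Legendre equation, \<open>- l (l + 1) P\<^sub>l\<close> is a divergence, and the factor is nonzero for \<open>l \<ge> 1\<close>.
\<close>

lemma integral_legendre_zonal:
  assumes "norm \<xi> = 1" "l \<ge> 1"
  shows "(\<integral>x. poly (legendre l) (x \<bullet> \<xi>) \<partial>sphere_measure) = 0"
  using integral_zonal_divergence[OF assms(1), of "pderiv (legendre l)"] assms(2)
  unfolding legendre_ode by simp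

lemma power_dvd_pderiv:
  fixes p q :: "real poly"
  assumes "q ^ Suc n dvd p"
  shows "q ^ n dvd pderiv p"
proof -
  obtain r where "p = q ^ Suc n * r" using assms by (auto elim: dvdE)
  then have "pderiv p = q ^ n * (q * pderiv r + smult (of_nat (Suc n)) (pderiv q * r))"
    by (simp only: pderiv_mult pderiv_power_Suc) (simp add: algebra_simps)
  then show ?thesis by (rule dvdI)
qed

lemma integral_zonal_by_parts:
  assumes "norm \<xi> = 1" "[:-1, 0, 1:] dvd u * v"
  shows "(\<integral>x. poly (pderiv u * v) (x \<bullet> \<xi>) \<partial>sphere_measure) = - (\<integral>x. poly (u * pderiv v) (x \<bullet> \<xi>) \<partial>sphere_measure)"
proof -
  obtain r where "u * v = [:-1, 0, 1:] * r" using assms(2) by (auto elim: dvdE)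
  also have "\<dots> = [:1, 0, -1:] * (- r)"
    by (rule poly_eq_poly_eq_iff[THEN iffD1], rule ext) (simp add: algebra_simps)
  finally have "(\<integral>x. poly (pderiv (u * v)) (x \<bullet> \<xi>) \<partial>sphere_measure) = 0"
    using integral_zonal_divergence[OF assms(1), of "- r"] by simp
  moreover have "(\<integral>x. poly (pderiv (u * v)) (x \<bullet> \<xi>) \<partial>sphere_measure) =
      (\<integral>x. poly (pderiv u * v) (x \<bullet> \<xi>) + poly (u * pderiv v) (x \<bullet> \<xi>) \<partial>sphere_measure)"
    by (intro Bochner_Integration.integral_cong) (auto simp: pderiv_mult)
  ultimately show ?thesis
    using integrable_zonal by (simp only: Bochner_Integration.integral_add)
qed

text \<open>
  Applied to \<open>s (1 - s\<^sup>2)\<^sup>n\<close>, the divergence identity gives the recursion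
  \<open>(2 n + 3) I (n + 1) = 2 (n + 1) I n\<close>, which starts with the area \<open>4 pi\<close> of the sphere.
\<close>

lemma integral_zonal_power:
  assumes "norm \<xi> = 1"
  shows "(\<integral>x. poly ([:1, 0, -1:] ^ n) (x \<bullet> \<xi>) \<partial>sphere_measure) =
    4 * pi * (2 ^ n * fact n)\<^sup>2 / fact (2 * n + 1)"
proof (induction n)
  case 0
  show ?case by (simp add: measure_sphere_measure)
next
  case (Suc n)
  let ?I = "\<lambda>p. \<integral>x. poly p (x \<bullet> \<xi>) \<partial>sphere_measure"
  have "pderiv ([:1, 0, -1:] * ([:0, 1:] * [:1, 0, -1:] ^ n)) =
    smult (real (2 * n + 3)) ([:1, 0, -1:] ^ Suc n) - smult (real (2 * (n + 1))) ([:1, 0, -1 :: real:] ^ n)"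
  proof -
    have "[:1, 0, -1:] * ([:0, 1:] * [:1, 0, -1:] ^ n) = [:0, 1:] * [:1, 0, -1 :: real:] ^ Suc n"
      by (simp only: power_Suc mult.left_commute)
    then show ?thesis
      apply (simp only: pderiv_mult[of "[:0, 1:]"] pderiv_power_Suc)
      by (intro poly_eq_poly_eq_iff[THEN iffD1] ext) (simp add: pderiv_pCons algebra_simps power2_eq_square)
  qed
  then have "?I (smult (real (2 * n + 3)) ([:1, 0, -1:] ^ Suc n) - smult (real (2 * (n + 1))) ([:1, 0, -1:] ^ n)) = 0"
    using integral_zonal_divergence[OF assms, of "[:0, 1:] * [:1, 0, -1:] ^ n"] by simp
  then have "real (2 * n + 3) * ?I ([:1, 0, -1:] ^ Suc n) = real (2 * (n + 1)) * ?I ([:1, 0, -1:] ^ n)"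
    using integrable_zonal by (simp del: power_Suc poly_power)
  moreover define a b A X :: real where "a = real (2 * (n + 1))" "b = real (2 * n + 3)"
    "A = fact (2 * n + 1)" "X = (2 ^ n * fact n)\<^sup>2"
  ultimately have "b * ?I ([:1, 0, -1:] ^ Suc n) = a * (4 * pi * X / A)"
    unfolding Suc by simp
  moreover have "a > 0" "b > 0" "A > 0"
    by (simp_all add: a_b_A_X_def)
  ultimately have "?I ([:1, 0, -1:] ^ Suc n) = 4 * pi * (a\<^sup>2 * X) / (b * a * A)"
    by (simp add: field_simps power2_eq_square del: power_Suc poly_power)
  also have "a\<^sup>2 * X = (2 ^ Suc n * fact (Suc n))\<^sup>2"
    by (simp add: a_b_A_X_def power2_eq_square algebra_simps)
  also have "b * a * A = fact (2 * Suc n + 1)"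
    by (simp add: a_b_A_X_def algebra_simps)
  finally show ?case .
qed

text \<open>
  Rodrigues' formula and \<open>l\<close> integrations by parts move all derivatives to one factor, where only the
  constant \<open>fact (2 * l)\<close> is left.
\<close>

lemma integral_legendre_square_zonal:
  assumes \<xi>: "norm \<xi> = 1"
  shows "(\<integral>x. (poly (legendre l) (x \<bullet> \<xi>))\<^sup>2 \<partial>sphere_measure) = 4 * pi / (2 * real l + 1)"
proof -
  let ?I = "\<lambda>p. \<integral>x. poly p (x \<bullet> \<xi>) \<partial>sphere_measure"
  let ?q = "[:-1, 0, 1:] :: real poly"
  define w where "w = ?q ^ l"
  let ?D = "\<lambda>n. (pderiv ^^ n) w"
  \<comment> \<open>The lower derivatives vanish at the end points, so no boundary terms arise.\<close>
  have dvd: "?q ^ (l - k) dvd ?D k" if "k \<le> l" for k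
    using that
  proof (induction k)
    case (Suc k)
    then have "?q ^ Suc (l - Suc k) dvd ?D k" by (simp add: Suc_diff_Suc del: power_Suc)
    from power_dvd_pderiv[OF this] show ?case by simp
  qed (simp add: w_def)
  have "?I (?D l * ?D l) = (- 1) ^ k * ?I (?D (l - k) * ?D (l + k))" if "k \<le> l" for k
    using that
  proof (induction k)
    case (Suc k)
    have "?q ^ 1 dvd ?q ^ (l - (l - Suc k))" using Suc.prems by (intro le_imp_power_dvd) simp
    then have "?q dvd ?D (l - Suc k)" using dvd[of "l - Suc k"] by (auto intro: dvd_trans)
    then have "?q dvd ?D (l - Suc k) * ?D (l + k)" by (rule dvd_mult2)
    from integral_zonal_by_parts[OF \<xi> this] have
      "?I (?D (Suc (l - Suc k)) * ?D (l + k)) = - ?I (?D (l - Suc k) * ?D (Suc (l + k)))" by simp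
    then show ?case using Suc by (simp add: Suc_diff_Suc del: poly_mult)
  qed simp
  from this[of l] have 1: "?I (?D l * ?D l) = (- 1) ^ l * ?I (w * ?D (2 * l))"
    by (simp add: mult_2 del: poly_mult)
  have deg: "degree w = 2 * l" "coeff w (2 * l) = 1"
  proof -
    show d: "degree w = 2 * l" by (simp add: w_def degree_power_eq)
    have "lead_coeff w = 1" by (simp add: w_def lead_coeff_power)
    then show "coeff w (2 * l) = 1" by (simp add: d)
  qed
  have "?D (2 * l) = [:fact (2 * l):]"
  proof (rule poly_eqI)
    fix n show "coeff (?D (2 * l)) n = coeff [:fact (2 * l):] n"
      using deg by (cases n) (simp_all add: coeff_higher_pderiv coeff_eq_0 pochhammer_fact)
  qed
  then have "w * ?D (2 * l) = smult (fact (2 * l)) (smult ((- 1) ^ l) ([:1, 0, -1:] ^ l))"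
  proof -
    have "?q = smult (- 1) [:1, 0, -1:]" by simp
    then have "w = smult ((- 1) ^ l) ([:1, 0, -1:] ^ l)"
      unfolding w_def by (simp only: smult_power)
    then show ?thesis using \<open>?D (2 * l) = _\<close> by simp
  qed
  then have "?I (?D l * ?D l) = fact (2 * l) * ?I ([:1, 0, -1:] ^ l)"
    unfolding 1 by (simp del: poly_power)
  moreover have "(\<integral>x. (poly (legendre l) (x \<bullet> \<xi>))\<^sup>2 \<partial>sphere_measure) = (1 / (2 ^ l * fact l))\<^sup>2 * ?I (?D l * ?D l)"
    by (simp add: legendre_def w_def power_mult_distrib power2_eq_square)
  ultimately show ?thesis
    unfolding integral_zonal_power[OF \<xi>]
    by (simp add: power_divide)
qed


section \<open>Integration by parts for Poisson and Gaussian variables\<close>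

lemma (in prob_space) poisson_expectation:
  fixes X :: "'a \<Rightarrow> real" and f :: "real \<Rightarrow> real" and r :: real
  defines "p \<equiv> \<lambda>n. exp (- r) * r ^ n / fact n"
  assumes [measurable]: "random_variable borel X" "f \<in> borel_measurable borel"
    and X: "\<And>n::nat. prob {\<omega> \<in> space M. X \<omega> = real n} = p n" and r: "r \<ge> 0"
    and sm: "summable (\<lambda>n. \<bar>f (real n)\<bar> * p n)"
  shows "integrable M (\<lambda>\<omega>. f (X \<omega>))" "expectation (\<lambda>\<omega>. f (X \<omega>)) = (\<Sum>n. f (real n) * p n)"
proof -
  let ?E = "\<lambda>n. {\<omega> \<in> space M. X \<omega> = real n}"
  have E[measurable]: "?E n \<in> events" for n by measurable
  have "(\<lambda>n. r ^ n / fact n) sums exp r"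
    using exp_converges[of r] by (simp add: field_simps)
  then have "p sums (exp (- r) * exp r)"
    unfolding p_def by (subst times_divide_eq_right[symmetric], intro sums_mult)
  then have "p sums 1" by (simp flip: exp_add)
  moreover have "(\<lambda>n. prob (?E n)) sums prob (\<Union>n. ?E n)"
    by (intro finite_measure_UNION) (auto simp: disjoint_family_on_def)
  ultimately have "prob (\<Union>n. ?E n) = 1"
    by (simp add: X sums_unique2)
  then have "AE \<omega> in M. \<omega> \<in> (\<Union>n. ?E n)"
    by (subst prob_eq_1[symmetric]) auto
  then have AE: "AE \<omega> in M. \<exists>n. X \<omega> = real n" by eventually_elim auto
  define F where "F n \<omega> = f (real n) * indicator (?E n) \<omega>" for n \<omega>
  have single: "(\<lambda>n. F n \<omega>) = (\<lambda>n. if n = k then f (X \<omega>) else 0)" if "X \<omega> = real k" "\<omega> \<in> space M" for \<omega> k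
    using that by (auto simp: F_def)
  have F_int: "integrable M (F n)" for n
    unfolding F_def by (intro integrable_mult_right integrable_real_indicator) (auto simp: emeasure_eq_measure)
  have F_sum: "AE \<omega> in M. summable (\<lambda>n. norm (F n \<omega>)) \<and> (\<Sum>n. F n \<omega>) = f (X \<omega>)"
    using AE AE_space
  proof eventually_elim
    fix \<omega> assume "\<exists>n. X \<omega> = real n" "\<omega> \<in> space M"
    then obtain k where k: "X \<omega> = real k" "\<omega> \<in> space M" by auto
    have "summable (\<lambda>n. norm (F n \<omega>))"
      unfolding fun_cong[OF single[OF k]] by (rule summable_finite[of "{k}"]) auto
    moreover have "(\<lambda>n. F n \<omega>) sums f (X \<omega>)"
      unfolding single[OF k] by (rule sums_single)
    ultimately show "summable (\<lambda>n. norm (F n \<omega>)) \<and> (\<Sum>n. F n \<omega>) = f (X \<omega>)"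
      by (simp add: sums_iff)
  qed
  have n: "norm (F n \<omega>) = \<bar>f (real n)\<bar> * indicator (?E n) \<omega>" for n \<omega>
    by (simp add: F_def abs_mult)
  have F_norm: "expectation (\<lambda>\<omega>. norm (F n \<omega>)) = \<bar>f (real n)\<bar> * p n" for n
    unfolding n by (simp add: X)
  have F_val: "expectation (F n) = f (real n) * p n" for n
    unfolding F_def by (simp add: X)
  have s: "summable (\<lambda>n. expectation (\<lambda>\<omega>. norm (F n \<omega>)))"
    unfolding F_norm by (rule sm)
  have a: "AE \<omega> in M. summable (\<lambda>n. norm (F n \<omega>))" using F_sum by eventually_elim auto
  have b: "AE \<omega> in M. (\<Sum>n. F n \<omega>) = f (X \<omega>)" using F_sum by eventually_elim auto
  have [measurable]: "F n \<in> borel_measurable M" for n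
    using F_int by auto
  show "integrable M (\<lambda>\<omega>. f (X \<omega>))"
    by (rule integrable_cong_AE_imp[OF integrable_suminf[OF F_int a s] _ b]) measurable
  have "expectation (\<lambda>\<omega>. f (X \<omega>)) = expectation (\<lambda>\<omega>. \<Sum>n. F n \<omega>)"
    using b by (intro integral_cong_AE) auto
  also have "\<dots> = (\<Sum>n. f (real n) * p n)"
    unfolding integral_suminf[OF F_int a s] F_val ..
  finally show "expectation (\<lambda>\<omega>. f (X \<omega>)) = (\<Sum>n. f (real n) * p n)" .
qed

text \<open>
  The weights \<open>p n\<close> of the Poisson law satisfy \<open>(n + 1) * p (n + 1) = r * p n\<close>; shift the summation index.
\<close>

lemma (in prob_space) poisson_by_parts:
  fixes X :: "'a \<Rightarrow> real" and g :: "real \<Rightarrow> real"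
  assumes X_meas[measurable]: "random_variable borel X" and [measurable]: "g \<in> borel_measurable borel"
    and X: "\<And>n::nat. prob {\<omega> \<in> space M. X \<omega> = real n} = exp (- r) * r ^ n / fact n" and r: "r \<ge> 0"
    and sm: "summable (\<lambda>n. \<bar>g (real n + 1)\<bar> * (exp (- r) * r ^ n / fact n))"
  shows "integrable M (\<lambda>\<omega>. g (X \<omega> + 1))" "integrable M (\<lambda>\<omega>. X \<omega> * g (X \<omega>))"
    "expectation (\<lambda>\<omega>. X \<omega> * g (X \<omega>)) = r * expectation (\<lambda>\<omega>. g (X \<omega> + 1))"
proof -
  let ?p = "\<lambda>n. exp (- r) * r ^ n / fact n"
  have shift: "real (Suc n) * c * ?p (Suc n) = r * (c * ?p n)" for n c
    by (simp add: field_simps del: of_nat_Suc)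
  have eq1: "(\<lambda>n. \<bar>real (Suc n) * g (real (Suc n))\<bar> * ?p (Suc n)) = (\<lambda>n. r * (\<bar>g (real n + 1)\<bar> * ?p n))"
    unfolding shift[symmetric] by (simp add: abs_mult add.commute)
  have "summable (\<lambda>n. \<bar>real (Suc n) * g (real (Suc n))\<bar> * ?p (Suc n))"
    unfolding eq1 by (intro summable_mult sm)
  then have sm2: "summable (\<lambda>n. \<bar>real n * g (real n)\<bar> * ?p n)"
    by (subst (asm) summable_Suc_iff)
  have sm3: "summable (\<lambda>n. real n * g (real n) * ?p n)"
    by (rule summable_rabs_cancel) (use sm2 r in \<open>simp add: abs_mult\<close>)
  have sm4: "summable (\<lambda>n. g (real n + 1) * ?p n)"
    by (rule summable_rabs_cancel) (use sm r in \<open>simp add: abs_mult\<close>)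
  note 1 = poisson_expectation[OF X_meas _ X r sm]
  note 2 = poisson_expectation[OF X_meas _ X r sm2]
  show "integrable M (\<lambda>\<omega>. g (X \<omega> + 1))" "integrable M (\<lambda>\<omega>. X \<omega> * g (X \<omega>))"
    by (rule 1 2; measurable)+
  have "expectation (\<lambda>\<omega>. X \<omega> * g (X \<omega>)) = (\<Sum>n. real n * g (real n) * ?p n)"
    by (rule 2) measurable
  also have "\<dots> = (\<Sum>n. real (Suc n) * g (real (Suc n)) * ?p (Suc n))"
    using suminf_split_head[OF sm3] by simp
  also have "\<dots> = (\<Sum>n. r * (g (real n + 1) * ?p n))"
    unfolding shift by (simp add: add.commute)
  also have "\<dots> = r * (\<Sum>n. g (real n + 1) * ?p n)"
    by (rule suminf_mult[OF sm4])
  also have "(\<Sum>n. g (real n + 1) * ?p n) = expectation (\<lambda>\<omega>. g (X \<omega> + 1))"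
    by (rule 1(2)[symmetric]) measurable
  finally show "expectation (\<lambda>\<omega>. X \<omega> * g (X \<omega>)) = r * expectation (\<lambda>\<omega>. g (X \<omega> + 1))" .
qed

lemma summable_poisson: "summable (\<lambda>n. exp (- r) * r ^ n / fact n :: real)"
proof -
  have "summable (\<lambda>n. r ^ n / fact n)"
    using summable_exp[of r] by (simp add: field_simps)
  then show ?thesis
    by (subst times_divide_eq_right[symmetric], intro summable_mult)
qed

lemma (in prob_space) poisson_by_parts_bounded:
  fixes X :: "'a \<Rightarrow> real" and g :: "real \<Rightarrow> real"
  assumes X_meas[measurable]: "random_variable borel X" and [measurable]: "g \<in> borel_measurable borel"
    and X: "\<And>n::nat. prob {\<omega> \<in> space M. X \<omega> = real n} = exp (- r) * r ^ n / fact n" and r: "r \<ge> 0"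
    and b: "\<And>x. \<bar>g x\<bar> \<le> b"
  shows "integrable M (\<lambda>\<omega>. X \<omega> * g (X \<omega>))"
    "expectation (\<lambda>\<omega>. X \<omega> * g (X \<omega>)) = r * expectation (\<lambda>\<omega>. g (X \<omega> + 1))"
proof -
  have "summable (\<lambda>n. \<bar>g (real n + 1)\<bar> * (exp (- r) * r ^ n / fact n))"
    by (rule summable_comparison_test'[where N = 0, OF summable_mult[OF summable_poisson[of r], of b]])
      (use r b in \<open>auto simp: abs_mult intro!: mult_right_mono divide_right_mono\<close>)
  note * = poisson_by_parts[OF X_meas _ X r this]
  show "integrable M (\<lambda>\<omega>. X \<omega> * g (X \<omega>))"
    "expectation (\<lambda>\<omega>. X \<omega> * g (X \<omega>)) = r * expectation (\<lambda>\<omega>. g (X \<omega> + 1))"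
    by (rule *; measurable)+
qed

text \<open>
  Integration by parts with the constant function and with the identity.
\<close>

lemma (in prob_space) poisson_moments:
  fixes X :: "'a \<Rightarrow> real"
  assumes X_meas[measurable]: "random_variable borel X"
    and X: "\<And>n::nat. prob {\<omega> \<in> space M. X \<omega> = real n} = exp (- r) * r ^ n / fact n" and r: "r \<ge> 0"
  shows "integrable M X" "expectation X = r" "integrable M (\<lambda>\<omega>. (X \<omega>)\<^sup>2)"
    "expectation (\<lambda>\<omega>. (X \<omega> - r)\<^sup>2) = r"
proof -
  note 1 = poisson_by_parts_bounded[OF X_meas _ X r, of "\<lambda>_. 1" 1, simplified]
  show i: "integrable M X" and e: "expectation X = r"
    using 1 by (auto simp: prob_space)
  let ?p = "\<lambda>n. exp (- r) * r ^ n / fact n"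
  have "summable (\<lambda>n. r * ?p n)" by (intro summable_mult summable_poisson)
  moreover have "(\<lambda>n. r * ?p n) = (\<lambda>n. real (Suc n) * ?p (Suc n))"
    by (simp add: fun_eq_iff field_simps del: of_nat_Suc)
  ultimately have "summable (\<lambda>n. real n * ?p n)"
    by (simp only: summable_Suc_iff[of "\<lambda>n. real n * ?p n"])
  then have "summable (\<lambda>n. real n * ?p n + ?p n)"
    by (intro summable_add summable_poisson)
  moreover have "(\<lambda>n. real n * ?p n + ?p n) = (\<lambda>n. \<bar>real n + 1\<bar> * ?p n)"
    by (simp add: fun_eq_iff add_divide_distrib algebra_simps)
  ultimately have "summable (\<lambda>n. \<bar>real n + 1\<bar> * ?p n)"
    by simp
  note 2 = poisson_by_parts[OF X_meas _ X r this, simplified]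
  show i2: "integrable M (\<lambda>\<omega>. (X \<omega>)\<^sup>2)"
    using 2 by (simp add: power2_eq_square)
  have "expectation (\<lambda>\<omega>. (X \<omega>)\<^sup>2) = r * (r + 1)"
    using 2(3) i e by (simp add: power2_eq_square prob_space)
  moreover have "(\<lambda>\<omega>. (X \<omega> - r)\<^sup>2) = (\<lambda>\<omega>. (X \<omega>)\<^sup>2 - 2 * r * X \<omega> + r\<^sup>2)"
    by (simp add: fun_eq_iff power2_eq_square algebra_simps)
  ultimately show "expectation (\<lambda>\<omega>. (X \<omega> - r)\<^sup>2) = r"
    using i i2 e by (simp add: prob_space power2_eq_square algebra_simps)
qed

lemma std_normal_density_tendsto_0:
  "(std_normal_density \<longlongrightarrow> 0) at_top" "(std_normal_density \<longlongrightarrow> 0) at_bot"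
proof -
  have "filterlim (\<lambda>x::real. x ^ 2 / 2) at_top at_top"
    using filterlim_tendsto_pos_mult_at_top[OF tendsto_const[of "1/2::real"] _ filterlim_pow_at_top[OF _ filterlim_ident, of 2]]
    by simp
  then have "filterlim (\<lambda>x::real. - (x ^ 2 / 2)) at_bot at_top"
    by (simp add: filterlim_uminus_at_bot)
  then have "((\<lambda>x. exp (- (x\<^sup>2 / 2))) \<longlongrightarrow> 0) (at_top :: real filter)"
    by (rule filterlim_compose[OF exp_at_bot])
  from tendsto_mult_left[OF this, of "1 / sqrt (2 * pi)"]
  show *: "(std_normal_density \<longlongrightarrow> 0) at_top"
    by (simp add: std_normal_density_def[abs_def])
  then show "(std_normal_density \<longlongrightarrow> 0) at_bot"
    unfolding filterlim_at_bot_mirror by (simp add: std_normal_density_def[abs_def])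
qed

lemma std_normal_density_has_derivative:
  "(std_normal_density has_real_derivative - x * std_normal_density x) (at x)"
proof -
  have "((\<lambda>x. exp (- x\<^sup>2 / 2)) has_real_derivative - x * exp (- x\<^sup>2 / 2)) (at x)"
    by (auto intro!: derivative_eq_intros)
  from DERIV_cmult[OF this, of "1 / sqrt (2 * pi)"] show ?thesis
    by (simp add: std_normal_density_def[abs_def] mult.left_commute)
qed

text \<open>
  The derivative of the normal density is \<open>- x\<close> times the density, and the product of the density with the
  bounded function \<open>g\<close> vanishes at infinity.
\<close>

lemma std_normal_by_parts:
  fixes g g' :: "real \<Rightarrow> real"
  assumes g: "\<And>x. (g has_real_derivative g' x) (at x)" and cont: "continuous_on UNIV g'"
    and b: "\<And>x. \<bar>g x\<bar> \<le> b" "\<And>x. \<bar>g' x\<bar> \<le> b'"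
  shows "(\<integral>x. x * g x \<partial>std_normal_distribution) = (\<integral>x. g' x \<partial>std_normal_distribution)"
proof -
  let ?\<phi> = std_normal_density
  have cg: "continuous_on UNIV g"
    using g by (meson DERIV_isCont continuous_at_imp_continuous_on)
  have [measurable]: "g \<in> borel_measurable borel" "g' \<in> borel_measurable borel"
    using cg cont by (auto intro: borel_measurable_continuous_onI)
  have \<phi>0: "?\<phi> x \<ge> 0" for x by simp
  have i1: "integrable lborel (\<lambda>x. ?\<phi> x * g' x)"
    by (rule Bochner_Integration.integrable_bound[OF integrable_mult_left[OF integrable_std_normal_moment[of 0], of b']])
      (auto simp: abs_mult intro!: mult_left_mono order_trans[OF b(2)])
  have i2: "integrable lborel (\<lambda>x. ?\<phi> x * (x * g x))"
    by (rule Bochner_Integration.integrable_bound[OF integrable_mult_left[OF integrable_std_normal_moment_abs[of 1], of b]])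
      (auto simp: abs_mult mult.assoc intro!: mult_left_mono order_trans[OF b(1)])
  let ?f = "\<lambda>x. ?\<phi> x * g' x - ?\<phi> x * (x * g x)"
  have "(LBINT x=-\<infinity>..\<infinity>. ?f x) = 0 - 0"
  proof (rule interval_integral_FTC_integrable[where F = "\<lambda>x. ?\<phi> x * g x"])
    show "((\<lambda>x. ?\<phi> x * g x) has_vector_derivative ?f x) (at x)" for x
      unfolding has_real_derivative_iff_has_vector_derivative[symmetric]
      by (auto intro!: derivative_eq_intros std_normal_density_has_derivative g simp: algebra_simps)
    have "continuous_on UNIV ?\<phi>"
      using std_normal_density_has_derivative by (meson DERIV_isCont continuous_at_imp_continuous_on)
    then show "isCont ?f x" for x
      using cg cont by (auto intro!: continuous_intros simp: continuous_on_eq_continuous_at)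
    show "set_integrable lborel (einterval (- \<infinity>) \<infinity>) ?f"
      using Bochner_Integration.integrable_diff[OF i1 i2] by (simp add: set_integrable_def)
    have lim: "((\<lambda>x. ?\<phi> x * g x) \<longlongrightarrow> 0) F" if "(?\<phi> \<longlongrightarrow> 0) F" for F
    proof (rule Lim_null_comparison)
      show "\<forall>\<^sub>F x in F. norm (?\<phi> x * g x) \<le> ?\<phi> x * b"
        by (intro always_eventually) (auto simp: abs_mult intro!: mult_left_mono b)
      show "((\<lambda>x. ?\<phi> x * b) \<longlongrightarrow> 0) F" using tendsto_mult_right[OF that, of b] by simp
    qed
    show "(((\<lambda>x. ?\<phi> x * g x) \<circ> real_of_ereal) \<longlongrightarrow> 0) (at_right (-\<infinity>))"
      "(((\<lambda>x. ?\<phi> x * g x) \<circ> real_of_ereal) \<longlongrightarrow> 0) (at_left \<infinity>)"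
      unfolding ereal_tendsto_simps by (intro lim std_normal_density_tendsto_0)+
  qed auto
  then have "(\<integral>x. ?f x \<partial>lborel) = 0"
    by (simp add: interval_lebesgue_integral_def set_lebesgue_integral_def)
  then have "(\<integral>x. ?\<phi> x * (x * g x) \<partial>lborel) = (\<integral>x. ?\<phi> x * g' x \<partial>lborel)"
    using i1 i2 by simp
  then show ?thesis
    by (simp add: integral_density)
qed

lemma (in prob_space) normal_by_parts:
  fixes g g' :: "real \<Rightarrow> real"
  assumes [measurable]: "random_variable borel X"
    and X: "distr M borel X = distr std_normal_distribution borel (\<lambda>x. \<sigma> * x)"
    and g: "\<And>x. (g has_real_derivative g' x) (at x)" and cont: "continuous_on UNIV g'"
    and b: "\<And>x. \<bar>g x\<bar> \<le> b" "\<And>x. \<bar>g' x\<bar> \<le> b'"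
  shows "expectation (\<lambda>\<omega>. X \<omega> * g (X \<omega>)) = \<sigma>\<^sup>2 * expectation (\<lambda>\<omega>. g' (X \<omega>))"
proof -
  have cg: "continuous_on UNIV g"
    using g by (meson DERIV_isCont continuous_at_imp_continuous_on)
  have [measurable]: "g \<in> borel_measurable borel" "g' \<in> borel_measurable borel"
    using cg cont by (auto intro: borel_measurable_continuous_onI)
  have E: "expectation (\<lambda>\<omega>. F (X \<omega>)) = (\<integral>x. F (\<sigma> * x) \<partial>std_normal_distribution)"
    if [measurable]: "F \<in> borel_measurable borel" for F :: "real \<Rightarrow> real"
  proof -
    have "expectation (\<lambda>\<omega>. F (X \<omega>)) = (\<integral>x. F x \<partial>distr M borel X)"
      by (simp add: integral_distr)
    also have "\<dots> = (\<integral>x. F (\<sigma> * x) \<partial>std_normal_distribution)"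
      unfolding X by (subst integral_distr) auto
    finally show ?thesis .
  qed
  have "expectation (\<lambda>\<omega>. X \<omega> * g (X \<omega>)) = (\<integral>x. \<sigma> * (x * g (\<sigma> * x)) \<partial>std_normal_distribution)"
    using E[of "\<lambda>x. x * g x"] by (simp add: mult.assoc)
  also have "\<dots> = \<sigma> * (\<integral>x. x * g (\<sigma> * x) \<partial>std_normal_distribution)"
    by simp
  also have "(\<integral>x. x * g (\<sigma> * x) \<partial>std_normal_distribution) = (\<integral>x. g' (\<sigma> * x) * \<sigma> \<partial>std_normal_distribution)"
  proof (rule std_normal_by_parts)
    show "((\<lambda>x. g (\<sigma> * x)) has_real_derivative g' (\<sigma> * x) * \<sigma>) (at x)" for x
      by (rule DERIV_chain2[OF g]) (auto intro!: derivative_eq_intros)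
    show "continuous_on UNIV (\<lambda>x. g' (\<sigma> * x) * \<sigma>)"
      by (intro continuous_intros continuous_on_compose2[OF cont]) auto
    show "\<bar>g (\<sigma> * x)\<bar> \<le> b" "\<bar>g' (\<sigma> * x) * \<sigma>\<bar> \<le> b' * \<bar>\<sigma>\<bar>" for x
      using b by (auto simp: abs_mult intro!: mult_right_mono)
  qed
  also have "\<dots> = expectation (\<lambda>\<omega>. g' (X \<omega>)) * \<sigma>"
    by (simp add: E)
  finally show ?thesis by (simp add: power2_eq_square)
qed


lemma (in prob_space) indep_var_expectation:
  fixes F :: "'b \<times> 'b \<Rightarrow> real"
  assumes ind: "indep_var S X T Y" and F[measurable]: "F \<in> borel_measurable (S \<Otimes>\<^sub>M T)"
    and int: "integrable M (\<lambda>\<omega>. F (X \<omega>, Y \<omega>))"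
  shows "expectation (\<lambda>\<omega>. F (X \<omega>, Y \<omega>)) = (\<integral>\<omega>'. (\<integral>\<omega>. F (X \<omega>, Y \<omega>') \<partial>M) \<partial>M)"
proof -
  have X[measurable]: "random_variable S X" and Y[measurable]: "random_variable T Y"
    and D: "distr M S X \<Otimes>\<^sub>M distr M T Y = distr M (S \<Otimes>\<^sub>M T) (\<lambda>x. (X x, Y x))"
    using ind by (auto simp: indep_var_distribution_eq)
  interpret P1: prob_space "distr M S X" by (rule prob_space_distr) fact
  interpret P2: prob_space "distr M T Y" by (rule prob_space_distr) fact
  interpret P: pair_prob_space "distr M S X" "distr M T Y" ..
  have i: "integrable (distr M S X \<Otimes>\<^sub>M distr M T Y) (case_prod (\<lambda>x y. F (x, y)))"
    unfolding D using int by (simp add: integrable_distr_eq)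
  have "expectation (\<lambda>\<omega>. F (X \<omega>, Y \<omega>)) = (\<integral>z. F z \<partial>(distr M S X \<Otimes>\<^sub>M distr M T Y))"
    unfolding D by (simp add: integral_distr)
  also have "\<dots> = (\<integral>y. (\<integral>x. F (x, y) \<partial>distr M S X) \<partial>distr M T Y)"
    using P.integral_snd[OF i] by simp
  also have "\<dots> = (\<integral>\<omega>'. (\<integral>x. F (x, Y \<omega>') \<partial>distr M S X) \<partial>M)"
    by (subst integral_distr) auto
  also have "\<dots> = (\<integral>\<omega>'. (\<integral>\<omega>. F (X \<omega>, Y \<omega>') \<partial>M) \<partial>M)"
  proof (intro Bochner_Integration.integral_cong refl)
    fix \<omega>' assume "\<omega>' \<in> space M"
    then have "Y \<omega>' \<in> space T" by (rule measurable_space[OF Y])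
    then have [measurable]: "(\<lambda>x. F (x, Y \<omega>')) \<in> borel_measurable S" by measurable
    show "(\<integral>x. F (x, Y \<omega>') \<partial>distr M S X) = (\<integral>\<omega>. F (X \<omega>, Y \<omega>') \<partial>M)"
      by (subst integral_distr) auto
  qed
  finally show ?thesis .
qed

text \<open>
  Conditioning on all variables but the \<open>i\<close>-th: the random vector \<open>R\<close> is a function of the others, so it may be replaced by
  an independent copy.
\<close>

lemma (in prob_space) indep_vars_sum_expectation:
  fixes N :: "'i \<Rightarrow> 'a \<Rightarrow> real" and a :: "'i \<Rightarrow> 'k :: {real_normed_vector, second_countable_topology}"
    and F :: "real \<times> 'k \<Rightarrow> real"
  assumes fin: "finite I" and ind: "indep_vars (\<lambda>_. borel) N I" and i: "i \<in> I"
    and F[measurable]: "F \<in> borel_measurable (borel \<Otimes>\<^sub>M borel)"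
    and R: "\<And>\<omega>. R \<omega> = (\<Sum>j\<in>I - {i}. (N j \<omega> - r j) *\<^sub>R a j)"
    and int: "integrable M (\<lambda>\<omega>. F (N i \<omega>, R \<omega>))"
  shows "expectation (\<lambda>\<omega>. F (N i \<omega>, R \<omega>)) = (\<integral>\<omega>'. (\<integral>\<omega>. F (N i \<omega>, R \<omega>') \<partial>M) \<partial>M)"
proof -
  have indR: "indep_var (PiM {i} (\<lambda>_. borel)) (\<lambda>\<omega>. restrict (\<lambda>i. N i \<omega>) {i})
      (PiM (I - {i}) (\<lambda>_. borel)) (\<lambda>\<omega>. restrict (\<lambda>i. N i \<omega>) (I - {i}))"
    using i by (intro indep_var_restrict[OF ind]) auto
  have eq: "(\<Sum>j\<in>I - {i}. (restrict (\<lambda>i. N i \<omega>) (I - {i}) j - r j) *\<^sub>R a j) = R \<omega>" for \<omega>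
    unfolding R by (intro sum.cong) auto
  have "(\<lambda>(x, y). F (x i, \<Sum>j\<in>I - {i}. (y j - r j) *\<^sub>R a j))
      \<in> borel_measurable (PiM {i} (\<lambda>_. borel) \<Otimes>\<^sub>M PiM (I - {i}) (\<lambda>_. borel))"
    by measurable
  moreover have "restrict (\<lambda>i. N i \<omega>) {i} i = N i \<omega>" for \<omega>
    by simp
  ultimately show ?thesis
    using indep_var_expectation[OF indR, of "\<lambda>(x, y). F (x i, \<Sum>j\<in>I - {i}. (y j - r j) *\<^sub>R a j)"] int
    by (simp only: eq prod.case)
qed

text \<open>
  Adding one point to the \<open>i\<close>-th count shifts \<open>X\<close> by \<open>a i\<close>; with the other counts held fixed this is the
  scalar formula for Poisson variables.
\<close>

lemma (in prob_space) compensated_poisson_by_parts: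
  fixes N :: "'i \<Rightarrow> 'a \<Rightarrow> real" and a :: "'i \<Rightarrow> 'k :: {real_normed_vector, second_countable_topology}"
  assumes fin: "finite I" and ind: "indep_vars (\<lambda>_. borel) N I" and i: "i \<in> I"
    and N: "\<And>n::nat. prob {\<omega> \<in> space M. N i \<omega> = real n} = exp (- r i) * r i ^ n / fact n" and r: "r i \<ge> 0"
    and f: "continuous_on UNIV f" and b: "\<And>x. \<bar>f x\<bar> \<le> b"
  defines "X \<equiv> \<lambda>\<omega>. \<Sum>j\<in>I. (N j \<omega> - r j) *\<^sub>R a j"
  shows "expectation (\<lambda>\<omega>. (N i \<omega> - r i) * f (X \<omega>)) =
    r i * expectation (\<lambda>\<omega>. f (X \<omega> + a i) - f (X \<omega>))"
proof -
  define R where "R \<omega> = (\<Sum>j\<in>I - {i}. (N j \<omega> - r j) *\<^sub>R a j)" for \<omega>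
  note split = indep_vars_sum_expectation[OF fin ind i _ R_def]
  have [measurable]: "random_variable borel (N j)" if "j \<in> I" for j
    using ind that by (auto simp: indep_vars_def)
  have [measurable]: "random_variable borel (N i)" "random_variable borel R"
    unfolding R_def using i by measurable
  have [measurable]: "f \<in> borel_measurable borel"
    by (rule borel_measurable_continuous_onI[OF f])
  have X: "X \<omega> = (N i \<omega> - r i) *\<^sub>R a i + R \<omega>" for \<omega>
    unfolding X_def R_def by (rule sum.remove[OF fin i])
  note mom = poisson_moments[OF _ N r]
  have Ni: "integrable M (N i)" by (rule mom) measurable
  have bint: "integrable M (\<lambda>\<omega>. f (h \<omega>))" if [measurable]: "h \<in> borel_measurable M" for h
    by (rule integrable_const_bound[of _ b]) (auto simp: b)
  have iN: "integrable M (\<lambda>\<omega>. (N i \<omega> - r i) * f (h \<omega>))" if [measurable]: "h \<in> borel_measurable M" for h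
  proof (rule Bochner_Integration.integrable_bound)
    show "integrable M (\<lambda>\<omega>. (N i \<omega> - r i) * b)"
      by (intro integrable_mult_left Bochner_Integration.integrable_diff Ni integrable_const)
    show "AE \<omega> in M. norm ((N i \<omega> - r i) * f (h \<omega>)) \<le> norm ((N i \<omega> - r i) * b)"
      by (intro AE_I2) (auto simp: abs_mult intro!: mult_left_mono order_trans[OF b])
  qed measurable
  have inner: "expectation (\<lambda>\<omega>. (N i \<omega> - r i) * f ((N i \<omega> - r i) *\<^sub>R a i + y)) =
    r i * expectation (\<lambda>\<omega>. f ((N i \<omega> - r i) *\<^sub>R a i + y + a i)) - r i * expectation (\<lambda>\<omega>. f ((N i \<omega> - r i) *\<^sub>R a i + y))"
    for y
  proof -
    let ?g = "\<lambda>x. f ((x - r i) *\<^sub>R a i + y)"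
    have 1: "integrable M (\<lambda>\<omega>. N i \<omega> * ?g (N i \<omega>))"
      "expectation (\<lambda>\<omega>. N i \<omega> * ?g (N i \<omega>)) = r i * expectation (\<lambda>\<omega>. ?g (N i \<omega> + 1))"
      by (rule poisson_by_parts_bounded[OF _ _ N r, of _ b]; simp add: b)+
    have "(N i \<omega> + 1 - r i) *\<^sub>R a i + y = (N i \<omega> - r i) *\<^sub>R a i + y + a i" for \<omega>
      by (simp add: scaleR_left_distrib scaleR_left_diff_distrib add.commute add.left_commute)
    moreover have "expectation (\<lambda>\<omega>. (N i \<omega> - r i) * ?g (N i \<omega>)) =
        expectation (\<lambda>\<omega>. N i \<omega> * ?g (N i \<omega>)) - r i * expectation (\<lambda>\<omega>. ?g (N i \<omega>))"
      using 1(1) bint[of "\<lambda>\<omega>. (N i \<omega> - r i) *\<^sub>R a i + y"] by (simp add: left_diff_distrib)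
    ultimately show ?thesis using 1(2) by (simp only:)
  qed
  have "expectation (\<lambda>\<omega>. (N i \<omega> - r i) * f (X \<omega>)) =
      (\<integral>\<omega>'. expectation (\<lambda>\<omega>. (N i \<omega> - r i) * f ((N i \<omega> - r i) *\<^sub>R a i + R \<omega>')) \<partial>M)"
    unfolding X
    using split[of "\<lambda>(x, y). (x - r i) * f ((x - r i) *\<^sub>R a i + y)"] iN
    by (simp add: split_beta')
  also have "\<dots> = (\<integral>\<omega>'. r i * expectation (\<lambda>\<omega>. f ((N i \<omega> - r i) *\<^sub>R a i + R \<omega>' + a i)) -
      r i * expectation (\<lambda>\<omega>. f ((N i \<omega> - r i) *\<^sub>R a i + R \<omega>')) \<partial>M)"
    unfolding inner ..
  also have "\<dots> = r i * (\<integral>\<omega>'. expectation (\<lambda>\<omega>. f ((N i \<omega> - r i) *\<^sub>R a i + R \<omega>' + a i)) \<partial>M) -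
      r i * (\<integral>\<omega>'. expectation (\<lambda>\<omega>. f ((N i \<omega> - r i) *\<^sub>R a i + R \<omega>')) \<partial>M)"
  proof -
    have *: "integrable M (\<lambda>\<omega>'. expectation (\<lambda>\<omega>. f ((N i \<omega> - r i) *\<^sub>R a i + R \<omega>' + c)))" for c
    proof (rule integrable_const_bound[of _ b])
      have "\<bar>expectation (\<lambda>\<omega>. f ((N i \<omega> - r i) *\<^sub>R a i + R \<omega>' + c))\<bar> \<le> b" for \<omega>'
      proof -
        have "\<bar>expectation (\<lambda>\<omega>. f ((N i \<omega> - r i) *\<^sub>R a i + R \<omega>' + c))\<bar> \<le> expectation (\<lambda>_. b)"
          unfolding real_norm_def[symmetric]
          by (rule order_trans[OF integral_norm_bound integral_mono]) (auto intro!: integrable_norm bint b)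
        then show ?thesis by (simp add: prob_space)
      qed
      then show "AE \<omega>' in M. norm (expectation (\<lambda>\<omega>. f ((N i \<omega> - r i) *\<^sub>R a i + R \<omega>' + c))) \<le> b"
        by simp
    qed measurable
    show ?thesis using *[of "a i"] *[of 0] by simp
  qed
  also have "(\<integral>\<omega>'. expectation (\<lambda>\<omega>. f ((N i \<omega> - r i) *\<^sub>R a i + R \<omega>' + a i)) \<partial>M) = expectation (\<lambda>\<omega>. f (X \<omega> + a i))"
    unfolding X
    using split[of "\<lambda>(x, y). f ((x - r i) *\<^sub>R a i + y + a i)"] bint
    by (simp add: split_beta')
  also have "(\<integral>\<omega>'. expectation (\<lambda>\<omega>. f ((N i \<omega> - r i) *\<^sub>R a i + R \<omega>')) \<partial>M) = expectation (\<lambda>\<omega>. f (X \<omega>))"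
    unfolding X
    using split[of "\<lambda>(x, y). f ((x - r i) *\<^sub>R a i + y)"] bint
    by (simp add: split_beta')
  finally show ?thesis
    using bint[of "\<lambda>\<omega>. X \<omega> + a i"] bint[of "\<lambda>\<omega>. (N i \<omega> - r i) *\<^sub>R a i + R \<omega>"] by (simp add: X right_diff_distrib)
qed

text \<open>
  With the other coordinates held fixed, \<open>g (Z \<omega>)\<close> is a function of \<open>\<eta> i\<close> whose derivative is the
  directional derivative of \<open>g\<close> along \<open>v i\<close>.
\<close>

lemma (in prob_space) gaussian_sum_by_parts:
  fixes \<eta> :: "'i \<Rightarrow> 'a \<Rightarrow> real" and v :: "'i \<Rightarrow> 'k :: {real_normed_vector, second_countable_topology}"
  assumes fin: "finite I" and ind: "indep_vars (\<lambda>_. borel) \<eta> I" and i: "i \<in> I"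
    and \<eta>: "distr M borel (\<eta> i) = distr std_normal_distribution borel (\<lambda>x. \<sigma> * x)"
    and int: "integrable M (\<eta> i)"
    and g: "\<And>x. ((\<lambda>s. g (x + s *\<^sub>R v i)) has_real_derivative g' x) (at 0)"
    and cont: "continuous_on UNIV g" "continuous_on UNIV g'"
    and b: "\<And>x. \<bar>g x\<bar> \<le> b" "\<And>x. \<bar>g' x\<bar> \<le> b'"
  defines "Z \<equiv> \<lambda>\<omega>. \<Sum>j\<in>I. \<eta> j \<omega> *\<^sub>R v j"
  shows "expectation (\<lambda>\<omega>. \<eta> i \<omega> * g (Z \<omega>)) = \<sigma>\<^sup>2 * expectation (\<lambda>\<omega>. g' (Z \<omega>))"
proof -
  define R where "R \<omega> = (\<Sum>j\<in>I - {i}. (\<eta> j \<omega> - 0) *\<^sub>R v j)" for \<omega>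
  note split = indep_vars_sum_expectation[OF fin ind i _ R_def]
  have [measurable]: "random_variable borel (\<eta> j)" if "j \<in> I" for j
    using ind that by (auto simp: indep_vars_def)
  have [measurable]: "random_variable borel (\<eta> i)" "random_variable borel R"
    unfolding R_def using i by measurable
  have [measurable]: "g \<in> borel_measurable borel" "g' \<in> borel_measurable borel"
    by (auto intro: borel_measurable_continuous_onI cont)
  have Z: "Z \<omega> = R \<omega> + \<eta> i \<omega> *\<^sub>R v i" for \<omega>
    unfolding Z_def R_def using sum.remove[OF fin i, of "\<lambda>j. \<eta> j \<omega> *\<^sub>R v j"] by simp
  have g: "((\<lambda>s. g (y + s *\<^sub>R v i)) has_real_derivative g' (y + s *\<^sub>R v i)) (at s)" for y s
    using DERIV_shift[of "\<lambda>s. g (y + s *\<^sub>R v i)" "g' (y + s *\<^sub>R v i)" 0 s] g[of "y + s *\<^sub>R v i"]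
    by (simp add: algebra_simps)
  have inner: "expectation (\<lambda>\<omega>. \<eta> i \<omega> * g (y + \<eta> i \<omega> *\<^sub>R v i)) = \<sigma>\<^sup>2 * expectation (\<lambda>\<omega>. g' (y + \<eta> i \<omega> *\<^sub>R v i))" for y
    by (rule normal_by_parts[OF _ \<eta>, of "\<lambda>s. g (y + s *\<^sub>R v i)" "\<lambda>s. g' (y + s *\<^sub>R v i)" b b'])
      (auto intro!: g b continuous_intros continuous_on_compose2[OF cont(2)])
  have "integrable M (\<lambda>\<omega>. \<eta> i \<omega> * g (Z \<omega>))"
  proof (rule Bochner_Integration.integrable_bound)
    show "integrable M (\<lambda>\<omega>. \<eta> i \<omega> * b)" by (intro integrable_mult_left int)
    show "AE \<omega> in M. norm (\<eta> i \<omega> * g (Z \<omega>)) \<le> norm (\<eta> i \<omega> * b)"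
      by (intro AE_I2) (auto simp: abs_mult intro!: mult_left_mono order_trans[OF b(1)])
  qed (simp add: Z)
  then have "expectation (\<lambda>\<omega>. \<eta> i \<omega> * g (Z \<omega>)) = (\<integral>\<omega>'. expectation (\<lambda>\<omega>. \<eta> i \<omega> * g (R \<omega>' + \<eta> i \<omega> *\<^sub>R v i)) \<partial>M)"
    unfolding Z
    using split[of "\<lambda>(x, y). x * g (y + x *\<^sub>R v i)"]
    by (simp add: split_beta')
  also have "\<dots> = \<sigma>\<^sup>2 * (\<integral>\<omega>'. expectation (\<lambda>\<omega>. g' (R \<omega>' + \<eta> i \<omega> *\<^sub>R v i)) \<partial>M)"
    unfolding inner by simp
  also have "(\<integral>\<omega>'. expectation (\<lambda>\<omega>. g' (R \<omega>' + \<eta> i \<omega> *\<^sub>R v i)) \<partial>M) = expectation (\<lambda>\<omega>. g' (Z \<omega>))"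
  proof -
    have "integrable M (\<lambda>\<omega>. g' (R \<omega> + \<eta> i \<omega> *\<^sub>R v i))"
      by (rule integrable_const_bound[of _ b']) (auto simp: b)
    then show ?thesis
      unfolding Z
      using split[of "\<lambda>(x, y). g' (y + x *\<^sub>R v i)"]
      by (simp add: split_beta')
  qed
  finally show ?thesis .
qed


section \<open>Independence from factorising characteristic functions\<close>

text \<open>
  The measure with density \<open>V / E V\<close> gives \<open>\<zeta>\<close> the same characteristic function as the original measure, hence
  the same law.
\<close>

lemma (in prob_space) char_factor_real:
  fixes V \<zeta> :: "'a \<Rightarrow> real"
  assumes [measurable]: "random_variable borel V" "random_variable borel \<zeta>" "B \<in> sets borel"
    and V: "\<And>\<omega>. 1 \<le> V \<omega>" "\<And>\<omega>. V \<omega> \<le> K"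
    and eq: "\<And>u. (CLINT \<omega>|M. complex_of_real (V \<omega>) * iexp (u * \<zeta> \<omega>)) =
        complex_of_real (expectation V) * (CLINT \<omega>|M. iexp (u * \<zeta> \<omega>))"
  shows "expectation (\<lambda>\<omega>. V \<omega> * indicator B (\<zeta> \<omega>)) = expectation V * expectation (\<lambda>\<omega>. indicator B (\<zeta> \<omega>))"
proof -
  have int: "integrable M V"
    using V order_trans[OF zero_le_one V(1)] by (intro integrable_const_bound[of _ K]) auto
  let ?m = "expectation V"
  have "expectation (\<lambda>_. 1) \<le> ?m"
    using int V by (intro integral_mono) auto
  then have m: "?m \<ge> 1" by (simp add: prob_space)
  define D where "D = density M (\<lambda>\<omega>. ennreal (V \<omega> / ?m))"
  have nn: "AE \<omega> in M. 0 \<le> V \<omega> / ?m" "V \<omega> \<ge> 0" for \<omega>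
    using m order_trans[OF zero_le_one V(1)] by auto
  have "emeasure D (space D) = (\<integral>\<^sup>+\<omega>. ennreal (V \<omega> / ?m) \<partial>M)"
    unfolding D_def by (subst emeasure_density) (auto intro!: nn_integral_cong)
  also have "\<dots> = ennreal (\<integral>\<omega>. V \<omega> / ?m \<partial>M)"
    using int nn by (intro nn_integral_eq_integral) auto
  also have "(\<integral>\<omega>. V \<omega> / ?m \<partial>M) = 1" using m by simp
  finally have "prob_space D" by (intro prob_spaceI) simp
  then interpret D: prob_space D .
  have [measurable]: "\<zeta> \<in> borel_measurable D" by (simp add: D_def)
  have intD: "(\<integral>\<omega>. f \<omega> \<partial>D) = (\<integral>\<omega>. (V \<omega> / ?m) *\<^sub>R f \<omega> \<partial>M)"
    if [measurable]: "f \<in> borel_measurable M" for f :: "'a \<Rightarrow> 'c :: {banach, second_countable_topology}"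
    unfolding D_def using nn by (intro integral_density) auto
  have rd: "real_distribution (distr M borel \<zeta>)" "real_distribution (distr D borel \<zeta>)"
    by (auto intro!: D.real_distribution_distr real_distribution_distr)
  have "char (distr D borel \<zeta>) = char (distr M borel \<zeta>)"
  proof
    fix u
    have "char (distr D borel \<zeta>) u = (CLINT \<omega>|D. iexp (u * \<zeta> \<omega>))"
      by (simp add: char_def integral_distr)
    also have "\<dots> = (CLINT \<omega>|M. complex_of_real (1 / ?m) * (complex_of_real (V \<omega>) * iexp (u * \<zeta> \<omega>)))"
      by (subst intD) (auto simp: scaleR_conv_of_real intro!: Bochner_Integration.integral_cong)
    also have "\<dots> = complex_of_real (1 / ?m) * (complex_of_real ?m * (CLINT \<omega>|M. iexp (u * \<zeta> \<omega>)))"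
      unfolding integral_mult_right_zero eq ..
    also have "\<dots> = (CLINT \<omega>|M. iexp (u * \<zeta> \<omega>))"
      using m by simp
    also have "\<dots> = char (distr M borel \<zeta>) u"
      by (simp add: char_def integral_distr)
    finally show "char (distr D borel \<zeta>) u = char (distr M borel \<zeta>) u" .
  qed
  then have D_eq: "distr D borel \<zeta> = distr M borel \<zeta>"
    by (rule Levy_uniqueness[OF rd(2,1)])
  have "(\<integral>\<omega>. indicator B (\<zeta> \<omega>) \<partial>D) = (\<integral>x. (indicator B x :: real) \<partial>distr D borel \<zeta>)"
    by (rule integral_distr[symmetric]) auto
  also have "\<dots> = (\<integral>\<omega>. indicator B (\<zeta> \<omega>) \<partial>M)"
    unfolding D_eq by (rule integral_distr) auto
  finally have "(\<integral>\<omega>. (V \<omega> / ?m) * indicator B (\<zeta> \<omega>) \<partial>M) = (\<integral>\<omega>. indicator B (\<zeta> \<omega>) \<partial>M :: real)"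
    by (subst (asm) intD) auto
  moreover have "(\<integral>\<omega>. (V \<omega> / ?m) * indicator B (\<zeta> \<omega>) \<partial>M) = expectation (\<lambda>\<omega>. V \<omega> * indicator B (\<zeta> \<omega>)) / ?m"
    by (simp flip: integral_divide_zero)
  ultimately show ?thesis using m by (simp add: field_simps)
qed

text \<open>
  A bounded complex weight is reduced to positive real ones: the hypothesis passes to the complex conjugate, hence to
  the real and imaginary parts, and the constant 2 can be added to make the real part at least 1.
\<close>

lemma (in prob_space) char_factor:
  fixes W :: "'a \<Rightarrow> complex" and \<zeta> :: "'a \<Rightarrow> real"
  assumes W_meas[measurable]: "random_variable borel W" and [measurable]: "random_variable borel \<zeta>" "B \<in> sets borel"
    and W: "\<And>\<omega>. norm (W \<omega>) \<le> 1"
    and eq: "\<And>u. (CLINT \<omega>|M. W \<omega> * iexp (u * \<zeta> \<omega>)) = (CLINT \<omega>|M. W \<omega>) * (CLINT \<omega>|M. iexp (u * \<zeta> \<omega>))"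
  shows "(CLINT \<omega>|M. W \<omega> * indicator B (\<zeta> \<omega>)) = (CLINT \<omega>|M. W \<omega>) * complex_of_real (prob {\<omega> \<in> space M. \<zeta> \<omega> \<in> B})"
proof -
  have [measurable]: "cnj \<in> borel_measurable borel"
    by (intro borel_measurable_continuous_onI continuous_intros)
  have Re: "expectation (\<lambda>\<omega>. Re (W \<omega>) * indicator B (\<zeta> \<omega>)) = Re (CLINT \<omega>|M. W \<omega>) * expectation (\<lambda>\<omega>. indicator B (\<zeta> \<omega>))"
    if [measurable]: "random_variable borel W" and W: "\<And>\<omega>. norm (W \<omega>) \<le> 1"
      and eq: "\<And>u. (CLINT \<omega>|M. W \<omega> * iexp (u * \<zeta> \<omega>)) = (CLINT \<omega>|M. W \<omega>) * (CLINT \<omega>|M. iexp (u * \<zeta> \<omega>))"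
    for W :: "'a \<Rightarrow> complex"
  proof -
    have i: "integrable M W" "integrable M (\<lambda>\<omega>. W \<omega> * iexp (u * \<zeta> \<omega>))" "integrable M (\<lambda>\<omega>. cnj (W \<omega>) * iexp (u * \<zeta> \<omega>))" 
      "integrable M (\<lambda>\<omega>. iexp (u * \<zeta> \<omega>))" for u
      using W by (auto intro!: integrable_const_bound[of _ 1] simp: norm_mult)
    have iR: "integrable M (\<lambda>\<omega>. Re (W \<omega>))" using i(1) by simp
    have r: "\<bar>Re (W \<omega>)\<bar> \<le> 1" for \<omega> using W[of \<omega>] abs_Re_le_cmod[of "W \<omega>"] by linarith
    have ib: "integrable M (\<lambda>\<omega>. Re (W \<omega>) * indicator B (\<zeta> \<omega>))"
      "integrable M (\<lambda>\<omega>. indicator B (\<zeta> \<omega>) :: real)"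
      using r by (auto intro!: integrable_const_bound[of _ 1] simp: abs_mult indicator_def)
    have c: "(CLINT \<omega>|M. cnj (W \<omega>) * iexp (u * \<zeta> \<omega>)) = cnj (CLINT \<omega>|M. W \<omega>) * (CLINT \<omega>|M. iexp (u * \<zeta> \<omega>))" for u
    proof -
      have "(CLINT \<omega>|M. cnj (W \<omega>) * iexp (u * \<zeta> \<omega>)) = (CLINT \<omega>|M. cnj (W \<omega> * iexp (- u * \<zeta> \<omega>)))"
        by (simp add: exp_cnj)
      also have "\<dots> = cnj (CLINT \<omega>|M. W \<omega> * iexp (- u * \<zeta> \<omega>))"
        by (rule Bochner_Integration.integral_cnj)
      also have "\<dots> = cnj (CLINT \<omega>|M. W \<omega>) * cnj (CLINT \<omega>|M. iexp (- u * \<zeta> \<omega>))"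
        unfolding eq by (rule complex_cnj_mult)
      also have "cnj (CLINT \<omega>|M. iexp (- u * \<zeta> \<omega>)) = (CLINT \<omega>|M. iexp (u * \<zeta> \<omega>))"
        unfolding Bochner_Integration.integral_cnj[symmetric] by (simp add: exp_cnj)
      finally show ?thesis .
    qed
    have "expectation (\<lambda>\<omega>. (Re (W \<omega>) + 2) * indicator B (\<zeta> \<omega>)) =
        expectation (\<lambda>\<omega>. Re (W \<omega>) + 2) * expectation (\<lambda>\<omega>. indicator B (\<zeta> \<omega>))"
    proof (rule char_factor_real[where K = 3])
      fix u
      have re: "complex_of_real (Re z + 2) * e = (W' * e + W'' * e) / 2 + 2 * e"
        if "W' = z" "W'' = cnj z" for z W' W'' e
      proof -
        have "W' * e + W'' * e = complex_of_real (2 * Re z) * e"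
          by (simp only: that distrib_right[symmetric] complex_add_cnj)
        then show ?thesis by (simp add: field_simps)
      qed
      have "(CLINT \<omega>|M. complex_of_real (Re (W \<omega>) + 2) * iexp (u * \<zeta> \<omega>)) =
        (CLINT \<omega>|M. (W \<omega> * iexp (u * \<zeta> \<omega>) + cnj (W \<omega>) * iexp (u * \<zeta> \<omega>)) / 2 + 2 * iexp (u * \<zeta> \<omega>))"
        by (intro Bochner_Integration.integral_cong refl re)
      also have "\<dots> = ((CLINT \<omega>|M. W \<omega>) * (CLINT \<omega>|M. iexp (u * \<zeta> \<omega>)) +
          cnj (CLINT \<omega>|M. W \<omega>) * (CLINT \<omega>|M. iexp (u * \<zeta> \<omega>))) / 2 + 2 * (CLINT \<omega>|M. iexp (u * \<zeta> \<omega>))"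
        using i(1) i(2-4)[of u] eq c by simp
      also have "\<dots> = complex_of_real (Re (CLINT \<omega>|M. W \<omega>) + 2) * (CLINT \<omega>|M. iexp (u * \<zeta> \<omega>))"
        by (rule re[symmetric]) auto
      also have "Re (CLINT \<omega>|M. W \<omega>) + 2 = expectation (\<lambda>\<omega>. Re (W \<omega>) + 2)"
        using iR i(1) by (simp add: prob_space)
      finally show "(CLINT \<omega>|M. complex_of_real (Re (W \<omega>) + 2) * iexp (u * \<zeta> \<omega>)) =
        complex_of_real (expectation (\<lambda>\<omega>. Re (W \<omega>) + 2)) * (CLINT \<omega>|M. iexp (u * \<zeta> \<omega>))" .
    next
      show "1 \<le> Re (W \<omega>) + 2" "Re (W \<omega>) + 2 \<le> 3" for \<omega>
        using r[of \<omega>] by (auto simp: abs_le_iff)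
    qed measurable
    then show ?thesis
      using ib iR i(1) by (simp add: distrib_right prob_space)
  qed
  have P: "expectation (\<lambda>\<omega>. indicator B (\<zeta> \<omega>)) = prob {\<omega> \<in> space M. \<zeta> \<omega> \<in> B}"
  proof -
    have "expectation (\<lambda>\<omega>. indicator B (\<zeta> \<omega>)) = expectation (indicator {\<omega> \<in> space M. \<zeta> \<omega> \<in> B} :: 'a \<Rightarrow> real)"
      by (intro Bochner_Integration.integral_cong) (auto simp: indicator_def)
    then show ?thesis by simp
  qed
  have i: "integrable M W" "integrable M (\<lambda>\<omega>. W \<omega> * indicator B (\<zeta> \<omega>))"
    using W by (auto intro!: integrable_const_bound[of _ 1] simp: norm_mult indicator_def)
  have 1: "expectation (\<lambda>\<omega>. Re (W \<omega>) * indicator B (\<zeta> \<omega>)) = Re (CLINT \<omega>|M. W \<omega>) * prob {\<omega> \<in> space M. \<zeta> \<omega> \<in> B}"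
    using Re[OF W_meas W eq] P by simp
  have "expectation (\<lambda>\<omega>. Re (- \<i> * W \<omega>) * indicator B (\<zeta> \<omega>)) = Re (CLINT \<omega>|M. - \<i> * W \<omega>) * expectation (\<lambda>\<omega>. indicator B (\<zeta> \<omega>))"
    using W eq by (intro Re) (auto simp: norm_mult mult.assoc)
  then have 2: "expectation (\<lambda>\<omega>. Im (W \<omega>) * indicator B (\<zeta> \<omega>)) = Im (CLINT \<omega>|M. W \<omega>) * prob {\<omega> \<in> space M. \<zeta> \<omega> \<in> B}"
    using P by simp
  have ri: "Re (z * indicator B x) = Re z * indicator B x" "Im (z * indicator B x) = Im z * indicator B x"
    for z x by (auto simp: indicator_def)
  show ?thesis
  proof (rule complex_eqI)
    show "Re (CLINT \<omega>|M. W \<omega> * indicator B (\<zeta> \<omega>)) = Re ((CLINT \<omega>|M. W \<omega>) * complex_of_real (prob {\<omega> \<in> space M. \<zeta> \<omega> \<in> B}))"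
      unfolding integral_Re[OF i(2), symmetric] ri 1 by simp
    show "Im (CLINT \<omega>|M. W \<omega> * indicator B (\<zeta> \<omega>)) = Im ((CLINT \<omega>|M. W \<omega>) * complex_of_real (prob {\<omega> \<in> space M. \<zeta> \<omega> \<in> B}))"
      unfolding integral_Im[OF i(2), symmetric] ri 2 by simp
  qed
qed

text \<open>
  Kac's theorem. The factors \<open>iexp (u i * \<zeta> i)\<close> are exchanged one at a time for indicators of \<open>\<zeta> i \<in> A i\<close>;
  each exchange is a use of the weighted uniqueness theorem, with the product of all other factors as weight.
\<close>

lemma (in prob_space) indep_vars_if_char_factors:
  fixes \<zeta> :: "'i \<Rightarrow> 'a \<Rightarrow> real"
  assumes I: "finite I" "I \<noteq> {}" and rv: "\<And>i. i \<in> I \<Longrightarrow> random_variable borel (\<zeta> i)"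
    and char: "\<And>u. (CLINT \<omega>|M. iexp (\<Sum>i\<in>I. u i * \<zeta> i \<omega>)) = (\<Prod>i\<in>I. char (distr M borel (\<zeta> i)) (u i))"
  shows "indep_vars (\<lambda>_. borel) \<zeta> I"
proof -
  have [measurable]: "random_variable borel (\<zeta> i)" if "i \<in> I" for i using rv[OF that] .
  let ?c = "\<lambda>i. char (distr M borel (\<zeta> i))"
  have c0: "?c i 0 = 1" if "i \<in> I" for i
    using real_distribution.char_zero[OF real_distribution_distr[OF rv[OF that]]] .
  have ce: "?c i t = (CLINT \<omega>|M. iexp (t * \<zeta> i \<omega>))" if "i \<in> I" for i t
    using rv[OF that] by (simp add: char_def integral_distr)
  have main: "(CLINT \<omega>|M. (\<Prod>j\<in>J. indicator (A j) (\<zeta> j \<omega>)) * iexp (\<Sum>i\<in>I - J. u i * \<zeta> i \<omega>)) =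
      (\<Prod>j\<in>J. complex_of_real (prob {\<omega> \<in> space M. \<zeta> j \<omega> \<in> A j})) * (\<Prod>i\<in>I - J. ?c i (u i))"
    if "J \<subseteq> I" and A: "\<And>j. j \<in> I \<Longrightarrow> A j \<in> sets borel" for J A u
    using finite_subset[OF that(1) I(1)] that(1)
  proof (induction J arbitrary: u rule: finite_induct)
    case empty
    show ?case using char[of u] by (simp only: prod.empty mult_1_left Diff_empty)
  next
    case (insert k J)
    have k: "k \<in> I" "k \<notin> J" and J: "J \<subseteq> I" "finite J" using insert by auto
    have IJ: "I - J = insert k (I - insert k J)" using k by auto
    have fin: "finite (I - insert k J)" using I by auto
    define W where "W \<omega> = (\<Prod>j\<in>J. indicator (A j) (\<zeta> j \<omega>)) * iexp (\<Sum>i\<in>I - insert k J. u i * \<zeta> i \<omega>)" for \<omega>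
    have [measurable]: "A j \<in> sets borel" if "j \<in> I" for j using A[OF that] .
    have [measurable]: "random_variable borel W"
      unfolding W_def
    proof (intro borel_measurable_times borel_measurable_prod)
      fix j assume "j \<in> J"
      then have "j \<in> I" using J by auto
      then show "(\<lambda>\<omega>. indicator (A j) (\<zeta> j \<omega>) :: complex) \<in> borel_measurable M"
        using measurable_compose[OF rv borel_measurable_indicator[OF A]] by blast
    next
      have "(\<lambda>\<omega>. \<Sum>i\<in>I - insert k J. u i * \<zeta> i \<omega>) \<in> borel_measurable M"
        by (intro borel_measurable_sum borel_measurable_times borel_measurable_const rv) auto
      then show "(\<lambda>\<omega>. iexp (\<Sum>i\<in>I - insert k J. u i * \<zeta> i \<omega>)) \<in> borel_measurable M"
        by measurable
    qed
    have Wn: "norm (W \<omega>) \<le> 1" for \<omega>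
    proof -
      have "norm (\<Prod>j\<in>J. indicator (A j) (\<zeta> j \<omega>) :: complex) \<le> 1"
        unfolding prod_norm[symmetric] by (intro prod_le_1) (auto simp: indicator_def)
      then show ?thesis by (simp add: W_def norm_mult)
    qed
    let ?P = "\<Prod>j\<in>J. complex_of_real (prob {\<omega> \<in> space M. \<zeta> j \<omega> \<in> A j})"
    let ?R = "\<Prod>i\<in>I - insert k J. ?c i (u i)"
    have E: "(CLINT \<omega>|M. W \<omega> * iexp (s * \<zeta> k \<omega>)) = ?P * (?c k s * ?R)" for s
    proof -
      have s1: "(\<Sum>i\<in>I - J. (u(k := s)) i * \<zeta> i \<omega>) = s * \<zeta> k \<omega> + (\<Sum>i\<in>I - insert k J. u i * \<zeta> i \<omega>)" for \<omega>
        unfolding IJ using fin by (subst sum.insert) (auto intro!: sum.cong)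
      have s2: "(\<Prod>i\<in>I - J. ?c i ((u(k := s)) i)) = ?c k s * ?R"
        unfolding IJ using fin by (subst prod.insert) (auto intro!: prod.cong)
      have "W \<omega> * iexp (s * \<zeta> k \<omega>) = (\<Prod>j\<in>J. indicator (A j) (\<zeta> j \<omega>)) * iexp (\<Sum>i\<in>I - J. (u(k := s)) i * \<zeta> i \<omega>)" for \<omega>
        unfolding s1 W_def of_real_add distrib_left exp_add by (simp only: mult_ac)
      then show ?thesis
        using insert.IH[OF J(1), of "u(k := s)"] unfolding s2 by simp
    qed
    have EW: "(CLINT \<omega>|M. W \<omega>) = ?P * ?R"
      using E[of 0] c0[OF k(1)] by simp
    have "(CLINT \<omega>|M. (\<Prod>j\<in>insert k J. indicator (A j) (\<zeta> j \<omega>)) * iexp (\<Sum>i\<in>I - insert k J. u i * \<zeta> i \<omega>)) =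
        (CLINT \<omega>|M. W \<omega> * indicator (A k) (\<zeta> k \<omega>))"
      using k J by (intro Bochner_Integration.integral_cong refl) (simp add: W_def)
    also have "\<dots> = (CLINT \<omega>|M. W \<omega>) * complex_of_real (prob {\<omega> \<in> space M. \<zeta> k \<omega> \<in> A k})"
    proof (rule char_factor)
      fix s show "(CLINT \<omega>|M. W \<omega> * iexp (s * \<zeta> k \<omega>)) = (CLINT \<omega>|M. W \<omega>) * (CLINT \<omega>|M. iexp (s * \<zeta> k \<omega>))"
        unfolding E EW ce[OF k(1)] by (simp only: mult_ac)
    qed (use k Wn A in auto)
    finally show ?case
      using k J by (simp add: EW)
  qed
  show ?thesis
  proof (subst indep_vars_finite[OF I(2,1), where E = "\<lambda>_. sets borel"])
    show "\<forall>A\<in>I \<rightarrow> sets borel. prob (\<Inter>j\<in>I. \<zeta> j -` A j \<inter> space M) = (\<Prod>j\<in>I. prob (\<zeta> j -` A j \<inter> space M))"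
    proof
      fix A :: "'i \<Rightarrow> real set" assume "A \<in> I \<rightarrow> sets borel"
      then have A: "A j \<in> sets borel" if "j \<in> I" for j using that by auto
      have v: "\<zeta> j -` A j \<inter> space M = {\<omega> \<in> space M. \<zeta> j \<omega> \<in> A j}" for j by auto
      have [measurable]: "A j \<in> sets borel" if "j \<in> I" for j using A[OF that] .
      have ms: "(\<Inter>j\<in>I. \<zeta> j -` A j \<inter> space M) \<in> events"
        using I A rv by (intro sets.finite_INT) (auto intro: measurable_sets)
      have "complex_of_real (prob (\<Inter>j\<in>I. \<zeta> j -` A j \<inter> space M)) =
          (CLINT \<omega>|M. complex_of_real (indicator (\<Inter>j\<in>I. \<zeta> j -` A j \<inter> space M) \<omega>))"
        using ms by (simp add: integral_complex_of_real)
      also have "\<dots> = (CLINT \<omega>|M. (\<Prod>j\<in>I. indicator (A j) (\<zeta> j \<omega>)))"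
      proof (intro Bochner_Integration.integral_cong refl)
        fix \<omega> assume "\<omega> \<in> space M"
        then show "complex_of_real (indicator (\<Inter>j\<in>I. \<zeta> j -` A j \<inter> space M) \<omega>) = (\<Prod>j\<in>I. indicator (A j) (\<zeta> j \<omega>))"
          using I by (auto simp: indicator_def prod_zero_iff)
      qed
      also have "\<dots> = complex_of_real (\<Prod>j\<in>I. prob (\<zeta> j -` A j \<inter> space M))"
        using main[OF subset_refl, of A] A by (simp add: v)
      finally show "prob (\<Inter>j\<in>I. \<zeta> j -` A j \<inter> space M) = (\<Prod>j\<in>I. prob (\<zeta> j -` A j \<inter> space M))"
        by (simp only: of_real_eq_iff)
    qed
  qed (use rv sets.sigma_sets_eq[of borel] in \<open>auto simp: sets.Int_stable\<close>)
qed


section \<open>Gaussian elements of a finite-dimensional space\<close>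

text \<open>
  The Gram-Schmidt process. The form may be degenerate: a null vector is orthogonal to everything, which agrees with
  the convention \<open>x / 0 = 0\<close> in the projection coefficients.
\<close>

lemma orthogonalize_form:
  fixes C :: "'k::real_vector \<Rightarrow> 'k \<Rightarrow> real"
  assumes bil: "bilinear C" and sym: "\<And>u v. C u v = C v u" and null: "\<And>u v. C v v = 0 \<Longrightarrow> C u v = 0"
    and "finite F"
  shows "\<exists>W. finite W \<and> F \<subseteq> span W \<and> (\<forall>u\<in>W. \<forall>v\<in>W. u \<noteq> v \<longrightarrow> C u v = 0)"
  using \<open>finite F\<close>
proof (induction F)
  case empty
  show ?case by (intro exI[of _ "{}"]) auto
next
  case (insert e F)
  obtain W where W: "finite W" "F \<subseteq> span W" and orth: "\<forall>u\<in>W. \<forall>v\<in>W. u \<noteq> v \<longrightarrow> C u v = 0"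
    using insert.IH by (elim exE conjE)
  define p where "p = (\<Sum>v\<in>W. (C e v / C v v) *\<^sub>R v)"
  define w where "w = e - p"
  have lin: "linear (\<lambda>x. C x v)" for v using bil by (simp add: bilinear_def)
  have Cw: "C w v = 0" if v: "v \<in> W" for v
  proof -
    have "C p v = (\<Sum>u\<in>W. (C e u / C u u) * C u v)"
      unfolding p_def by (simp add: linear_sum[OF lin] linear_scale[OF lin])
    also have "\<dots> = (\<Sum>u\<in>{v}. (C e u / C u u) * C u v)"
      using W(1) orth v by (intro sum.mono_neutral_right) auto
    finally have "C w v = C e v - C e v / C v v * C v v"
      by (simp add: w_def linear_diff[OF lin])
    then show ?thesis using null[of v e] by (cases "C v v = 0") auto
  qed
  have "p \<in> span W"
    unfolding p_def by (intro span_sum span_scale span_base)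
  then have "p \<in> span (insert w W)"
    using span_mono[of W "insert w W"] by auto
  then have "e \<in> span (insert w W)"
    using span_add[of w "insert w W" p] span_base[of w "insert w W"] by (simp add: w_def)
  moreover have "F \<subseteq> span (insert w W)"
    using W(2) span_mono[of W "insert w W"] by auto
  moreover have "\<forall>u\<in>insert w W. \<forall>v\<in>insert w W. u \<noteq> v \<longrightarrow> C u v = 0"
  proof (intro ballI impI)
    fix x y assume "x \<in> insert w W" "y \<in> insert w W" "x \<noteq> y"
    then consider "x = w" "y \<in> W" | "y = w" "x \<in> W" | "x \<in> W" "y \<in> W" by blast
    then show "C x y = 0"
      using Cw[of y] Cw[of x] sym[of x w] orth \<open>x \<noteq> y\<close> by cases simp_all
  qed
  ultimately show ?case
    using W(1) by (intro exI[of _ "insert w W"]) auto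
qed

lemma (in prob_space) centred_gaussian_char:
  assumes Z: "centred_gaussian M Z"
  obtains \<sigma> where "distr M borel (\<lambda>\<omega>. Z \<omega> \<bullet> u) = distr std_normal_distribution borel (\<lambda>x. \<sigma> * x)"
    "integrable M (\<lambda>\<omega>. (Z \<omega> \<bullet> u)\<^sup>2)" "integrable M (\<lambda>\<omega>. Z \<omega> \<bullet> u)"
    "expectation (\<lambda>\<omega>. (Z \<omega> \<bullet> u)\<^sup>2) = \<sigma>\<^sup>2"
    "(CLINT \<omega>|M. iexp (Z \<omega> \<bullet> u)) = complex_of_real (exp (- expectation (\<lambda>\<omega>. (Z \<omega> \<bullet> u)\<^sup>2) / 2))"
proof -
  have "Z \<in> borel_measurable M" using Z by (simp add: centred_gaussian_def)
  then have [measurable]: "(\<lambda>\<omega>. Z \<omega> \<bullet> u) \<in> borel_measurable M"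
    by (rule measurable_compose) (intro borel_measurable_continuous_onI continuous_intros)
  obtain \<sigma> where \<sigma>: "distr M borel (\<lambda>\<omega>. Z \<omega> \<bullet> u) = distr std_normal_distribution borel (\<lambda>x. \<sigma> * x)"
    using Z by (auto simp: centred_gaussian_def)
  have E: "(\<integral>\<omega>. F (Z \<omega> \<bullet> u) \<partial>M) = (\<integral>x. F (\<sigma> * x) \<partial>std_normal_distribution)"
    if [measurable]: "F \<in> borel_measurable borel" for F :: "real \<Rightarrow> 'c::{banach, second_countable_topology}"
  proof -
    have "(\<integral>\<omega>. F (Z \<omega> \<bullet> u) \<partial>M) = (\<integral>x. F x \<partial>distr M borel (\<lambda>\<omega>. Z \<omega> \<bullet> u))"
      by (rule integral_distr[symmetric]) auto
    also have "\<dots> = (\<integral>x. F (\<sigma> * x) \<partial>std_normal_distribution)"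
      unfolding \<sigma> by (rule integral_distr) auto
    finally show ?thesis .
  qed
  have I: "integrable M (\<lambda>\<omega>. F (Z \<omega> \<bullet> u)) \<longleftrightarrow> integrable std_normal_distribution (\<lambda>x. F (\<sigma> * x))"
    if [measurable]: "F \<in> borel_measurable borel" for F :: "real \<Rightarrow> real"
  proof -
    have "integrable M (\<lambda>\<omega>. F (Z \<omega> \<bullet> u)) \<longleftrightarrow> integrable (distr M borel (\<lambda>\<omega>. Z \<omega> \<bullet> u)) F"
      by (subst integrable_distr_eq) auto
    also have "\<dots> \<longleftrightarrow> integrable std_normal_distribution (\<lambda>x. F (\<sigma> * x))"
      unfolding \<sigma> by (subst integrable_distr_eq) auto
    finally show ?thesis .
  qed
  have 1: "integrable M (\<lambda>\<omega>. (Z \<omega> \<bullet> u)\<^sup>2)" "integrable M (\<lambda>\<omega>. Z \<omega> \<bullet> u)"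
    using I[of "\<lambda>x. x\<^sup>2"] I[of "\<lambda>x. x"] integrable_std_normal_distribution_moment[of 2]
      integrable_std_normal_distribution_moment[of 1]
    by (simp_all add: power_mult_distrib)
  have 2: "expectation (\<lambda>\<omega>. (Z \<omega> \<bullet> u)\<^sup>2) = \<sigma>\<^sup>2"
    using E[of "\<lambda>x. x\<^sup>2"] std_normal_distribution_even_moments(1)[of 1]
    by (simp add: power_mult_distrib)
  have "(CLINT \<omega>|M. iexp (Z \<omega> \<bullet> u)) = char std_normal_distribution \<sigma>"
    using E[of iexp] by (simp add: char_def)
  then have "(CLINT \<omega>|M. iexp (Z \<omega> \<bullet> u)) = complex_of_real (exp (- expectation (\<lambda>\<omega>. (Z \<omega> \<bullet> u)\<^sup>2) / 2))"
    by (simp add: char_std_normal_distribution 2)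
  with \<sigma> 1 2 show ?thesis by (rule that)
qed

text \<open>
  Orthogonalise \<open>B\<close> with respect to the covariance form. The projections of \<open>Z\<close> on the new vectors are uncorrelated,
  and since every linear combination of them is normal with the sum of the variances, their joint characteristic
  function is the product of the individual ones.
\<close>

lemma (in prob_space) centred_gaussian_decomposition:
  fixes Z :: "'a \<Rightarrow> 'k::{real_inner, second_countable_topology}"
  assumes Z: "centred_gaussian M Z" and B: "finite B" and ZB: "AE \<omega> in M. Z \<omega> = (\<Sum>b\<in>B. (Z \<omega> \<bullet> b) *\<^sub>R b)"
  obtains W :: "'k set" and v :: "'k \<Rightarrow> 'k" where "finite W"
    "indep_vars (\<lambda>_. borel) (\<lambda>w \<omega>. Z \<omega> \<bullet> w) W" "AE \<omega> in M. Z \<omega> = (\<Sum>w\<in>W. (Z \<omega> \<bullet> w) *\<^sub>R v w)"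
    "\<And>w w'. w \<in> W \<Longrightarrow> w' \<in> W \<Longrightarrow> w \<noteq> w' \<Longrightarrow> expectation (\<lambda>\<omega>. (Z \<omega> \<bullet> w) * (Z \<omega> \<bullet> w')) = 0"
proof -
  have [measurable]: "Z \<in> borel_measurable M" using Z by (simp add: centred_gaussian_def)
  have i2: "integrable M (\<lambda>\<omega>. (Z \<omega> \<bullet> u)\<^sup>2)" for u
    using centred_gaussian_char[OF Z, of u] by metis
  have i11: "integrable M (\<lambda>\<omega>. (Z \<omega> \<bullet> u) * (Z \<omega> \<bullet> v))" for u v
  proof (rule Bochner_Integration.integrable_bound)
    show "integrable M (\<lambda>\<omega>. (Z \<omega> \<bullet> u)\<^sup>2 + (Z \<omega> \<bullet> v)\<^sup>2)"
      by (intro Bochner_Integration.integrable_add i2)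
    have "\<bar>x * y\<bar> \<le> \<bar>x\<^sup>2 + y\<^sup>2\<bar>" for x y :: real
      using sum_squares_bound[of "\<bar>x\<bar>" "\<bar>y\<bar>"] by (simp add: abs_mult mult.assoc) (smt (verit) mult_nonneg_nonneg abs_ge_zero)
    then show "AE \<omega> in M. norm ((Z \<omega> \<bullet> u) * (Z \<omega> \<bullet> v)) \<le> norm ((Z \<omega> \<bullet> u)\<^sup>2 + (Z \<omega> \<bullet> v)\<^sup>2)"
      by (intro AE_I2) simp
  qed measurable
  define C where "C u v = expectation (\<lambda>\<omega>. (Z \<omega> \<bullet> u) * (Z \<omega> \<bullet> v))" for u v
  have C1: "C (x + y) z = C x z + C y z" "C (c *\<^sub>R x) z = c * C x z" for x y z c
    using i11 unfolding C_def by (simp_all add: inner_add_right distrib_right mult.assoc)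
  have sym: "C u v = C v u" for u v by (simp add: C_def mult.commute)
  have bil: "bilinear C"
  proof -
    have "C x (y + z) = C x y + C x z" "C x (c *\<^sub>R y) = c * C x y" for x y z c
      using C1 by (simp_all only: sym[of x])
    then show ?thesis
      unfolding bilinear_def by (auto intro!: linearI simp: C1)
  qed
  have null: "C u v = 0" if "C v v = 0" for u v
  proof -
    have "AE \<omega> in M. (Z \<omega> \<bullet> v)\<^sup>2 = 0"
      using that i2[of v] integral_nonneg_eq_0_iff_AE[OF i2[of v]] by (simp add: C_def power2_eq_square)
    then have "AE \<omega> in M. (Z \<omega> \<bullet> u) * (Z \<omega> \<bullet> v) = 0" by eventually_elim simp
    then have "C u v = expectation (\<lambda>\<omega>. 0)"
      unfolding C_def by (intro integral_cong_AE) auto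
    then show ?thesis by simp
  qed
  have "\<exists>W. finite W \<and> B \<subseteq> span W \<and> (\<forall>u\<in>W. \<forall>v\<in>W. u \<noteq> v \<longrightarrow> C u v = 0)"
  proof (rule orthogonalize_form[OF bil])
    show "C u v = C v u" for u v by (rule sym)
    show "C u v = 0" if "C v v = 0" for u v using that by (rule null)
  qed (rule B)
  then obtain W0 where W0: "finite W0" "B \<subseteq> span W0" "\<forall>u\<in>W0. \<forall>v\<in>W0. u \<noteq> v \<longrightarrow> C u v = 0"
    by (elim exE conjE)
  \<comment> \<open>The zero vector is added to keep the index set nonempty.\<close>
  define W where "W = insert 0 W0"
  have W: "finite W" "W \<noteq> {}" "B \<subseteq> span W"
    using W0(1,2) by (auto simp: W_def)
  have orth: "C u v = 0" if "u \<in> W" "v \<in> W" "u \<noteq> v" for u v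
  proof (cases "u = 0 \<or> v = 0")
    case True
    then show ?thesis by (auto simp: C_def)
  next
    case False
    then show ?thesis using W0(3) that by (simp add: W_def)
  qed
  have ind: "indep_vars (\<lambda>_. borel) (\<lambda>w \<omega>. Z \<omega> \<bullet> w) W"
  proof (rule indep_vars_if_char_factors[OF W(1,2)])
    fix u :: "'k \<Rightarrow> real"
    let ?x = "\<Sum>w\<in>W. u w *\<^sub>R w"
    have "C ?x ?x = (\<Sum>w\<in>W. \<Sum>w'\<in>W. u w * (u w' * C w w'))"
      using bil by (subst bilinear_sum[OF bil]) (simp add: bilinear_lmul bilinear_rmul sum.cartesian_product W(1))
    also have "\<dots> = (\<Sum>w\<in>W. \<Sum>w'\<in>{w}. u w * (u w' * C w w'))"
      using W(1) by (intro sum.cong refl sum.mono_neutral_right) (auto simp: orth)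
    finally have Cx: "C ?x ?x = (\<Sum>w\<in>W. (u w)\<^sup>2 * C w w)"
      by (simp add: power2_eq_square mult.assoc)
    have char1: "(CLINT \<omega>|M. iexp (Z \<omega> \<bullet> x)) = complex_of_real (exp (- C x x / 2))" for x
      using centred_gaussian_char[OF Z, of x] unfolding C_def power2_eq_square by metis
    have "char (distr M borel (\<lambda>\<omega>. Z \<omega> \<bullet> w)) t = (CLINT \<omega>|M. iexp (Z \<omega> \<bullet> (t *\<^sub>R w)))" for w t
      by (simp add: char_def integral_distr)
    then have char2: "char (distr M borel (\<lambda>\<omega>. Z \<omega> \<bullet> w)) t = complex_of_real (exp (- (t\<^sup>2 * C w w) / 2))" for w t
      unfolding char1 using bil by (simp add: bilinear_lmul bilinear_rmul power2_eq_square mult.assoc)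
    have "(CLINT \<omega>|M. iexp (\<Sum>w\<in>W. u w * (Z \<omega> \<bullet> w))) = (CLINT \<omega>|M. iexp (Z \<omega> \<bullet> ?x))"
      by (simp add: inner_sum_right)
    also have "\<dots> = complex_of_real (exp (\<Sum>w\<in>W. - ((u w)\<^sup>2 * C w w) / 2))"
      unfolding char1 Cx by (simp add: sum_negf sum_divide_distrib)
    also have "\<dots> = (\<Prod>w\<in>W. char (distr M borel (\<lambda>\<omega>. Z \<omega> \<bullet> w)) (u w))"
      unfolding char2 exp_sum[OF W(1)] by simp
    finally show "(CLINT \<omega>|M. iexp (\<Sum>w\<in>W. u w * (Z \<omega> \<bullet> w))) =
        (\<Prod>w\<in>W. char (distr M borel (\<lambda>\<omega>. Z \<omega> \<bullet> w)) (u w))" .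
  qed measurable
  have "\<forall>b\<in>B. \<exists>c. b = (\<Sum>w\<in>W. c w *\<^sub>R w)"
    using W(3) span_finite[OF W(1)] by auto
  then obtain c where c: "\<And>b. b \<in> B \<Longrightarrow> b = (\<Sum>w\<in>W. c b w *\<^sub>R w)" by metis
  define v where "v w = (\<Sum>b\<in>B. c b w *\<^sub>R b)" for w
  have eq: "(\<Sum>b\<in>B. (z \<bullet> b) *\<^sub>R b) = (\<Sum>w\<in>W. (z \<bullet> w) *\<^sub>R v w)" for z
  proof -
    have "(\<Sum>b\<in>B. (z \<bullet> b) *\<^sub>R b) = (\<Sum>b\<in>B. \<Sum>w\<in>W. ((z \<bullet> w) * c b w) *\<^sub>R b)"
    proof (intro sum.cong refl)
      fix b assume "b \<in> B"
      then have "z \<bullet> b = (\<Sum>w\<in>W. (z \<bullet> w) * c b w)"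
        by (subst c) (simp_all add: inner_sum_right mult.commute)
      then show "(z \<bullet> b) *\<^sub>R b = (\<Sum>w\<in>W. ((z \<bullet> w) * c b w) *\<^sub>R b)"
        by (simp add: scaleR_sum_left)
    qed
    also have "\<dots> = (\<Sum>w\<in>W. (z \<bullet> w) *\<^sub>R v w)"
      unfolding v_def by (subst sum.swap) (simp add: scaleR_sum_right)
    finally show ?thesis .
  qed
  show ?thesis
    using that[OF W(1) ind ZB[unfolded eq] orth[unfolded C_def]] by simp
qed


section \<open>The interpolation between the Poisson and the Gaussian sum\<close>

lemma taylor_remainder_order2:
  fixes f f' f'' :: "real \<Rightarrow> real"
  assumes "\<And>t. (f has_real_derivative f' t) (at t)" "\<And>t. (f' has_real_derivative f'' t) (at t)"
    and b: "\<And>t. \<bar>f'' t\<bar> \<le> K"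
  shows "\<bar>f c - f 0 - c * f' 0\<bar> \<le> K * c\<^sup>2 / 2"
proof -
  define d where "d m = (if m = 0 then f else if m = Suc 0 then f' else f'')" for m
  have "\<exists>t. \<bar>t\<bar> \<le> \<bar>c\<bar> \<and> f c = (\<Sum>m<2. d m 0 / fact m * c ^ m) + d 2 t / fact 2 * c ^ 2"
    using assms by (intro Maclaurin_bi_le) (auto simp: d_def less_2_cases_iff)
  then obtain t where "f c = f 0 + f' 0 * c + f'' t / 2 * c\<^sup>2"
    by (auto simp: d_def numeral_2_eq_2)
  then have "f c - f 0 - c * f' 0 = f'' t * c\<^sup>2 / 2" by simp
  then have "\<bar>f c - f 0 - c * f' 0\<bar> = \<bar>f'' t\<bar> * c\<^sup>2 / 2" by (simp only: abs_mult abs_divide) simp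
  also have "\<dots> \<le> K * c\<^sup>2 / 2" using b by (intro divide_right_mono mult_right_mono) auto
  finally show ?thesis .
qed

lemma has_real_derivativeI_scale:
  "(f has_derivative f') F \<Longrightarrow> (\<And>s. f' s = s * c) \<Longrightarrow> (f has_real_derivative c) F"
  unfolding has_field_derivative_def
  by (rule has_derivative_eq_rhs) (auto simp: fun_eq_iff)

lemma lipschitz_if_derivative_le_norm:
  fixes h :: "'k::real_normed_vector \<Rightarrow> real" and D :: "'k \<Rightarrow> 'k \<Rightarrow>\<^sub>L real"
  assumes "\<And>x. (h has_derivative D x) (at x)" "\<And>x u. \<bar>D x u\<bar> \<le> norm u"
  shows "\<bar>h x - h y\<bar> \<le> norm (x - y)"
proof -
  have "norm (h x - h y) \<le> 1 * norm (x - y)"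
  proof (rule differentiable_bound[of UNIV h "\<lambda>x. blinfun_apply (D x)"])
    show "onorm (blinfun_apply (D x)) \<le> 1" for x
      using assms(2) by (intro onorm_bound) auto
  qed (auto intro: assms(1))
  then show ?thesis by simp
qed

text \<open>
  Let \<open>U \<theta>\<close> be the expectation of \<open>h\<close> at \<open>cos \<theta> X + sin \<theta> Z\<close>, with \<open>X\<close> and \<open>Z\<close> on a product space, so that \<open>U 0\<close> and
  \<open>U (pi / 2)\<close> are the two expectations. After the integrations by parts, \<open>U'\<close> is \<open>cos \<theta> sin \<theta>\<close> times the difference
  of the contracted covariances plus \<open>sin \<theta>\<close> times Taylor remainders of order \<open>cos\<^sup>2 \<theta>\<close>. The constants come from
  \<open>\<bar>cos \<theta> sin \<theta>\<bar> \<le> 1 / 2\<close> and from the length \<open>pi / 2\<close> of the path.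
\<close>

lemma smart_path_bound:
  fixes h :: "'k::{real_inner, banach, second_countable_topology} \<Rightarrow> real"
    and D1 :: "'k \<Rightarrow> 'k \<Rightarrow>\<^sub>L real" and D2 :: "'k \<Rightarrow> 'k \<Rightarrow>\<^sub>L 'k \<Rightarrow>\<^sub>L real"
    and D3 :: "'k \<Rightarrow> 'k \<Rightarrow>\<^sub>L 'k \<Rightarrow>\<^sub>L 'k \<Rightarrow>\<^sub>L real"
    and N :: "'i \<Rightarrow> 'a \<Rightarrow> real" and \<eta> :: "'j \<Rightarrow> 'b \<Rightarrow> real"
  assumes M: "prob_space M" and M': "prob_space M'"
    and D1: "\<And>x. (h has_derivative D1 x) (at x)" and D2: "\<And>x. (D1 has_derivative D2 x) (at x)"
    and D3: "\<And>x. (D2 has_derivative D3 x) (at x)"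
    and b1: "\<And>x u. \<bar>D1 x u\<bar> \<le> norm u" and b2: "\<And>x u. \<bar>D2 x u u\<bar> \<le> norm u ^ 2"
    and b3: "\<And>x u. \<bar>D3 x u u u\<bar> \<le> norm u ^ 3"
    and I: "finite I" "prob_space.indep_vars M (\<lambda>_. borel) N I" "\<And>i. i \<in> I \<Longrightarrow> r i \<ge> 0"
    and N: "\<And>i n. i \<in> I \<Longrightarrow> measure M {\<omega> \<in> space M. N i \<omega> = real n} = exp (- r i) * r i ^ n / fact n"
    and J: "finite J" "prob_space.indep_vars M' (\<lambda>_. borel) \<eta> J" "\<And>j. j \<in> J \<Longrightarrow> integrable M' (\<eta> j)"
    and \<eta>: "\<And>j. j \<in> J \<Longrightarrow> distr M' borel (\<eta> j) = distr std_normal_distribution borel (\<lambda>x. \<sigma> j * x)"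
    and X: "\<And>\<omega>. X \<omega> = (\<Sum>i\<in>I. (N i \<omega> - r i) *\<^sub>R a i)" and Z: "\<And>\<omega>. Z \<omega> = (\<Sum>j\<in>J. \<eta> j \<omega> *\<^sub>R v j)"
    and cov: "\<And>x. \<bar>(\<Sum>j\<in>J. (\<sigma> j)\<^sup>2 * D2 x (v j) (v j)) - (\<Sum>i\<in>I. r i * D2 x (a i) (a i))\<bar> \<le> \<delta>"
  shows "\<bar>(\<integral>\<omega>. h (X \<omega>) \<partial>M) - (\<integral>\<omega>. h (Z \<omega>) \<partial>M')\<bar> \<le> pi / 2 * (\<delta> / 2 + (\<Sum>i\<in>I. r i * norm (a i) ^ 3) / 4)"
proof -
  interpret M: prob_space M by fact
  interpret M': prob_space M' by fact
  interpret P: pair_prob_space M M' ..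
  define PM where "PM = M \<Otimes>\<^sub>M M'"
  have PM: "prob_space PM" unfolding PM_def by (rule P.prob_space_axioms)
  interpret PM: prob_space PM by fact
  have ch: "continuous_on UNIV h" "continuous_on UNIV D1" "continuous_on UNIV D2"
    using D1 D2 D3 by (meson has_derivative_continuous continuous_at_imp_continuous_on)+
  note ca = bounded_bilinear.continuous_on[OF bounded_bilinear_blinfun_apply]
  have cD1: "continuous_on UNIV (\<lambda>x. D1 x u)" for u
    by (intro ca ch continuous_on_const)
  have cD2: "continuous_on UNIV (\<lambda>x. D2 x u w)" for u w
    by (intro ca ch continuous_on_const)
  have [measurable]: "h \<in> borel_measurable borel" "(\<lambda>x. D1 x u) \<in> borel_measurable borel"
    "(\<lambda>x. D2 x u w) \<in> borel_measurable borel" for u w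
    by (intro borel_measurable_continuous_onI ch cD1 cD2)+
  have N_meas: "N i \<in> borel_measurable M" if "i \<in> I" for i
    using I(2) that by (auto simp: M.indep_vars_def)
  have \<eta>_meas: "\<eta> j \<in> borel_measurable M'" if "j \<in> J" for j
    using J(2) that by (auto simp: M'.indep_vars_def)
  have X_meas[measurable]: "X \<in> borel_measurable M"
    unfolding X[abs_def] by (intro borel_measurable_sum borel_measurable_scaleR borel_measurable_diff N_meas borel_measurable_const)
  have Z_meas[measurable]: "Z \<in> borel_measurable M'"
    unfolding Z[abs_def] by (intro borel_measurable_sum borel_measurable_scaleR \<eta>_meas borel_measurable_const)
  have Ni: "integrable M (\<lambda>\<omega>. N i \<omega> - r i)" if "i \<in> I" for i
    using M.poisson_moments(1)[OF N_meas[OF that] N[OF that] I(3)[OF that]] by simp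
  have iX: "integrable M (\<lambda>\<omega>. norm (X \<omega>))" and iZ: "integrable M' (\<lambda>\<omega>. norm (Z \<omega>))"
    unfolding X Z using Ni J(3) by (auto intro!: integrable_norm Bochner_Integration.integrable_sum integrable_scaleR_left)
  have lift1: "integrable PM (\<lambda>z. f (fst z))" "(\<integral>z. f (fst z) \<partial>PM) = (\<integral>\<omega>. f \<omega> \<partial>M)"
    if "integrable M f" for f :: "'a \<Rightarrow> real"
  proof -
    have [measurable]: "f \<in> borel_measurable M" using that by auto
    have i: "integrable (M \<Otimes>\<^sub>M M') (\<lambda>(x, y). f x)"
      using that by (intro P.Fubini_integrable) auto
    then show "integrable PM (\<lambda>z. f (fst z))" by (simp add: PM_def split_beta')
    show "(\<integral>z. f (fst z) \<partial>PM) = (\<integral>\<omega>. f \<omega> \<partial>M)"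
      using P.integral_fst[OF i] by (simp add: PM_def split_beta' M'.prob_space)
  qed
  have lift2: "integrable PM (\<lambda>z. f (snd z))" "(\<integral>z. f (snd z) \<partial>PM) = (\<integral>\<omega>. f \<omega> \<partial>M')"
    if "integrable M' f" for f :: "'b \<Rightarrow> real"
  proof -
    have [measurable]: "f \<in> borel_measurable M'" using that by auto
    have i: "integrable (M \<Otimes>\<^sub>M M') (\<lambda>(x, y). f y)"
      using that by (intro P.Fubini_integrable) auto
    then show "integrable PM (\<lambda>z. f (snd z))" by (simp add: PM_def split_beta')
    show "(\<integral>z. f (snd z) \<partial>PM) = (\<integral>\<omega>. f \<omega> \<partial>M')"
      using P.integral_snd[OF i] by (simp add: PM_def split_beta' M.prob_space)
  qed
  note lip = lipschitz_if_derivative_le_norm[OF D1 b1]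
  define Wp where "Wp \<theta> z = cos \<theta> *\<^sub>R X (fst z) + sin \<theta> *\<^sub>R Z (snd z)" for \<theta> z
  have [measurable]: "Wp \<theta> \<in> borel_measurable PM" for \<theta>
    unfolding Wp_def PM_def by measurable
  have hint: "integrable PM (\<lambda>z. h (Wp \<theta> z))" for \<theta>
  proof (rule Bochner_Integration.integrable_bound)
    show "integrable PM (\<lambda>z. \<bar>h 0\<bar> + norm (X (fst z)) + norm (Z (snd z)))"
      by (intro Bochner_Integration.integrable_add lift1 lift2 iX iZ PM.integrable_const)
    have "\<bar>h (Wp \<theta> z)\<bar> \<le> \<bar>h 0\<bar> + norm (X (fst z)) + norm (Z (snd z))" for z
    proof -
      have "\<bar>h (Wp \<theta> z)\<bar> \<le> \<bar>h 0\<bar> + norm (Wp \<theta> z)" using lip[of "Wp \<theta> z" 0] by simp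
      also have "norm (Wp \<theta> z) \<le> \<bar>cos \<theta>\<bar> * norm (X (fst z)) + \<bar>sin \<theta>\<bar> * norm (Z (snd z))"
        unfolding Wp_def by (rule norm_triangle_le) simp
      also have "\<dots> \<le> 1 * norm (X (fst z)) + 1 * norm (Z (snd z))"
        by (intro add_mono mult_right_mono) auto
      finally show ?thesis by simp
    qed
    then show "AE z in PM. norm (h (Wp \<theta> z)) \<le> norm (\<bar>h 0\<bar> + norm (X (fst z)) + norm (Z (snd z)))"
      by (intro AE_I2) (smt (verit) real_norm_def)
  qed measurable
  define U where "U \<theta> = (\<integral>z. h (Wp \<theta> z) \<partial>PM)" for \<theta>
  \<comment> \<open>The velocity of the path.\<close>
  define V where "V \<theta> z = - sin \<theta> *\<^sub>R X (fst z) + cos \<theta> *\<^sub>R Z (snd z)" for \<theta> z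
  have V_eq: "D1 x (V \<theta> z) = - sin \<theta> * (\<Sum>i\<in>I. (N i (fst z) - r i) * D1 x (a i))
      + cos \<theta> * (\<Sum>j\<in>J. \<eta> j (snd z) * D1 x (v j))" for x \<theta> z
    by (simp add: V_def X Z blinfun.bilinear_simps blinfun.sum_right)
  have N_meas'[measurable]: "(\<lambda>z. N i (fst z)) \<in> borel_measurable PM" if "i \<in> I" for i
    unfolding PM_def using N_meas[OF that] by measurable
  have \<eta>_meas'[measurable]: "(\<lambda>z. \<eta> j (snd z)) \<in> borel_measurable PM" if "j \<in> J" for j
    unfolding PM_def using \<eta>_meas[OF that] by measurable
  have iN: "integrable PM (\<lambda>z. (N i (fst z) - r i) * D1 (Wp \<theta> z) u)" if "i \<in> I" for i u \<theta>
  proof (rule Bochner_Integration.integrable_bound)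
    show "integrable PM (\<lambda>z. (N i (fst z) - r i) * norm u)"
      by (intro integrable_mult_left lift1 Ni that)
    show "AE z in PM. norm ((N i (fst z) - r i) * D1 (Wp \<theta> z) u) \<le> norm ((N i (fst z) - r i) * norm u)"
      by (intro AE_I2) (auto simp: abs_mult intro!: mult_left_mono b1)
    show "(\<lambda>z. (N i (fst z) - r i) * D1 (Wp \<theta> z) u) \<in> borel_measurable PM"
      using N_meas'[OF that] by measurable
  qed
  have i\<eta>: "integrable PM (\<lambda>z. \<eta> j (snd z) * D1 (Wp \<theta> z) u)" if "j \<in> J" for j u \<theta>
  proof (rule Bochner_Integration.integrable_bound)
    show "integrable PM (\<lambda>z. \<eta> j (snd z) * norm u)"
      by (intro integrable_mult_left lift2 J(3) that)
    show "AE z in PM. norm (\<eta> j (snd z) * D1 (Wp \<theta> z) u) \<le> norm (\<eta> j (snd z) * norm u)"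
      by (intro AE_I2) (auto simp: abs_mult intro!: mult_left_mono b1)
    show "(\<lambda>z. \<eta> j (snd z) * D1 (Wp \<theta> z) u) \<in> borel_measurable PM"
      using \<eta>_meas'[OF that] by measurable
  qed
  have bD1: "integrable PM (\<lambda>z. D1 (Wp \<theta> z + w) u)" for \<theta> u w
    by (rule PM.integrable_const_bound[of _ "norm u"]) (auto simp: b1)
  have bD2: "integrable PM (\<lambda>z. D2 (Wp \<theta> z) u u)" for \<theta> u
    by (rule PM.integrable_const_bound[of _ "norm u ^ 2"]) (use b2 in auto)
  \<comment> \<open>Poisson integration by parts, with the Gaussian component held fixed.\<close>
  have N_parts: "(\<integral>z. (N i (fst z) - r i) * D1 (Wp \<theta> z) (a i) \<partial>PM) =
      r i * (\<integral>z. D1 (Wp \<theta> z + cos \<theta> *\<^sub>R a i) (a i) - D1 (Wp \<theta> z) (a i) \<partial>PM)" if i: "i \<in> I" for i \<theta>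
  proof -
    have "(\<integral>z. (N i (fst z) - r i) * D1 (Wp \<theta> z) (a i) \<partial>PM) =
      (\<integral>y. (\<integral>x. (N i x - r i) * D1 (Wp \<theta> (x, y)) (a i) \<partial>M) \<partial>M')"
      using P.integral_snd[of "\<lambda>x y. (N i x - r i) * D1 (Wp \<theta> (x, y)) (a i)"] iN[OF i, of \<theta> "a i"]
      by (simp add: PM_def split_beta')
    also have "(\<lambda>y. \<integral>x. (N i x - r i) * D1 (Wp \<theta> (x, y)) (a i) \<partial>M) =
      (\<lambda>y. r i * (\<integral>x. D1 (Wp \<theta> (x, y) + cos \<theta> *\<^sub>R a i) (a i) - D1 (Wp \<theta> (x, y)) (a i) \<partial>M))"
    proof
      fix y
      let ?f = "\<lambda>x. D1 (cos \<theta> *\<^sub>R x + sin \<theta> *\<^sub>R Z y) (a i)"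
      have "continuous_on UNIV ?f"
        by (rule continuous_on_compose2[OF cD1]) (auto intro!: continuous_intros)
      from M.compensated_poisson_by_parts[where N = N and r = r and a = a and f = ?f, OF I(1,2) i N[OF i] I(3)[OF i] this b1]
      show "(\<integral>x. (N i x - r i) * D1 (Wp \<theta> (x, y)) (a i) \<partial>M) =
        r i * (\<integral>x. D1 (Wp \<theta> (x, y) + cos \<theta> *\<^sub>R a i) (a i) - D1 (Wp \<theta> (x, y)) (a i) \<partial>M)"
        unfolding X[symmetric] Wp_def by (simp add: scaleR_add_right add_ac)
    qed
    also have "(\<integral>y. r i * (\<integral>x. D1 (Wp \<theta> (x, y) + cos \<theta> *\<^sub>R a i) (a i) - D1 (Wp \<theta> (x, y)) (a i) \<partial>M) \<partial>M') =
      r i * (\<integral>z. D1 (Wp \<theta> z + cos \<theta> *\<^sub>R a i) (a i) - D1 (Wp \<theta> z) (a i) \<partial>PM)"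
      using P.integral_snd[of "\<lambda>x y. D1 (Wp \<theta> (x, y) + cos \<theta> *\<^sub>R a i) (a i) - D1 (Wp \<theta> (x, y)) (a i)"]
        bD1[of \<theta> "cos \<theta> *\<^sub>R a i" "a i"] bD1[of \<theta> 0 "a i"]
      by (simp add: PM_def split_beta')
    finally show ?thesis .
  qed
  \<comment> \<open>Gaussian integration by parts, with the Poisson component held fixed.\<close>
  have \<eta>_parts: "(\<integral>z. \<eta> j (snd z) * D1 (Wp \<theta> z) (v j) \<partial>PM) =
      (\<sigma> j)\<^sup>2 * (sin \<theta> * (\<integral>z. D2 (Wp \<theta> z) (v j) (v j) \<partial>PM))" if j: "j \<in> J" for j \<theta>
  proof -
    have "(\<integral>z. \<eta> j (snd z) * D1 (Wp \<theta> z) (v j) \<partial>PM) =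
      (\<integral>x. (\<integral>y. \<eta> j y * D1 (Wp \<theta> (x, y)) (v j) \<partial>M') \<partial>M)"
      using P.integral_fst[of "\<lambda>x y. \<eta> j y * D1 (Wp \<theta> (x, y)) (v j)"] i\<eta>[OF j, of \<theta> "v j"]
      by (simp add: PM_def split_beta')
    also have "(\<lambda>x. \<integral>y. \<eta> j y * D1 (Wp \<theta> (x, y)) (v j) \<partial>M') =
      (\<lambda>x. (\<sigma> j)\<^sup>2 * (\<integral>y. sin \<theta> * D2 (Wp \<theta> (x, y)) (v j) (v j) \<partial>M'))"
    proof
      fix x
      let ?L = "\<lambda>y. cos \<theta> *\<^sub>R X x + sin \<theta> *\<^sub>R y"
      let ?g = "\<lambda>y. D1 (?L y) (v j)"
      let ?g' = "\<lambda>y. sin \<theta> * D2 (?L y) (v j) (v j)"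
      have c: "continuous_on UNIV ?g" "continuous_on UNIV ?g'"
        by (auto intro!: continuous_intros continuous_on_compose2[OF cD1] continuous_on_compose2[OF cD2])
      have "((\<lambda>s. ?g (y + s *\<^sub>R v j)) has_real_derivative ?g' y) (at 0)" for y
      proof -
        have l: "((\<lambda>s. ?L (y + s *\<^sub>R v j)) has_derivative (\<lambda>s. sin \<theta> *\<^sub>R (s *\<^sub>R v j))) (at 0)"
          by (auto intro!: derivative_eq_intros)
        have "((\<lambda>s. D1 (?L (y + s *\<^sub>R v j))) has_derivative (\<lambda>s. D2 (?L y) (sin \<theta> *\<^sub>R (s *\<^sub>R v j)))) (at 0)"
          using has_derivative_compose[OF l, of D1] D2[of "?L y"] by simp
        from bounded_linear.has_derivative[OF blinfun.bounded_linear_left this]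
        have "((\<lambda>s. ?g (y + s *\<^sub>R v j)) has_derivative (\<lambda>s. D2 (?L y) (sin \<theta> *\<^sub>R (s *\<^sub>R v j)) (v j))) (at 0)" .
        then show ?thesis
          by (rule has_real_derivativeI_scale) (simp add: blinfun.bilinear_simps)
      qed
      from M'.gaussian_sum_by_parts[where \<eta> = \<eta> and v = v and g = ?g and g' = ?g', OF J(1,2) j \<eta>[OF j] J(3)[OF j] this c b1, of "1 * norm (v j) ^ 2"]
      show "(\<integral>y. \<eta> j y * D1 (Wp \<theta> (x, y)) (v j) \<partial>M') =
        (\<sigma> j)\<^sup>2 * (\<integral>y. sin \<theta> * D2 (Wp \<theta> (x, y)) (v j) (v j) \<partial>M')"
        unfolding Z[symmetric] Wp_def fst_conv snd_conv
        by (simp add: abs_mult) (metis mult_mono[OF abs_sin_le_one b2 zero_le_one abs_ge_zero] mult_1)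
    qed
    also have "(\<integral>x. (\<sigma> j)\<^sup>2 * (\<integral>y. sin \<theta> * D2 (Wp \<theta> (x, y)) (v j) (v j) \<partial>M') \<partial>M) =
      (\<sigma> j)\<^sup>2 * (sin \<theta> * (\<integral>z. D2 (Wp \<theta> z) (v j) (v j) \<partial>PM))"
      using P.integral_fst[of "\<lambda>x y. D2 (Wp \<theta> (x, y)) (v j) (v j)"] bD2[of \<theta> "v j"]
      by (simp add: PM_def split_beta')
    finally show ?thesis .
  qed
  define K where "K = \<delta> / 2 + (\<Sum>i\<in>I. r i * norm (a i) ^ 3) / 4"
  have U_deriv: "(U has_real_derivative (\<integral>z. D1 (Wp \<theta> z) (V \<theta> z) \<partial>PM)) (at \<theta>)" for \<theta>
    unfolding U_def
  proof (rule has_real_derivative_integral[where g = "\<lambda>z. norm (X (fst z)) + norm (Z (snd z))"])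
    show "integrable PM (\<lambda>z. norm (X (fst z)) + norm (Z (snd z)))"
      by (intro Bochner_Integration.integrable_add lift1 lift2 iX iZ)
    show "(\<lambda>z. D1 (Wp \<theta> z) (V \<theta> z)) \<in> borel_measurable PM"
      unfolding V_eq using iN i\<eta>
      by (intro borel_measurable_add borel_measurable_times borel_measurable_const borel_measurable_sum)
        (auto intro: borel_measurable_integrable)
    show "((\<lambda>t. h (Wp t z)) has_real_derivative D1 (Wp t z) (V t z)) (at t)" for t z
    proof -
      have "((\<lambda>t. Wp t z) has_vector_derivative V t z) (at t)"
        unfolding Wp_def V_def has_vector_derivative_def
        by (auto intro!: derivative_eq_intros simp: algebra_simps)
      from vector_derivative_diff_chain_within[OF this has_derivative_at_withinI[OF D1]]
      show ?thesis by (simp add: o_def has_real_derivative_iff_has_vector_derivative)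
    qed
    show "\<bar>D1 (Wp t z) (V t z)\<bar> \<le> norm (X (fst z)) + norm (Z (snd z))" for t z
    proof -
      have "norm (V t z) \<le> \<bar>sin t\<bar> * norm (X (fst z)) + \<bar>cos t\<bar> * norm (Z (snd z))"
        unfolding V_def by (rule norm_triangle_le) simp
      also have "\<dots> \<le> 1 * norm (X (fst z)) + 1 * norm (Z (snd z))"
        by (intro add_mono mult_right_mono) auto
      finally show ?thesis using b1[of "Wp t z" "V t z"] by linarith
    qed
  qed (rule hint)
  have taylor: "\<bar>D1 (w + c *\<^sub>R u) u - D1 w u - c * D2 w u u\<bar> \<le> norm u ^ 3 * c\<^sup>2 / 2" for w u c
  proof -
    have l: "((\<lambda>s. w + s *\<^sub>R u) has_derivative (\<lambda>s. s *\<^sub>R u)) (at t)" for t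
      by (auto intro!: derivative_eq_intros)
    have 1: "((\<lambda>s. D1 (w + s *\<^sub>R u) u) has_real_derivative D2 (w + t *\<^sub>R u) u u) (at t)" for t
      by (rule has_real_derivativeI_scale[OF bounded_linear.has_derivative[OF blinfun.bounded_linear_left
          has_derivative_compose[OF l[of t] D2]]]) (simp add: blinfun.bilinear_simps)
    have 2: "((\<lambda>s. D2 (w + s *\<^sub>R u) u u) has_real_derivative D3 (w + t *\<^sub>R u) u u u) (at t)" for t
      by (rule has_real_derivativeI_scale[OF bounded_linear.has_derivative[OF blinfun.bounded_linear_left
          bounded_linear.has_derivative[OF blinfun.bounded_linear_left has_derivative_compose[OF l[of t] D3]]]])
        (simp add: blinfun.bilinear_simps)
    show ?thesis
      using taylor_remainder_order2[OF 1 2 b3] by simp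
  qed
  have U_bound: "\<bar>\<integral>z. D1 (Wp \<theta> z) (V \<theta> z) \<partial>PM\<bar> \<le> K" for \<theta>
  proof -
    let ?c = "cos \<theta>" and ?s = "sin \<theta>"
    let ?G = "\<lambda>z. ?c * ?s * (\<Sum>j\<in>J. (\<sigma> j)\<^sup>2 * D2 (Wp \<theta> z) (v j) (v j))
        - ?s * (\<Sum>i\<in>I. r i * (D1 (Wp \<theta> z + ?c *\<^sub>R a i) (a i) - D1 (Wp \<theta> z) (a i)))"
    have d: "integrable PM (\<lambda>z. D1 (Wp \<theta> z + ?c *\<^sub>R u) u - D1 (Wp \<theta> z) u)" for u
      using bD1[of \<theta> "?c *\<^sub>R u" u] bD1[of \<theta> 0 u] by simp
    have "(\<integral>z. D1 (Wp \<theta> z) (V \<theta> z) \<partial>PM) =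
      - ?s * (\<Sum>i\<in>I. \<integral>z. (N i (fst z) - r i) * D1 (Wp \<theta> z) (a i) \<partial>PM)
      + ?c * (\<Sum>j\<in>J. \<integral>z. \<eta> j (snd z) * D1 (Wp \<theta> z) (v j) \<partial>PM)"
      unfolding V_eq using iN i\<eta>
      by (subst Bochner_Integration.integral_add)
        (auto intro!: integrable_mult_right Bochner_Integration.integrable_sum simp: Bochner_Integration.integral_sum)
    also have "\<dots> = - ?s * (\<Sum>i\<in>I. r i * (\<integral>z. D1 (Wp \<theta> z + ?c *\<^sub>R a i) (a i) - D1 (Wp \<theta> z) (a i) \<partial>PM))
      + ?c * (\<Sum>j\<in>J. (\<sigma> j)\<^sup>2 * (?s * (\<integral>z. D2 (Wp \<theta> z) (v j) (v j) \<partial>PM)))"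
      by (simp only: N_parts \<eta>_parts cong: sum.cong)
    also have "\<dots> = (\<integral>z. ?G z \<partial>PM)"
    proof -
      have "(\<integral>z. ?G z \<partial>PM) = ?c * ?s * (\<Sum>j\<in>J. (\<sigma> j)\<^sup>2 * (\<integral>z. D2 (Wp \<theta> z) (v j) (v j) \<partial>PM))
        - ?s * (\<Sum>i\<in>I. r i * (\<integral>z. D1 (Wp \<theta> z + ?c *\<^sub>R a i) (a i) - D1 (Wp \<theta> z) (a i) \<partial>PM))"
        using d bD2 by (subst Bochner_Integration.integral_diff)
          (auto intro!: integrable_mult_right Bochner_Integration.integrable_sum simp: Bochner_Integration.integral_sum)
      then show ?thesis by (simp add: sum_distrib_left mult_ac sum_negf)
    qed
    finally have eq: "(\<integral>z. D1 (Wp \<theta> z) (V \<theta> z) \<partial>PM) = (\<integral>z. ?G z \<partial>PM)" .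
    \<comment> \<open>Extract the linear part of the increments of \<open>D1\<close>; it is compared with the Gaussian term by \<open>cov\<close>.\<close>
    have G: "\<bar>?G z\<bar> \<le> K" for z
    proof -
      let ?w = "Wp \<theta> z"
      let ?S = "\<Sum>j\<in>J. (\<sigma> j)\<^sup>2 * D2 ?w (v j) (v j)" and ?T = "\<Sum>i\<in>I. r i * D2 ?w (a i) (a i)"
      let ?R = "\<Sum>i\<in>I. r i * (D1 (?w + ?c *\<^sub>R a i) (a i) - D1 ?w (a i) - ?c * D2 ?w (a i) (a i))"
      let ?L = "\<Sum>i\<in>I. r i * norm (a i) ^ 3"
      have "?G z = ?c * ?s * (?S - ?T) - ?s * ?R"
        by (simp add: algebra_simps sum_subtractf sum.distrib sum_distrib_left)
      then have "\<bar>?G z\<bar> \<le> \<bar>?c * ?s * (?S - ?T)\<bar> + \<bar>?s * ?R\<bar>"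
        by (simp only: abs_triangle_ineq4)
      also have "\<dots> = \<bar>?c * ?s\<bar> * \<bar>?S - ?T\<bar> + \<bar>?s\<bar> * \<bar>?R\<bar>"
        by (simp only: abs_mult)
      also have "\<dots> \<le> \<bar>?c * ?s\<bar> * \<delta> + \<bar>?s\<bar> * (?c\<^sup>2 / 2 * ?L)"
      proof (intro add_mono mult_left_mono cov abs_ge_zero)
        have "\<bar>?R\<bar> \<le> (\<Sum>i\<in>I. r i * (norm (a i) ^ 3 * ?c\<^sup>2 / 2))"
        proof (rule order_trans[OF sum_abs sum_mono])
          fix i assume i: "i \<in> I"
          show "\<bar>r i * (D1 (?w + ?c *\<^sub>R a i) (a i) - D1 ?w (a i) - ?c * D2 ?w (a i) (a i))\<bar>
              \<le> r i * (norm (a i) ^ 3 * ?c\<^sup>2 / 2)"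
            unfolding abs_mult abs_of_nonneg[OF I(3)[OF i]] by (rule mult_left_mono[OF taylor I(3)[OF i]])
        qed
        then show "\<bar>?R\<bar> \<le> ?c\<^sup>2 / 2 * ?L"
          by (simp add: sum_distrib_left mult_ac)
      qed
      also have "\<dots> \<le> 1 / 2 * \<delta> + 1 / 4 * ?L"
      proof -
        have "\<delta> \<ge> 0" using cov[of 0] abs_ge_zero order_trans by blast
        have L: "?L \<ge> 0" by (intro sum_nonneg mult_nonneg_nonneg I(3)) auto
        have cs: "\<bar>?c * ?s\<bar> \<le> 1 / 2"
          using sin_double[of \<theta>] abs_sin_le_one[of "2 * \<theta>"] by (simp add: mult_ac abs_mult)
        have "\<bar>?s\<bar> * ?c\<^sup>2 = \<bar>?c * ?s\<bar> * \<bar>?c\<bar>"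
          by (simp add: power2_eq_square abs_mult) 
        also have "\<dots> \<le> 1 / 2 * 1" using cs by (intro mult_mono) auto
        finally have "\<bar>?s\<bar> * ?c\<^sup>2 * (?L / 2) \<le> 1 / 2 * (?L / 2)" using L by (intro mult_right_mono) auto
        then show ?thesis
          using mult_right_mono[OF cs \<open>\<delta> \<ge> 0\<close>] by (simp add: mult_ac)
      qed
      finally show ?thesis by (simp add: K_def)
    qed
    have "\<bar>\<integral>z. ?G z \<partial>PM\<bar> \<le> (\<integral>z. \<bar>?G z\<bar> \<partial>PM)"
      by (rule integral_abs_bound)
    also have "\<dots> \<le> (\<integral>z. K \<partial>PM)"
    proof (rule integral_mono)
      show "integrable PM (\<lambda>z. \<bar>?G z\<bar>)"
        by (intro d bD2 integrable_abs Bochner_Integration.integrable_diff integrable_mult_right Bochner_Integration.integrable_sum)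
    qed (use G in auto)
    finally show ?thesis unfolding eq by (simp add: PM.prob_space)
  qed
  obtain z where "U (pi / 2) - U 0 = (pi / 2 - 0) * (\<integral>w. D1 (Wp z w) (V z w) \<partial>PM)"
    using MVT2[of 0 "pi / 2" U "\<lambda>\<theta>. \<integral>w. D1 (Wp \<theta> w) (V \<theta> w) \<partial>PM"] U_deriv by auto
  then have "U (pi / 2) - U 0 = pi / 2 * (\<integral>w. D1 (Wp z w) (V z w) \<partial>PM)"
    by (simp only: diff_0_right)
  then have "\<bar>U 0 - U (pi / 2)\<bar> = \<bar>pi / 2 * (\<integral>w. D1 (Wp z w) (V z w) \<partial>PM)\<bar>"
    by (simp only: abs_minus_commute[of "U 0"])
  also have "\<dots> = pi / 2 * \<bar>\<integral>w. D1 (Wp z w) (V z w) \<partial>PM\<bar>"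
    by (simp only: abs_mult) simp
  also have "\<dots> \<le> pi / 2 * K"
    by (intro mult_left_mono U_bound) auto
  also have "U 0 = (\<integral>\<omega>. h (X \<omega>) \<partial>M)"
  proof -
    have "integrable M (\<lambda>\<omega>. h (X \<omega>))"
    proof (rule Bochner_Integration.integrable_bound)
      show "integrable M (\<lambda>\<omega>. \<bar>h 0\<bar> + norm (X \<omega>))" by (intro Bochner_Integration.integrable_add iX M.integrable_const)
      show "AE \<omega> in M. norm (h (X \<omega>)) \<le> norm (\<bar>h 0\<bar> + norm (X \<omega>))"
        using lip[of _ 0] by (intro AE_I2) (smt (verit) real_norm_def diff_zero norm_ge_zero)
    qed measurable
    from lift1(2)[OF this] show ?thesis by (simp add: U_def Wp_def)
  qed
  also have "U (pi / 2) = (\<integral>\<omega>. h (Z \<omega>) \<partial>M')"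
  proof -
    have "integrable M' (\<lambda>\<omega>. h (Z \<omega>))"
    proof (rule Bochner_Integration.integrable_bound)
      show "integrable M' (\<lambda>\<omega>. \<bar>h 0\<bar> + norm (Z \<omega>))" by (intro Bochner_Integration.integrable_add iZ M'.integrable_const)
      show "AE \<omega> in M'. norm (h (Z \<omega>)) \<le> norm (\<bar>h 0\<bar> + norm (Z \<omega>))"
        using lip[of _ 0] by (intro AE_I2) (smt (verit) real_norm_def diff_zero norm_ge_zero)
    qed measurable
    from lift2(2)[OF this] show ?thesis by (simp add: U_def Wp_def)
  qed
  finally show ?thesis by (simp only: K_def)
qed


section \<open>Covariances and the support of the Gaussian element\<close>

text \<open>
  Polarisation bounds the symmetric part of \<open>B\<close> on pairs of unit vectors, and homogeneity does the rest.
\<close>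

lemma quadratic_form_diff_bound:
  fixes B :: "'k::real_inner \<Rightarrow>\<^sub>L 'k \<Rightarrow>\<^sub>L real"
  assumes B: "\<And>u. \<bar>B u u\<bar> \<le> (norm u)\<^sup>2"
  shows "\<bar>B x x - B y y\<bar> \<le> 2 * norm y * norm (x - y) + (norm (x - y))\<^sup>2"
proof -
  define d where "d = x - y"
  have x: "x = y + d" by (simp add: d_def)
  have pol: "\<bar>B u w + B w u\<bar> \<le> (norm u)\<^sup>2 + (norm w)\<^sup>2" for u w
  proof -
    have "2 * (B u w + B w u) = B (u + w) (u + w) - B (u - w) (u - w)"
      by (simp add: blinfun.bilinear_simps)
    then have "2 * \<bar>B u w + B w u\<bar> \<le> (norm (u + w))\<^sup>2 + (norm (u - w))\<^sup>2"
      using B[of "u + w"] B[of "u - w"] by linarith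
    also have "\<dots> = 2 * ((norm u)\<^sup>2 + (norm w)\<^sup>2)"
      by (simp add: power2_norm_eq_inner inner_simps)
    finally show ?thesis by simp
  qed
  have "\<bar>B y d + B d y\<bar> \<le> 2 * norm y * norm d"
  proof (cases "y = 0 \<or> d = 0")
    case True
    then show ?thesis by (auto simp: blinfun.bilinear_simps)
  next
    case False
    then have ny: "norm y > 0" and nd: "norm d > 0" by auto
    have "\<bar>B (y /\<^sub>R norm y) (d /\<^sub>R norm d) + B (d /\<^sub>R norm d) (y /\<^sub>R norm y)\<bar> \<le> 2"
      using pol[of "y /\<^sub>R norm y" "d /\<^sub>R norm d"] ny nd by simp
    moreover have "B (y /\<^sub>R norm y) (d /\<^sub>R norm d) + B (d /\<^sub>R norm d) (y /\<^sub>R norm y) =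
        (B y d + B d y) / (norm y * norm d)"
      using ny nd by (simp add: blinfun.bilinear_simps field_simps)
    ultimately show ?thesis
      using ny nd by (simp add: abs_mult abs_divide pos_divide_le_eq mult.assoc)
  qed
  moreover have "B x x - B y y = (B y d + B d y) + B d d"
    by (simp add: x blinfun.bilinear_simps)
  ultimately show ?thesis
    using B[of d] unfolding d_def[symmetric] by linarith
qed

lemma blinfun_quadratic_sum:
  fixes B :: "'k::real_normed_vector \<Rightarrow>\<^sub>L 'k \<Rightarrow>\<^sub>L real"
  shows "B (\<Sum>j\<in>J. c j *\<^sub>R v j) (\<Sum>j\<in>J. c j *\<^sub>R v j) = (\<Sum>i\<in>J. \<Sum>j\<in>J. (c i * c j) * B (v i) (v j))"
  by (simp add: blinfun.sum_left blinfun.sum_right blinfun.scaleR_left blinfun.scaleR_right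
      sum_distrib_left) (subst sum.swap, simp add: mult_ac)

text \<open>
  The covariance of a sum of uncorrelated multiples of fixed vectors is diagonal in these vectors.
\<close>

lemma (in prob_space) expectation_quadratic_uncorrelated:
  fixes B :: "'k::real_normed_vector \<Rightarrow>\<^sub>L 'k \<Rightarrow>\<^sub>L real" and \<eta> :: "'j \<Rightarrow> 'a \<Rightarrow> real"
  assumes "finite J" and int: "\<And>i j. i \<in> J \<Longrightarrow> j \<in> J \<Longrightarrow> integrable M (\<lambda>\<omega>. \<eta> i \<omega> * \<eta> j \<omega>)"
    and unc: "\<And>i j. i \<in> J \<Longrightarrow> j \<in> J \<Longrightarrow> i \<noteq> j \<Longrightarrow> expectation (\<lambda>\<omega>. \<eta> i \<omega> * \<eta> j \<omega>) = 0"
  shows "expectation (\<lambda>\<omega>. B (\<Sum>j\<in>J. \<eta> j \<omega> *\<^sub>R v j) (\<Sum>j\<in>J. \<eta> j \<omega> *\<^sub>R v j)) =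
    (\<Sum>j\<in>J. expectation (\<lambda>\<omega>. (\<eta> j \<omega>)\<^sup>2) * B (v j) (v j))"
proof -
  have "expectation (\<lambda>\<omega>. B (\<Sum>j\<in>J. \<eta> j \<omega> *\<^sub>R v j) (\<Sum>j\<in>J. \<eta> j \<omega> *\<^sub>R v j)) =
    expectation (\<lambda>\<omega>. \<Sum>i\<in>J. \<Sum>j\<in>J. (\<eta> i \<omega> * \<eta> j \<omega>) * B (v i) (v j))"
    unfolding blinfun_quadratic_sum ..
  also have "\<dots> = (\<Sum>i\<in>J. \<Sum>j\<in>J. expectation (\<lambda>\<omega>. \<eta> i \<omega> * \<eta> j \<omega>) * B (v i) (v j))"
    using int by (simp add: Bochner_Integration.integral_sum)
  also have "\<dots> = (\<Sum>i\<in>J. \<Sum>j\<in>{i}. expectation (\<lambda>\<omega>. \<eta> i \<omega> * \<eta> j \<omega>) * B (v i) (v j))"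
    using unc \<open>finite J\<close> by (intro sum.cong refl sum.mono_neutral_right) auto
  finally show ?thesis by (simp add: power2_eq_square)
qed

lemma (in prob_space) covariance_operator_inner:
  fixes Z :: "'a \<Rightarrow> 'k::{real_inner, banach, second_countable_topology}"
  assumes [measurable]: "Z \<in> borel_measurable M" and Z: "integrable M (\<lambda>\<omega>. (norm (Z \<omega>))\<^sup>2)"
  shows "integrable M (\<lambda>\<omega>. (Z \<omega> \<bullet> u) * (Z \<omega> \<bullet> w))"
    "expectation (\<lambda>\<omega>. (Z \<omega> \<bullet> u) * (Z \<omega> \<bullet> w)) = covariance_operator M Z u \<bullet> w"
proof -
  have i: "integrable M (\<lambda>\<omega>. (Z \<omega> \<bullet> u) *\<^sub>R Z \<omega>)"
  proof (rule Bochner_Integration.integrable_bound)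
    show "integrable M (\<lambda>\<omega>. norm u * (norm (Z \<omega>))\<^sup>2)" using Z by simp
    have "norm ((Z \<omega> \<bullet> u) *\<^sub>R Z \<omega>) \<le> norm u * (norm (Z \<omega>))\<^sup>2" for \<omega>
      using mult_right_mono[OF Cauchy_Schwarz_ineq2[of "Z \<omega>" u] norm_ge_zero[of "Z \<omega>"]]
      by (simp add: power2_eq_square mult_ac)
    then show "AE \<omega> in M. norm ((Z \<omega> \<bullet> u) *\<^sub>R Z \<omega>) \<le> norm (norm u * (norm (Z \<omega>))\<^sup>2)" by simp
  qed measurable
  show "integrable M (\<lambda>\<omega>. (Z \<omega> \<bullet> u) * (Z \<omega> \<bullet> w))"
    using integrable_inner_left[of w, OF i] by simp
  show "expectation (\<lambda>\<omega>. (Z \<omega> \<bullet> u) * (Z \<omega> \<bullet> w)) = covariance_operator M Z u \<bullet> w"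
    unfolding covariance_operator_def using integral_inner_left[of w, OF i] by simp
qed

lemma (in prob_space) expectation_quadratic_covariance:
  fixes Z :: "'a \<Rightarrow> 'k::{real_inner, banach, second_countable_topology}" and B :: "'k \<Rightarrow>\<^sub>L 'k \<Rightarrow>\<^sub>L real"
  assumes Z_meas[measurable]: "Z \<in> borel_measurable M" and Z: "integrable M (\<lambda>\<omega>. (norm (Z \<omega>))\<^sup>2)"
    and E: "finite E" and ZE: "AE \<omega> in M. Z \<omega> = (\<Sum>e\<in>E. (Z \<omega> \<bullet> e) *\<^sub>R e)"
  shows "expectation (\<lambda>\<omega>. B (Z \<omega>) (Z \<omega>)) =
    (\<Sum>e\<in>E. \<Sum>e'\<in>E. (covariance_operator M Z e \<bullet> e') * B e e')"
proof -
  note cov = covariance_operator_inner[OF Z_meas Z]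
  have exp: "B (\<Sum>e\<in>E. (z \<bullet> e) *\<^sub>R e) (\<Sum>e\<in>E. (z \<bullet> e) *\<^sub>R e) = (\<Sum>e\<in>E. \<Sum>e'\<in>E. ((z \<bullet> e) * (z \<bullet> e')) * B e e')" for z
    by (rule blinfun_quadratic_sum)
  note cb = bounded_bilinear.continuous_on[OF bounded_bilinear_blinfun_apply]
  have [measurable]: "(\<lambda>z. B z z) \<in> borel_measurable borel"
    by (intro borel_measurable_continuous_onI cb continuous_on_const continuous_on_id)
  have "expectation (\<lambda>\<omega>. B (Z \<omega>) (Z \<omega>)) = expectation (\<lambda>\<omega>. \<Sum>e\<in>E. \<Sum>e'\<in>E. ((Z \<omega> \<bullet> e) * (Z \<omega> \<bullet> e')) * B e e')"
  proof (rule integral_cong_AE)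
    show "AE \<omega> in M. B (Z \<omega>) (Z \<omega>) = (\<Sum>e\<in>E. \<Sum>e'\<in>E. ((Z \<omega> \<bullet> e) * (Z \<omega> \<bullet> e')) * B e e')"
      using ZE
    proof eventually_elim
      fix \<omega> assume "Z \<omega> = (\<Sum>e\<in>E. (Z \<omega> \<bullet> e) *\<^sub>R e)"
      then show "B (Z \<omega>) (Z \<omega>) = (\<Sum>e\<in>E. \<Sum>e'\<in>E. ((Z \<omega> \<bullet> e) * (Z \<omega> \<bullet> e')) * B e e')"
        using exp[of "Z \<omega>"] by simp
    qed
  qed measurable
  also have "\<dots> = (\<Sum>e\<in>E. \<Sum>e'\<in>E. (covariance_operator M Z e \<bullet> e') * B e e')"
    using cov by (simp add: Bochner_Integration.integral_sum)
  finally show ?thesis .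
qed

lemma orthonormal_expansion:
  fixes E :: "'k::real_inner set"
  assumes "finite E" "pairwise orthogonal E" "\<And>e. e \<in> E \<Longrightarrow> norm e = 1" "z \<in> span E"
  shows "z = (\<Sum>e\<in>E. (z \<bullet> e) *\<^sub>R e)"
proof -
  obtain c where c: "z = (\<Sum>e\<in>E. c e *\<^sub>R e)" using assms(4) span_finite[OF assms(1)] by auto
  have "z \<bullet> e = c e" if e: "e \<in> E" for e
  proof -
    have "z \<bullet> e = (\<Sum>e'\<in>E. c e' * (e' \<bullet> e))" by (simp add: c inner_sum_left)
    also have "\<dots> = (\<Sum>e'\<in>{e}. c e' * (e' \<bullet> e))"
      using assms(1,2) e by (intro sum.mono_neutral_right) (auto simp: pairwise_def orthogonal_def)
    finally show ?thesis using assms(3)[OF e] by (simp add: norm_eq_1)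
  qed
  then show ?thesis by (subst c) simp
qed

text \<open>
  The map \<open>z \<longmapsto> (\<Sum>e\<in>E. (z \<bullet> e) *\<^sub>R e)\<close> is symmetric and fixes \<open>T\<close>. Hence the
  residual of \<open>Z\<close> has variance zero in every direction; a countable dense set of directions gives one null set for all.
\<close>

lemma covariance_determines_support:
  fixes Z :: "'b \<Rightarrow> 'k::{real_inner, banach, second_countable_topology}" and T :: "'a \<Rightarrow> 'k"
  assumes M: "prob_space M" and M': "prob_space M'"
    and T_meas: "T \<in> borel_measurable M" and T2: "integrable M (\<lambda>\<omega>. (norm (T \<omega>))\<^sup>2)"
    and Z_meas: "Z \<in> borel_measurable M'" and Z2: "integrable M' (\<lambda>\<omega>. (norm (Z \<omega>))\<^sup>2)"
    and cov: "covariance_operator M' Z = covariance_operator M T"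
    and TE: "\<And>\<omega>. \<omega> \<in> space M \<Longrightarrow> T \<omega> = (\<Sum>e\<in>E. (T \<omega> \<bullet> e) *\<^sub>R e)"
  shows "AE \<omega> in M'. Z \<omega> = (\<Sum>e\<in>E. (Z \<omega> \<bullet> e) *\<^sub>R e)"
proof -
  interpret M: prob_space M by fact
  interpret M': prob_space M' by fact
  have [measurable]: "Z \<in> borel_measurable M'" by fact
  define p where "p z = (\<Sum>e\<in>E. (z \<bullet> e) *\<^sub>R e)" for z :: 'k
  have psym: "p z \<bullet> w = z \<bullet> p w" for z w
    unfolding p_def by (simp add: inner_sum_left inner_sum_right inner_commute mult.commute)
  have zero: "AE \<omega> in M'. (Z \<omega> - p (Z \<omega>)) \<bullet> u = 0" for u
  proof -
    have "M'.expectation (\<lambda>\<omega>. (Z \<omega> \<bullet> (u - p u)) * (Z \<omega> \<bullet> (u - p u))) =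
        M.expectation (\<lambda>\<omega>. (T \<omega> \<bullet> (u - p u)) * (T \<omega> \<bullet> (u - p u)))"
      using M.covariance_operator_inner(2)[OF T_meas T2] M'.covariance_operator_inner(2)[OF Z_meas Z2] cov
      by simp
    also have "\<dots> = M.expectation (\<lambda>\<omega>. 0)"
    proof (intro Bochner_Integration.integral_cong refl)
      fix \<omega> assume "\<omega> \<in> space M"
      then have "p (T \<omega>) = T \<omega>" using TE by (simp add: p_def)
      then have "T \<omega> \<bullet> (u - p u) = 0" using psym[of "T \<omega>" u] by (simp add: inner_diff_right)
      then show "(T \<omega> \<bullet> (u - p u)) * (T \<omega> \<bullet> (u - p u)) = 0" by simp
    qed
    finally have "AE \<omega> in M'. (Z \<omega> \<bullet> (u - p u)) * (Z \<omega> \<bullet> (u - p u)) = 0"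
      using integral_nonneg_eq_0_iff_AE[OF M'.covariance_operator_inner(1)[OF Z_meas Z2]] by simp
    then show ?thesis
      by eventually_elim (simp add: inner_diff_left inner_diff_right psym)
  qed
  obtain D :: "'k set" where D: "countable D" "\<And>X. open X \<Longrightarrow> X \<noteq> {} \<Longrightarrow> \<exists>d\<in>D. d \<in> X"
    using countable_dense_setE by metis
  have "AE \<omega> in M'. \<forall>u\<in>D. (Z \<omega> - p (Z \<omega>)) \<bullet> u = 0"
    using D(1) zero by (simp add: AE_ball_countable)
  then show ?thesis
  proof eventually_elim
    fix \<omega> assume *: "\<forall>u\<in>D. (Z \<omega> - p (Z \<omega>)) \<bullet> u = 0"
    let ?r = "Z \<omega> - p (Z \<omega>)"
    have "?r = 0"
    proof (rule ccontr)
      assume r: "?r \<noteq> 0"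
      then obtain d where d: "d \<in> D" "d \<in> ball ?r (norm ?r)"
        using D(2)[of "ball ?r (norm ?r)"] by auto
      \<comment> \<open>A direction close to the residual cannot be orthogonal to it.\<close>
      have "(norm d)\<^sup>2 + (norm ?r)\<^sup>2 = (norm (?r - d))\<^sup>2"
        using * d(1) by (simp add: power2_norm_eq_inner inner_diff_left inner_diff_right inner_commute)
      also have "\<dots> < (norm ?r)\<^sup>2"
        using d(2) by (intro power_strict_mono) (auto simp: dist_norm)
      finally show False by (smt (verit) zero_le_power2)
    qed
    then show "Z \<omega> = (\<Sum>e\<in>E. (Z \<omega> \<bullet> e) *\<^sub>R e)" by (simp add: p_def)
  qed
qed


section \<open>The bound for Poisson integrals\<close>

text \<open>
  Uniform continuity makes \<open>\<phi>\<close> nearly constant on small balls; a finite cover by such balls is made disjoint.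
\<close>

lemma fine_partition:
  fixes \<phi> :: "'x::metric_space \<Rightarrow> 'k::real_normed_vector"
  assumes S: "compact S" and \<phi>: "continuous_on S \<phi>" and L: "sets L = sets (restrict_space borel S)" and "\<epsilon> > 0"
  obtains n :: nat and A :: "nat \<Rightarrow> 'x set" and \<xi> where "\<And>i. A i \<in> sets L" "disjoint_family_on A {..<n}"
    "(\<Union>i<n. A i) = S" "\<And>i. i < n \<Longrightarrow> \<xi> i \<in> S" "\<And>i x. i < n \<Longrightarrow> x \<in> A i \<Longrightarrow> norm (\<phi> x - \<phi> (\<xi> i)) \<le> \<epsilon>"
proof -
  obtain d where d: "d > 0" "\<And>x y. x \<in> S \<Longrightarrow> y \<in> S \<Longrightarrow> dist y x < d \<Longrightarrow> dist (\<phi> y) (\<phi> x) < \<epsilon>"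
    using compact_uniformly_continuous[OF \<phi> S] \<open>\<epsilon> > 0\<close> unfolding uniformly_continuous_on_def by metis
  have "S \<subseteq> (\<Union>x\<in>S. ball x d)" using d(1) by auto
  then obtain K where K: "K \<subseteq> S" "finite K" "S \<subseteq> (\<Union>x\<in>K. ball x d)"
    by (rule compactE_image[OF S, rotated]) auto
  obtain n :: nat and \<xi> where \<xi>: "K = \<xi> ` {..<n}"
    using finite_imp_nat_seg_image_inj_on[OF K(2)] by (metis lessThan_def)
  define A where "A i = (ball (\<xi> i) d - (\<Union>j<i. ball (\<xi> j) d)) \<inter> S" for i
  have "A i \<in> sets L" for i
    unfolding L A_def sets_restrict_space by (auto intro!: imageI simp: Int_commute)
  moreover have "disjoint_family_on A {..<n}"
    unfolding disjoint_family_on_def A_def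
  proof (intro ballI impI)
    fix i j :: nat assume "i \<noteq> j"
    then consider "i < j" | "j < i" by linarith
    then show "(ball (\<xi> i) d - (\<Union>k<i. ball (\<xi> k) d)) \<inter> S \<inter> ((ball (\<xi> j) d - (\<Union>k<j. ball (\<xi> k) d)) \<inter> S) = {}"
      by cases blast+
  qed
  moreover have "(\<Union>i<n. A i) = S"
  proof
    show "S \<subseteq> (\<Union>i<n. A i)"
    proof
      fix x assume x: "x \<in> S"
      define P where "P i \<longleftrightarrow> i < n \<and> x \<in> ball (\<xi> i) d" for i
      obtain i where "i < n" "x \<in> ball (\<xi> i) d" using K(3) x unfolding \<xi> by blast
      then have "P i" by (simp add: P_def)
      define k where "k = (LEAST i. P i)"
      have k: "k < n" "x \<in> ball (\<xi> k) d"
        using LeastI[of P, OF \<open>P i\<close>] by (auto simp: P_def k_def)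
      have "x \<notin> ball (\<xi> j) d" if "j < k" for j
        using not_less_Least[of j P] that k(1) by (auto simp: P_def k_def)
      then have "x \<in> A k" using k(2) x by (auto simp: A_def)
      with k(1) have "k < n" "x \<in> A k" by auto
      then show "x \<in> (\<Union>i<n. A i)" by blast
    qed
  qed (auto simp: A_def)
  moreover have \<xi>S: "\<xi> i \<in> S" if "i < n" for i using K(1) that unfolding \<xi> by auto
  moreover have "norm (\<phi> x - \<phi> (\<xi> i)) \<le> \<epsilon>" if "i < n" "x \<in> A i" for i x
    using d(2)[of "\<xi> i" x] \<xi>S[OF that(1)] that(2) by (auto simp: A_def dist_norm dist_commute)
  ultimately show ?thesis by (rule that)
qed

lemma integral_partition_approx:
  fixes \<phi> :: "'x::metric_space \<Rightarrow> 'k::{real_normed_vector, banach, second_countable_topology}" and n :: nat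
  assumes Q: "finite_measure Q" and sQ: "sets Q = sets (restrict_space borel S)" and S: "compact S" and \<phi>: "continuous_on S \<phi>"
    and A: "\<And>i. A i \<in> sets Q" "disjoint_family_on A {..<n}" "(\<Union>i<n. A i) = S"
    and \<epsilon>: "\<And>i x. i < n \<Longrightarrow> x \<in> A i \<Longrightarrow> norm (\<phi> x - \<phi> (\<xi> i)) \<le> \<epsilon>"
  shows "norm ((\<integral>x. \<phi> x \<partial>Q) - (\<Sum>i<n. measure Q (A i) *\<^sub>R \<phi> (\<xi> i))) \<le> \<epsilon> * measure Q S"
proof -
  interpret Q: finite_measure Q by fact
  have sp: "space Q = S" using sets_eq_imp_space_eq[OF sQ] by (simp add: space_restrict_space)
  have m: "\<phi> \<in> borel_measurable Q"
    using borel_measurable_continuous_on_restrict[OF \<phi>] by (simp add: measurable_cong_sets[OF sQ refl])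
  have "compact (\<phi> ` S)" using \<phi> S by (rule compact_continuous_image)
  then obtain b where b: "\<And>x. x \<in> S \<Longrightarrow> norm (\<phi> x) \<le> b"
    by (meson bounded_iff compact_imp_bounded imageI)
  have i1: "integrable Q \<phi>"
    by (rule Q.integrable_const_bound[OF _ m, of b]) (auto simp: sp b)
  have i2: "integrable Q (\<lambda>x. indicator (A i) x *\<^sub>R c)" for i and c :: 'k
    by (intro integrable_scaleR_left integrable_real_indicator A) (simp add: Q.emeasure_eq_measure)
  let ?s = "\<lambda>x. \<Sum>i<n. indicator (A i) x *\<^sub>R \<phi> (\<xi> i)"
  have i3: "integrable Q ?s" by (intro Bochner_Integration.integrable_sum i2)
  have "(\<integral>x. ?s x \<partial>Q) = (\<Sum>i<n. measure Q (A i) *\<^sub>R \<phi> (\<xi> i))"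
    using A(1) i2 sets.sets_into_space[OF A(1)]
    by (subst Bochner_Integration.integral_sum) (auto simp: Q.emeasure_eq_measure Int_absorb2)
  then have "(\<integral>x. \<phi> x \<partial>Q) - (\<Sum>i<n. measure Q (A i) *\<^sub>R \<phi> (\<xi> i)) = (\<integral>x. \<phi> x - ?s x \<partial>Q)"
    using i1 i3 by simp
  also have "norm \<dots> \<le> (\<integral>x. norm (\<phi> x - ?s x) \<partial>Q)" by (rule integral_norm_bound)
  also have "\<dots> \<le> (\<integral>x. \<epsilon> \<partial>Q)"
  proof (rule integral_mono)
    fix x assume "x \<in> space Q"
    then have "x \<in> (\<Union>i<n. A i)" using A(3) sp by auto
    then obtain i where i: "i < n" "x \<in> A i" by auto
    have "x \<notin> A j" if "j < n" "j \<noteq> i" for j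
      using A(2) i that by (auto simp: disjoint_family_on_def)
    then have "?s x = (\<Sum>j\<in>{i}. indicator (A j) x *\<^sub>R \<phi> (\<xi> j))"
      using i by (intro sum.mono_neutral_right) (auto simp: indicator_def)
    then show "norm (\<phi> x - ?s x) \<le> \<epsilon>" using i \<epsilon> by simp
  qed (intro integrable_norm Bochner_Integration.integrable_diff i1 i3, simp)
  also have "\<dots> = \<epsilon> * measure Q S" by (simp add: sp mult.commute)
  finally show ?thesis .
qed

text \<open>
  On a partition into cells where \<open>\<phi>\<close> varies by at most \<open>\<epsilon>\<close>, the compensated sum \<open>X\<close> of the counts
  differs from \<open>T\<close> by at most \<open>\<epsilon>\<close> times \<open>N0\<close>, the number of points plus its mean. As \<open>N0\<close> has a second moment, the
  expectations of \<open>h\<close> and the covariances of \<open>X\<close> and \<open>T\<close> agree up to a quantity that vanishes with \<open>\<epsilon>\<close>. The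
  interpolation bound for \<open>X\<close> and \<open>Z\<close> therefore passes to the limit, where the covariances of \<open>T\<close> and \<open>Z\<close> are equal.
\<close>

lemma poisson_gaussian_bound:
  fixes M :: "'a measure" and M' :: "'b measure" and L :: "'x::metric_space measure"
    and N :: "'a \<Rightarrow> 'x measure" and \<phi> :: "'x \<Rightarrow> 'k::{real_inner, banach, second_countable_topology}"
    and Z :: "'b \<Rightarrow> 'k" and h :: "'k \<Rightarrow> real"
    and D1 :: "'k \<Rightarrow> 'k \<Rightarrow>\<^sub>L real" and D2 :: "'k \<Rightarrow> 'k \<Rightarrow>\<^sub>L 'k \<Rightarrow>\<^sub>L real"
    and D3 :: "'k \<Rightarrow> 'k \<Rightarrow>\<^sub>L 'k \<Rightarrow>\<^sub>L 'k \<Rightarrow>\<^sub>L real"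
  assumes M: "prob_space M" and M': "prob_space M'"
    and N: "poisson_random_measure M L N" and S: "compact S" and L: "sets L = sets (restrict_space borel S)"
    and \<phi>: "continuous_on S \<phi>" and c: "\<And>x. x \<in> S \<Longrightarrow> norm (\<phi> x) \<le> c" "c \<ge> 0" and mean: "(\<integral>x. \<phi> x \<partial>L) = 0"
    and E: "finite E" and \<phi>E: "\<And>x. x \<in> S \<Longrightarrow> \<phi> x \<in> span E"
    and T: "\<And>\<omega>. \<omega> \<in> space M \<Longrightarrow> T \<omega> = (\<integral>x. \<phi> x \<partial>N \<omega>)"
    and Z: "centred_gaussian M' Z" and Z2: "integrable M' (\<lambda>\<omega>. (norm (Z \<omega>))\<^sup>2)"
    and cov: "covariance_operator M' Z = covariance_operator M T"
    and D1: "\<And>x. (h has_derivative D1 x) (at x)" and D2: "\<And>x. (D1 has_derivative D2 x) (at x)"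
    and D3: "\<And>x. (D2 has_derivative D3 x) (at x)"
    and b1: "\<And>x u. \<bar>D1 x u\<bar> \<le> norm u" and b2: "\<And>x u. \<bar>D2 x u u\<bar> \<le> norm u ^ 2"
    and b3: "\<And>x u. \<bar>D3 x u u u\<bar> \<le> norm u ^ 3"
  shows "\<bar>(\<integral>\<omega>. h (T \<omega>) \<partial>M) - (\<integral>\<omega>. h (Z \<omega>) \<partial>M')\<bar> \<le> pi / 8 * (measure L S * c ^ 3)"
proof -
  interpret M: prob_space M by fact
  interpret M': prob_space M' by fact
  have fL: "finite_measure L" and sN: "\<And>\<omega>. \<omega> \<in> space M \<Longrightarrow> sets (N \<omega>) = sets L"
    and fN: "\<And>\<omega>. \<omega> \<in> space M \<Longrightarrow> finite_measure (N \<omega>)"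
    and mN: "\<And>A. A \<in> sets L \<Longrightarrow> (\<lambda>\<omega>. measure (N \<omega>) A) \<in> borel_measurable M"
    and pN: "\<And>A n. A \<in> sets L \<Longrightarrow> measure M {\<omega> \<in> space M. measure (N \<omega>) A = real n} =
          exp (- measure L A) * measure L A ^ n / fact n"
    and iN: "\<And>(n::nat) A. A ` {..<n} \<subseteq> sets L \<Longrightarrow> disjoint_family_on A {..<n} \<Longrightarrow>
        M.indep_vars (\<lambda>_. borel) (\<lambda>i \<omega>. measure (N \<omega>) (A i)) {..<n}"
    using N unfolding poisson_random_measure_def by blast+
  define \<Lambda> where "\<Lambda> = measure L S"
  have \<Lambda>0: "\<Lambda> \<ge> 0" by (simp add: \<Lambda>_def)
  have SL: "S \<in> sets L" using S unfolding L by (auto simp: sets_restrict_space_iff compact_imp_closed)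
  define N0 where "N0 \<omega> = measure (N \<omega>) S + \<Lambda>" for \<omega>
  have N0_meas[measurable]: "N0 \<in> borel_measurable M" unfolding N0_def using mN[OF SL] by measurable
  have N0_nonneg: "N0 \<omega> \<ge> 0" for \<omega> using \<Lambda>0 by (simp add: N0_def)
  note momS = M.poisson_moments[OF mN[OF SL] pN[OF SL] measure_nonneg]
  have N0_int: "integrable M N0" unfolding N0_def using momS(1) by simp
  have N0_int2: "integrable M (\<lambda>\<omega>. (N0 \<omega>)\<^sup>2)"
    unfolding N0_def power2_sum using momS(1,3) by simp
  define K where "K = M.expectation (\<lambda>\<omega>. (N0 \<omega>)\<^sup>2)"
  \<comment> \<open>Since \<open>\<phi>\<close> has mean zero, its integral against \<open>L\<close> may be subtracted from \<open>T\<close> to compensate the counts.\<close>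
  have approx: "\<exists>n A \<xi>. (\<forall>i. A i \<in> sets L) \<and> disjoint_family_on A {..<n::nat} \<and> (\<forall>i<n. \<xi> i \<in> S) \<and>
      (\<forall>\<omega>\<in>space M. norm (T \<omega> - (\<Sum>i<n. (measure (N \<omega>) (A i) - measure L (A i)) *\<^sub>R \<phi> (\<xi> i))) \<le> \<epsilon> * N0 \<omega>)
      \<and> (\<Sum>i<n. measure L (A i)) = \<Lambda>"
    if \<epsilon>: "\<epsilon> > 0" for \<epsilon>
  proof -
    obtain n :: nat and A \<xi> where A: "\<And>i. A i \<in> sets L" "disjoint_family_on A {..<n}"
      "(\<Union>i<n. A i) = S" "\<And>i. i < n \<Longrightarrow> \<xi> i \<in> S" "\<And>i x. i < n \<Longrightarrow> x \<in> A i \<Longrightarrow> norm (\<phi> x - \<phi> (\<xi> i)) \<le> \<epsilon>"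
      using fine_partition[OF S \<phi> L \<epsilon>] by metis
    have "norm (T \<omega> - (\<Sum>i<n. (measure (N \<omega>) (A i) - measure L (A i)) *\<^sub>R \<phi> (\<xi> i))) \<le> \<epsilon> * N0 \<omega>"
      if \<omega>: "\<omega> \<in> space M" for \<omega>
    proof -
      have A': "A i \<in> sets (N \<omega>)" for i using A(1) sN[OF \<omega>] by simp
      have sN': "sets (N \<omega>) = sets (restrict_space borel S)" using sN[OF \<omega>] L by simp
      let ?a = "(\<integral>x. \<phi> x \<partial>N \<omega>) - (\<Sum>i<n. measure (N \<omega>) (A i) *\<^sub>R \<phi> (\<xi> i))"
      let ?b = "(\<integral>x. \<phi> x \<partial>L) - (\<Sum>i<n. measure L (A i) *\<^sub>R \<phi> (\<xi> i))"
      have 1: "norm ?a \<le> \<epsilon> * measure (N \<omega>) S"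
        by (rule integral_partition_approx[OF fN[OF \<omega>] sN' S \<phi> A' A(2,3,5)])
      have 2: "norm ?b \<le> \<epsilon> * \<Lambda>"
        unfolding \<Lambda>_def by (rule integral_partition_approx[OF fL L S \<phi> A(1,2,3,5)])
      have "T \<omega> - (\<Sum>i<n. (measure (N \<omega>) (A i) - measure L (A i)) *\<^sub>R \<phi> (\<xi> i)) = ?a - ?b"
        using mean T[OF \<omega>] by (simp add: scaleR_diff_left sum_subtractf)
      also have "norm (?a - ?b) \<le> norm ?a + norm ?b" by (rule norm_triangle_ineq4)
      also have "\<dots> \<le> \<epsilon> * N0 \<omega>" using 1 2 unfolding N0_def distrib_left by (rule add_mono)
      finally show ?thesis .
    qed
    moreover have "(\<Sum>i<n. measure L (A i)) = \<Lambda>"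
      unfolding \<Lambda>_def A(3)[symmetric]
      by (rule finite_measure.finite_measure_finite_Union[OF fL, symmetric]) (use A(1,2) in auto)
    ultimately show ?thesis using A(1,2,4) by blast
  qed
  have meas_sum: "(\<lambda>\<omega>. \<Sum>i<n. (measure (N \<omega>) (A i) - measure L (A i)) *\<^sub>R \<phi> (\<xi> i)) \<in> borel_measurable M"
    if "\<forall>i. A i \<in> sets L" for A \<xi> and n :: nat
    using that by (intro borel_measurable_sum borel_measurable_scaleR borel_measurable_diff mN borel_measurable_const) auto
  \<comment> \<open>\<open>T\<close> is the pointwise limit of the discretised sums.\<close>
  have T_meas[measurable]: "T \<in> borel_measurable M"
  proof -
    have "\<exists>X. X \<in> borel_measurable M \<and> (\<forall>\<omega>\<in>space M. norm (T \<omega> - X \<omega>) \<le> inverse (real (Suc k)) * N0 \<omega>)" for k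
    proof -
      have pos: "0 < inverse (real (Suc k))" by simp
      obtain n :: nat and A \<xi> where "\<forall>i. A i \<in> sets L"
        and "\<forall>\<omega>\<in>space M. norm (T \<omega> - (\<Sum>i<n. (measure (N \<omega>) (A i) - measure L (A i)) *\<^sub>R \<phi> (\<xi> i))) \<le> inverse (real (Suc k)) * N0 \<omega>"
        using approx[OF pos] by (elim exE conjE) (rule that; assumption)
      then show ?thesis
        using meas_sum[of A \<xi> n]
        by (intro exI[of _ "\<lambda>\<omega>. \<Sum>i<n. (measure (N \<omega>) (A i) - measure L (A i)) *\<^sub>R \<phi> (\<xi> i)"]) simp
    qed
    then obtain X where X: "\<And>k. X k \<in> borel_measurable M"
      and le: "\<And>k \<omega>. \<omega> \<in> space M \<Longrightarrow> norm (T \<omega> - X k \<omega>) \<le> inverse (real (Suc k)) * N0 \<omega>"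
      by metis
    show ?thesis
    proof (rule borel_measurable_LIMSEQ_metric[OF X])
      fix \<omega> assume \<omega>: "\<omega> \<in> space M"
      have "(\<lambda>k. inverse (real (Suc k)) * N0 \<omega>) \<longlonglongrightarrow> 0"
        using tendsto_mult_right[OF LIMSEQ_inverse_real_of_nat, of "N0 \<omega>"] by simp
      moreover have "norm (X k \<omega> - T \<omega>) \<le> inverse (real (Suc k)) * N0 \<omega>" for k
        using le[OF \<omega>, of k] by (simp only: norm_minus_commute)
      ultimately have "(\<lambda>k. X k \<omega> - T \<omega>) \<longlonglongrightarrow> 0"
        by (rule Lim_null_comparison[OF always_eventually[OF allI], rotated])
      then show "(\<lambda>k. X k \<omega>) \<longlonglongrightarrow> T \<omega>" by (simp add: LIM_zero_iff)
    qed
  qed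
  have T_bound: "norm (T \<omega>) \<le> c * N0 \<omega>" if \<omega>: "\<omega> \<in> space M" for \<omega>
  proof -
    interpret Q: finite_measure "N \<omega>" by (rule fN[OF \<omega>])
    have sp: "space (N \<omega>) = S"
      using sets_eq_imp_space_eq[of "N \<omega>" "restrict_space borel S"] sN[OF \<omega>] L by (simp add: space_restrict_space)
    have "norm (T \<omega>) \<le> (\<integral>x. norm (\<phi> x) \<partial>N \<omega>)" unfolding T[OF \<omega>] by (rule integral_norm_bound)
    also have "\<dots> \<le> (\<integral>x. c \<partial>N \<omega>)"
    proof (rule integral_mono)
      have "\<phi> \<in> borel_measurable (N \<omega>)"
        using borel_measurable_continuous_on_restrict[OF \<phi>] sN[OF \<omega>] L
        by (simp add: measurable_cong_sets[of "N \<omega>" "restrict_space borel S"])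
      then show "integrable (N \<omega>) (\<lambda>x. norm (\<phi> x))"
        by (intro integrable_norm Q.integrable_const_bound[of _ c]) (auto simp: sp c)
    qed (auto simp: sp c)
    also have "\<dots> \<le> c * N0 \<omega>"
      using c(2) \<Lambda>0 by (simp add: sp N0_def distrib_left mult.commute)
    finally show ?thesis .
  qed
  have T2: "integrable M (\<lambda>\<omega>. (norm (T \<omega>))\<^sup>2)"
  proof (rule Bochner_Integration.integrable_bound)
    show "integrable M (\<lambda>\<omega>. c\<^sup>2 * (N0 \<omega>)\<^sup>2)" using N0_int2 by simp
    show "AE \<omega> in M. norm ((norm (T \<omega>))\<^sup>2) \<le> norm (c\<^sup>2 * (N0 \<omega>)\<^sup>2)"
      using T_bound by (intro AE_I2) (auto simp: power_mult_distrib[symmetric] intro!: power_mono)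
  qed measurable
  \<comment> \<open>An orthonormal set that spans the range of \<open>\<phi>\<close>.\<close>
  obtain E' where E': "finite E'" "pairwise orthogonal E'" "\<And>e. e \<in> E' \<Longrightarrow> norm e = 1" "span E \<subseteq> span E'"
  proof -
    obtain C where C: "finite C" "span C = span E" "pairwise orthogonal C"
      using basis_orthogonal[OF E] by metis
    let ?E = "(\<lambda>x. x /\<^sub>R norm x) ` (C - {0})"
    have "x \<in> span ?E" if "x \<in> C" for x
    proof (cases "x = 0")
      case False
      then have "norm x *\<^sub>R (x /\<^sub>R norm x) \<in> span ?E"
        using that by (intro span_scale span_base) auto
      then show ?thesis using False by simp
    qed (simp add: span_zero)
    then have "span E \<subseteq> span ?E"
      unfolding C(2)[symmetric] by (intro span_minimal subspace_span) auto
    moreover have "pairwise orthogonal ?E"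
      using C(3) unfolding pairwise_def orthogonal_def by fastforce
    moreover have "norm e = 1" if "e \<in> ?E" for e
      using that by (auto simp: norm_sgn split: if_splits simp flip: sgn_div_norm)
    moreover have "finite ?E" using C(1) by simp
    ultimately show ?thesis using that[of ?E] by (simp only: simp_thms)
  qed
  have TE: "T \<omega> = (\<Sum>e\<in>E'. (T \<omega> \<bullet> e) *\<^sub>R e)" if \<omega>: "\<omega> \<in> space M" for \<omega>
  proof -
    interpret Q: finite_measure "N \<omega>" by (rule fN[OF \<omega>])
    have sp: "space (N \<omega>) = S"
      using sets_eq_imp_space_eq[of "N \<omega>" "restrict_space borel S"] sN[OF \<omega>] L by (simp add: space_restrict_space)
    have "\<phi> \<in> borel_measurable (N \<omega>)"
      using borel_measurable_continuous_on_restrict[OF \<phi>] sN[OF \<omega>] L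
      by (simp add: measurable_cong_sets[of "N \<omega>" "restrict_space borel S"])
    then have i: "integrable (N \<omega>) \<phi>"
      by (intro Q.integrable_const_bound[of _ c]) (auto simp: sp c)
    have "bounded_linear (\<lambda>z :: 'k. \<Sum>e\<in>E'. (z \<bullet> e) *\<^sub>R e)"
      by (intro bounded_linear_sum bounded_linear_scaleR_const bounded_linear_inner_left)
    from integral_bounded_linear[OF this i]
    have "(\<Sum>e\<in>E'. (T \<omega> \<bullet> e) *\<^sub>R e) = (\<integral>x. (\<Sum>e\<in>E'. (\<phi> x \<bullet> e) *\<^sub>R e) \<partial>N \<omega>)"
      by (simp add: T[OF \<omega>])
    also have "\<dots> = (\<integral>x. \<phi> x \<partial>N \<omega>)"
    proof (intro Bochner_Integration.integral_cong refl)
      fix x assume "x \<in> space (N \<omega>)"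
      then have "\<phi> x \<in> span E'" using \<phi>E E'(4) by (auto simp: sp)
      from orthonormal_expansion[OF E'(1,2,3) this]
      show "(\<Sum>e\<in>E'. (\<phi> x \<bullet> e) *\<^sub>R e) = \<phi> x" by simp
    qed
    finally show ?thesis by (simp add: T[OF \<omega>])
  qed
  have Z_meas[measurable]: "Z \<in> borel_measurable M'" using Z by (simp add: centred_gaussian_def)
  have ZE: "AE \<omega> in M'. Z \<omega> = (\<Sum>e\<in>E'. (Z \<omega> \<bullet> e) *\<^sub>R e)"
    by (rule covariance_determines_support[OF M M' T_meas T2 Z_meas Z2 cov TE])
  have quad: "M'.expectation (\<lambda>\<omega>. B (Z \<omega>) (Z \<omega>)) = M.expectation (\<lambda>\<omega>. B (T \<omega>) (T \<omega>))"
    for B :: "'k \<Rightarrow>\<^sub>L 'k \<Rightarrow>\<^sub>L real"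
    using M'.expectation_quadratic_covariance[OF Z_meas Z2 E'(1) ZE, of B]
      M.expectation_quadratic_covariance[OF T_meas T2 E'(1) AE_I2[OF TE], of B] cov by simp
  obtain W :: "'k set" and v :: "'k \<Rightarrow> 'k" where W: "finite W"
    "M'.indep_vars (\<lambda>_. borel) (\<lambda>w \<omega>. Z \<omega> \<bullet> w) W" "AE \<omega> in M'. Z \<omega> = (\<Sum>w\<in>W. (Z \<omega> \<bullet> w) *\<^sub>R v w)"
    "\<And>w w'. w \<in> W \<Longrightarrow> w' \<in> W \<Longrightarrow> w \<noteq> w' \<Longrightarrow> M'.expectation (\<lambda>\<omega>. (Z \<omega> \<bullet> w) * (Z \<omega> \<bullet> w')) = 0"
    by (rule M'.centred_gaussian_decomposition[OF Z E'(1) ZE]) (rule that)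
  have "\<exists>\<sigma>. distr M' borel (\<lambda>\<omega>. Z \<omega> \<bullet> w) = distr std_normal_distribution borel (\<lambda>x. \<sigma> * x) \<and>
    integrable M' (\<lambda>\<omega>. Z \<omega> \<bullet> w) \<and> M'.expectation (\<lambda>\<omega>. (Z \<omega> \<bullet> w)\<^sup>2) = \<sigma>\<^sup>2" for w
    by (rule M'.centred_gaussian_char[OF Z, of w]) blast
  then obtain \<sigma> where \<sigma>: "\<And>w. distr M' borel (\<lambda>\<omega>. Z \<omega> \<bullet> w) = distr std_normal_distribution borel (\<lambda>x. \<sigma> w * x)"
    "\<And>w. integrable M' (\<lambda>\<omega>. Z \<omega> \<bullet> w)" "\<And>w. M'.expectation (\<lambda>\<omega>. (Z \<omega> \<bullet> w)\<^sup>2) = (\<sigma> w)\<^sup>2"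
    by metis
  define Z' where "Z' \<omega> = (\<Sum>w\<in>W. (Z \<omega> \<bullet> w) *\<^sub>R v w)" for \<omega>
  have Z'_meas[measurable]: "Z' \<in> borel_measurable M'" unfolding Z'_def by measurable
  have ZZ': "AE \<omega> in M'. Z \<omega> = Z' \<omega>" using W(3) by (simp add: Z'_def)
  note cb = bounded_bilinear.continuous_on[OF bounded_bilinear_blinfun_apply]
  have Bm: "(\<lambda>z. B z z) \<in> borel_measurable borel" for B :: "'k \<Rightarrow>\<^sub>L 'k \<Rightarrow>\<^sub>L real"
    by (intro borel_measurable_continuous_onI cb continuous_on_const continuous_on_id)
  \<comment> \<open>The contracted covariance of the independent representation of \<open>Z\<close> is that of \<open>T\<close>.\<close>
  have quadZ: "(\<Sum>w\<in>W. (\<sigma> w)\<^sup>2 * B (v w) (v w)) = M.expectation (\<lambda>\<omega>. B (T \<omega>) (T \<omega>))"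
    for B :: "'k \<Rightarrow>\<^sub>L 'k \<Rightarrow>\<^sub>L real"
  proof -
    have "M'.expectation (\<lambda>\<omega>. B (Z \<omega>) (Z \<omega>)) = M'.expectation (\<lambda>\<omega>. B (Z' \<omega>) (Z' \<omega>))"
      using ZZ' measurable_compose[OF Z_meas Bm] measurable_compose[OF Z'_meas Bm] by (intro integral_cong_AE) auto
    also have "\<dots> = (\<Sum>w\<in>W. (\<sigma> w)\<^sup>2 * B (v w) (v w))"
      unfolding Z'_def \<sigma>(3)[symmetric]
      by (rule M'.expectation_quadratic_uncorrelated[OF W(1) M'.covariance_operator_inner(1)[OF Z_meas Z2] W(4)])
    finally show ?thesis using quad by simp
  qed
  have ch: "continuous_on UNIV h"
    using D1 by (meson has_derivative_continuous continuous_at_imp_continuous_on)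
  have [measurable]: "h \<in> borel_measurable borel"
    by (intro borel_measurable_continuous_onI ch)
  note lip = lipschitz_if_derivative_le_norm[OF D1 b1]
  have hint: "integrable M (\<lambda>\<omega>. h (Y \<omega>))"
    if [measurable]: "Y \<in> borel_measurable M" and Y: "\<And>\<omega>. \<omega> \<in> space M \<Longrightarrow> norm (Y \<omega>) \<le> C * N0 \<omega>" for Y C
  proof (rule Bochner_Integration.integrable_bound)
    show "integrable M (\<lambda>\<omega>. \<bar>h 0\<bar> + C * N0 \<omega>)" using N0_int by simp
    show "AE \<omega> in M. norm (h (Y \<omega>)) \<le> norm (\<bar>h 0\<bar> + C * N0 \<omega>)"
    proof (rule AE_I2)
      fix \<omega> assume "\<omega> \<in> space M"
      then have "norm (Y \<omega>) \<le> C * N0 \<omega>" by (rule Y)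
      moreover have "\<bar>h (Y \<omega>) - h 0\<bar> \<le> norm (Y \<omega>)" using lip[of "Y \<omega>" 0] by simp
      ultimately show "norm (h (Y \<omega>)) \<le> norm (\<bar>h 0\<bar> + C * N0 \<omega>)"
        unfolding real_norm_def by linarith
    qed
  qed measurable
  have main: "\<bar>(\<integral>\<omega>. h (T \<omega>) \<partial>M) - (\<integral>\<omega>. h (Z \<omega>) \<partial>M')\<bar> \<le>
      \<epsilon> * M.expectation N0 + pi / 2 * ((2 * (c + \<epsilon>) * \<epsilon> + \<epsilon>\<^sup>2) * K / 2 + \<Lambda> * c ^ 3 / 4)" if \<epsilon>: "\<epsilon> > 0" for \<epsilon>
  proof -
    obtain n A \<xi> where A: "\<forall>i. A i \<in> sets L" "disjoint_family_on A {..<n::nat}" and \<xi>: "\<forall>i<n. \<xi> i \<in> S"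
      and TX: "\<forall>\<omega>\<in>space M. norm (T \<omega> - (\<Sum>i<n. (measure (N \<omega>) (A i) - measure L (A i)) *\<^sub>R \<phi> (\<xi> i))) \<le> \<epsilon> * N0 \<omega>"
      and sum: "(\<Sum>i<n. measure L (A i)) = \<Lambda>"
      using approx[OF \<epsilon>] by (elim exE conjE)
    define X where "X \<omega> = (\<Sum>i<n. (measure (N \<omega>) (A i) - measure L (A i)) *\<^sub>R \<phi> (\<xi> i))" for \<omega>
    have TX: "norm (T \<omega> - X \<omega>) \<le> \<epsilon> * N0 \<omega>" if "\<omega> \<in> space M" for \<omega> using TX that by (simp add: X_def)
    have X_meas[measurable]: "X \<in> borel_measurable M" unfolding X_def[abs_def] by (rule meas_sum[OF A(1)])
    have indN: "M.indep_vars (\<lambda>_. borel) (\<lambda>i \<omega>. measure (N \<omega>) (A i)) {..<n}"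
      using A by (intro iN) auto
    have AL: "A i \<in> sets L" for i using A(1) by blast
    note mom = M.poisson_moments[OF mN[OF AL] pN[OF AL] measure_nonneg]
    have Xb: "norm (X \<omega>) \<le> (c + \<epsilon>) * N0 \<omega>" if \<omega>: "\<omega> \<in> space M" for \<omega>
      using norm_triangle_ineq4[of "T \<omega>" "T \<omega> - X \<omega>"] T_bound[OF \<omega>] TX[OF \<omega>]
      by (simp add: distrib_right)
    have quadX: "(\<Sum>i<n. measure L (A i) * B (\<phi> (\<xi> i)) (\<phi> (\<xi> i))) = M.expectation (\<lambda>\<omega>. B (X \<omega>) (X \<omega>))"
      for B :: "'k \<Rightarrow>\<^sub>L 'k \<Rightarrow>\<^sub>L real"
    proof -
      let ?\<eta> = "\<lambda>i \<omega>. measure (N \<omega>) (A i) - measure L (A i)"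
      have ind: "M.indep_vars (\<lambda>_. borel) ?\<eta> {..<n}"
        using M.indep_vars_compose2[OF indN, of "\<lambda>i x. x - measure L (A i)" "\<lambda>_. borel"] by simp
      have i1: "integrable M (?\<eta> i)" "M.expectation (?\<eta> i) = 0" "integrable M (\<lambda>\<omega>. (?\<eta> i \<omega>)\<^sup>2)" for i
        using mom(1,2,3)[of i] by (simp_all add: M.prob_space power2_diff)
      have ij: "integrable M (\<lambda>\<omega>. ?\<eta> i \<omega> * ?\<eta> j \<omega>) \<and> M.expectation (\<lambda>\<omega>. ?\<eta> i \<omega> * ?\<eta> j \<omega>) = 0"
        if "i < n" "j < n" "i \<noteq> j" for i j
      proof -
        have "M.indep_vars (\<lambda>_. borel) ?\<eta> {i, j}" using that by (intro M.indep_vars_subset[OF ind]) auto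
        from M.indep_vars_integrable[OF _ this i1(1)] M.indep_vars_lebesgue_integral[OF _ this i1(1)] that
        show ?thesis by (simp add: i1(2))
      qed
      have ii: "integrable M (\<lambda>\<omega>. ?\<eta> i \<omega> * ?\<eta> i \<omega>)" for i
        using i1(3)[of i] by (simp add: power2_eq_square)
      have "M.expectation (\<lambda>\<omega>. B (X \<omega>) (X \<omega>)) =
        (\<Sum>i<n. M.expectation (\<lambda>\<omega>. (?\<eta> i \<omega>)\<^sup>2) * B (\<phi> (\<xi> i)) (\<phi> (\<xi> i)))"
        unfolding X_def
      proof (rule M.expectation_quadratic_uncorrelated)
        fix i j assume "i \<in> {..<n}" "j \<in> {..<n}"
        then show "integrable M (\<lambda>\<omega>. ?\<eta> i \<omega> * ?\<eta> j \<omega>)" using ij[of i j] ii[of i] by (cases "i = j") auto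
      qed (use ij in auto)
      then show ?thesis by (simp add: mom(4))
    qed
    have cov_bound: "\<bar>(\<Sum>w\<in>W. (\<sigma> w)\<^sup>2 * D2 x (v w) (v w)) - (\<Sum>i<n. measure L (A i) * D2 x (\<phi> (\<xi> i)) (\<phi> (\<xi> i)))\<bar>
        \<le> (2 * (c + \<epsilon>) * \<epsilon> + \<epsilon>\<^sup>2) * K" for x
    proof -
      let ?B = "D2 x"
      have iB: "integrable M (\<lambda>\<omega>. ?B (Y \<omega>) (Y \<omega>))"
        if [measurable]: "Y \<in> borel_measurable M" and Y: "\<And>\<omega>. \<omega> \<in> space M \<Longrightarrow> norm (Y \<omega>) \<le> C * N0 \<omega>" for Y C
      proof (rule Bochner_Integration.integrable_bound)
        show "integrable M (\<lambda>\<omega>. C\<^sup>2 * (N0 \<omega>)\<^sup>2)" using N0_int2 by simp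
        show "AE \<omega> in M. norm (?B (Y \<omega>) (Y \<omega>)) \<le> norm (C\<^sup>2 * (N0 \<omega>)\<^sup>2)"
        proof (rule AE_I2)
          fix \<omega> assume "\<omega> \<in> space M"
          then have "norm (Y \<omega>) ^ 2 \<le> C\<^sup>2 * (N0 \<omega>)\<^sup>2"
            using Y unfolding power_mult_distrib[symmetric] by (intro power_mono) auto
          then show "norm (?B (Y \<omega>) (Y \<omega>)) \<le> norm (C\<^sup>2 * (N0 \<omega>)\<^sup>2)"
            using b2[of x "Y \<omega>"] by simp
        qed
        show "(\<lambda>\<omega>. ?B (Y \<omega>) (Y \<omega>)) \<in> borel_measurable M" by (rule measurable_compose[OF _ Bm]) measurable
      qed
      have "\<bar>M.expectation (\<lambda>\<omega>. ?B (T \<omega>) (T \<omega>)) - M.expectation (\<lambda>\<omega>. ?B (X \<omega>) (X \<omega>))\<bar> =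
        \<bar>M.expectation (\<lambda>\<omega>. ?B (T \<omega>) (T \<omega>) - ?B (X \<omega>) (X \<omega>))\<bar>"
        using iB[OF T_meas T_bound] iB[OF X_meas Xb] by simp
      also have "\<dots> \<le> M.expectation (\<lambda>\<omega>. \<bar>?B (T \<omega>) (T \<omega>) - ?B (X \<omega>) (X \<omega>)\<bar>)"
        by (rule integral_abs_bound)
      also have "\<dots> \<le> M.expectation (\<lambda>\<omega>. (2 * (c + \<epsilon>) * \<epsilon> + \<epsilon>\<^sup>2) * (N0 \<omega>)\<^sup>2)"
      proof (rule integral_mono)
        fix \<omega> assume \<omega>: "\<omega> \<in> space M"
        have "\<bar>?B (T \<omega>) (T \<omega>) - ?B (X \<omega>) (X \<omega>)\<bar> \<le> 2 * norm (X \<omega>) * norm (T \<omega> - X \<omega>) + (norm (T \<omega> - X \<omega>))\<^sup>2"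
          by (rule quadratic_form_diff_bound) (rule b2)
        also have "\<dots> \<le> 2 * ((c + \<epsilon>) * N0 \<omega>) * (\<epsilon> * N0 \<omega>) + (\<epsilon> * N0 \<omega>)\<^sup>2"
          using Xb[OF \<omega>] TX[OF \<omega>] c(2) N0_nonneg[of \<omega>] \<epsilon> by (intro add_mono mult_mono power_mono) auto
        also have "\<dots> = (2 * (c + \<epsilon>) * \<epsilon> + \<epsilon>\<^sup>2) * (N0 \<omega>)\<^sup>2"
          by (simp add: power2_eq_square algebra_simps)
        finally show "\<bar>?B (T \<omega>) (T \<omega>) - ?B (X \<omega>) (X \<omega>)\<bar> \<le> (2 * (c + \<epsilon>) * \<epsilon> + \<epsilon>\<^sup>2) * (N0 \<omega>)\<^sup>2" .
      qed (use iB[OF T_meas T_bound] iB[OF X_meas Xb] N0_int2 in auto)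
      finally show ?thesis by (simp add: quadZ quadX K_def)
    qed
    have X1: "\<bar>(\<integral>\<omega>. h (X \<omega>) \<partial>M) - (\<integral>\<omega>. h (Z' \<omega>) \<partial>M')\<bar> \<le>
        pi / 2 * ((2 * (c + \<epsilon>) * \<epsilon> + \<epsilon>\<^sup>2) * K / 2 + (\<Sum>i<n. measure L (A i) * norm (\<phi> (\<xi> i)) ^ 3) / 4)"
      by (rule smart_path_bound[OF M M' D1 D2 D3 b1 b2 b3 _ indN _ pN[OF AL] W(1,2) \<sigma>(2) \<sigma>(1) X_def Z'_def cov_bound]) auto
    have "(\<Sum>i<n. measure L (A i) * norm (\<phi> (\<xi> i)) ^ 3) \<le> (\<Sum>i<n. measure L (A i) * c ^ 3)"
      using \<xi> c by (intro sum_mono mult_left_mono power_mono) auto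
    also have "\<dots> = \<Lambda> * c ^ 3" by (simp add: sum flip: sum_distrib_right)
    finally have "pi / 2 * ((2 * (c + \<epsilon>) * \<epsilon> + \<epsilon>\<^sup>2) * K / 2 + (\<Sum>i<n. measure L (A i) * norm (\<phi> (\<xi> i)) ^ 3) / 4) \<le>
        pi / 2 * ((2 * (c + \<epsilon>) * \<epsilon> + \<epsilon>\<^sup>2) * K / 2 + \<Lambda> * c ^ 3 / 4)"
      by (intro mult_left_mono) auto
    moreover have "(\<integral>\<omega>. h (Z' \<omega>) \<partial>M') = (\<integral>\<omega>. h (Z \<omega>) \<partial>M')"
      using ZZ' by (intro integral_cong_AE) auto
    moreover have "\<bar>(\<integral>\<omega>. h (T \<omega>) \<partial>M) - (\<integral>\<omega>. h (X \<omega>) \<partial>M)\<bar> \<le> \<epsilon> * M.expectation N0"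
    proof -
      have "\<bar>(\<integral>\<omega>. h (T \<omega>) \<partial>M) - (\<integral>\<omega>. h (X \<omega>) \<partial>M)\<bar> = \<bar>\<integral>\<omega>. h (T \<omega>) - h (X \<omega>) \<partial>M\<bar>"
        using hint[OF T_meas T_bound] hint[OF X_meas Xb] by simp
      also have "\<dots> \<le> (\<integral>\<omega>. \<bar>h (T \<omega>) - h (X \<omega>)\<bar> \<partial>M)" by (rule integral_abs_bound)
      also have "\<dots> \<le> (\<integral>\<omega>. \<epsilon> * N0 \<omega> \<partial>M)"
        using hint[OF T_meas T_bound] hint[OF X_meas Xb] N0_int order_trans[OF lip TX]
        by (intro integral_mono) auto
      finally show ?thesis by simp
    qed
    ultimately show ?thesis using X1 by linarith
  qed
  let ?f = "\<lambda>\<epsilon>. \<epsilon> * M.expectation N0 + pi / 2 * ((2 * (c + \<epsilon>) * \<epsilon> + \<epsilon>\<^sup>2) * K / 2 + \<Lambda> * c ^ 3 / 4)"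
  have "(?f \<longlongrightarrow> ?f 0) (at_right 0)"
    by (intro tendsto_intros) auto
  then have "\<bar>(\<integral>\<omega>. h (T \<omega>) \<partial>M) - (\<integral>\<omega>. h (Z \<omega>) \<partial>M')\<bar> \<le> ?f 0"
  proof (rule tendsto_lowerbound)
    show "\<forall>\<^sub>F \<epsilon> in at_right 0. \<bar>(\<integral>\<omega>. h (T \<omega>) \<partial>M) - (\<integral>\<omega>. h (Z \<omega>) \<partial>M')\<bar> \<le> ?f \<epsilon>"
      using main by (auto simp: eventually_at_filter intro!: always_eventually)
  qed simp
  then show ?thesis by (simp add: \<Lambda>_def)
qed


section \<open>Test functions\<close>

lemma lists_over_singleton: "{es. set es \<subseteq> {e} \<and> length es = j} = {replicate j e}"
  by (auto simp: replicate_eqI subset_eq)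

text \<open>
  The orthonormal set \<open>{e}\<close> is one of those in the supremum.
\<close>

lemma tensor_norm_ge_diagonal:
  assumes "tensor_norm j A \<le> 1" "norm e = 1"
  shows "\<bar>A (replicate j e)\<bar> \<le> 1"
proof -
  have "ennreal (sqrt (\<Sum>es\<in>{es. set es \<subseteq> {e} \<and> length es = j}. (A es)\<^sup>2)) \<le> tensor_norm j A"
    unfolding tensor_norm_def using assms(2) by (intro SUP_upper) auto
  also note assms(1)
  finally have "ennreal \<bar>A (replicate j e)\<bar> \<le> 1" unfolding lists_over_singleton by simp
  then show ?thesis by simp
qed

text \<open>
  The tensor norm bounds a derivative at equal unit vectors, and homogeneity extends this to equal vectors of any length,
  which is the form in which the interpolation argument meets the derivatives.
\<close>

lemma Cb3_bounds:
  fixes h :: "'k::real_inner \<Rightarrow> real"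
  assumes h: "h \<in> Cb3" and n: "Cb3_norm h \<le> 1"
  shows "(h has_derivative fderiv h x) (at x)" "(fderiv h has_derivative fderiv (fderiv h) x) (at x)"
    "(fderiv (fderiv h) has_derivative fderiv (fderiv (fderiv h)) x) (at x)"
    "\<bar>fderiv h x u\<bar> \<le> norm u" "\<bar>fderiv (fderiv h) x u u\<bar> \<le> norm u ^ 2"
    "\<bar>fderiv (fderiv (fderiv h)) x u u u\<bar> \<le> norm u ^ 3"
proof -
  have fd: "(f has_derivative fderiv f x) (at x)" if "f differentiable (at x)" for f :: "'k \<Rightarrow> 'c::real_normed_vector"
  proof -
    have w: "(f has_derivative frechet_derivative f (at x)) (at x)"
      using that frechet_derivative_works by blast
    then show ?thesis
      by (simp add: fderiv_def bounded_linear_Blinfun_apply[OF has_derivative_bounded_linear[OF w]])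
  qed
  show "(h has_derivative fderiv h x) (at x)" "(fderiv h has_derivative fderiv (fderiv h) x) (at x)"
    "(fderiv (fderiv h) has_derivative fderiv (fderiv (fderiv h)) x) (at x)"
    using h by (auto simp: Cb3_def intro!: fd)
  let ?A1 = "\<lambda>es :: 'k list. fderiv h x (es ! 0)"
  let ?A2 = "\<lambda>es. fderiv (fderiv h) x (es ! 0) (es ! 1)"
  let ?A3 = "\<lambda>es. fderiv (fderiv (fderiv h)) x (es ! 0) (es ! 1) (es ! 2)"
  have "Max {tensor_norm 1 ?A1, tensor_norm 2 ?A2, tensor_norm 3 ?A3} \<le> Cb3_norm h"
    unfolding Cb3_norm_def by (rule SUP_upper) simp
  then have "Max {tensor_norm 1 ?A1, tensor_norm 2 ?A2, tensor_norm 3 ?A3} \<le> 1"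
    using n by (rule order_trans)
  then have t: "tensor_norm 1 ?A1 \<le> 1" "tensor_norm 2 ?A2 \<le> 1" "tensor_norm 3 ?A3 \<le> 1"
    by auto
  have u: "u = norm u *\<^sub>R sgn u" by (cases "u = 0") (auto simp: sgn_div_norm)
  have "\<bar>fderiv h x u\<bar> \<le> norm u \<and> \<bar>fderiv (fderiv h) x u u\<bar> \<le> norm u ^ 2 \<and>
    \<bar>fderiv (fderiv (fderiv h)) x u u u\<bar> \<le> norm u ^ 3"
  proof (cases "u = 0")
    case False
    define e where "e = sgn u"
    have e: "norm e = 1" using False by (simp add: e_def norm_sgn)
    have ue: "u = norm u *\<^sub>R e" unfolding e_def by (rule u)
    have 1: "\<bar>fderiv h x e\<bar> \<le> 1"
      using tensor_norm_ge_diagonal[OF t(1) e] by simp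
    have 2: "\<bar>fderiv (fderiv h) x e e\<bar> \<le> 1"
      using tensor_norm_ge_diagonal[OF t(2) e] by simp
    have 3: "\<bar>fderiv (fderiv (fderiv h)) x e e e\<bar> \<le> 1"
      using tensor_norm_ge_diagonal[OF t(3) e] by simp
    have "fderiv h x u = norm u * fderiv h x e"
      by (subst ue) (simp add: blinfun.bilinear_simps)
    moreover have "fderiv (fderiv h) x u u = norm u ^ 2 * fderiv (fderiv h) x e e"
      by (subst (1 2) ue) (simp add: blinfun.bilinear_simps power2_eq_square)
    moreover have "fderiv (fderiv (fderiv h)) x u u u = norm u ^ 3 * fderiv (fderiv (fderiv h)) x e e e"
      by (subst (1 2 3) ue) (simp add: blinfun.bilinear_simps power3_eq_cube)
    ultimately show ?thesis
      using mult_left_mono[OF 1 norm_ge_zero[of u]] mult_left_mono[OF 2 zero_le_power[OF norm_ge_zero[of u]], of 2]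
        mult_left_mono[OF 3 zero_le_power[OF norm_ge_zero[of u]], of 3]
      by (simp add: abs_mult)
  qed simp
  then show "\<bar>fderiv h x u\<bar> \<le> norm u" "\<bar>fderiv (fderiv h) x u u\<bar> \<le> norm u ^ 2"
    "\<bar>fderiv (fderiv (fderiv h)) x u u u\<bar> \<le> norm u ^ 3" by auto
qed

section \<open>Functions of a single degree\<close>

lemma real_spherical_harmonics_continuous:
  assumes "real_spherical_harmonics Y" "m \<in> {- int l..int l}"
  shows "continuous_on (sphere 0 1) (Y l m)"
proof -
  have "has_rotation_laplacian (Y l m) (\<lambda>x. - (real l * (real l + 1)) * Y l m x)"
    using assms by (intro has_sphere_laplacian_imp_rotation) (auto simp: real_spherical_harmonics_def)
  moreover obtain b :: "real ^ 3" where "b \<in> Basis" using nonempty_Basis by blast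
  ultimately show ?thesis
    unfolding has_rotation_laplacian_def has_rotation_derivative_def by blast
qed

text \<open>
  Eigenfunctions of the symmetric Laplacian with the distinct eigenvalues \<open>- l (l + 1)\<close> and \<open>- l' (l' + 1)\<close> are orthogonal.
\<close>

lemma sphere_coeff_legendre_eq_0:
  assumes Y: "real_spherical_harmonics Y" and m: "m \<in> {- int l'..int l'}" and "l' \<noteq> l" and \<xi>: "norm \<xi> = 1"
  shows "sphere_coeff Y (\<lambda>x. poly (legendre l) (x \<bullet> \<xi>)) l' m = 0"
proof -
  let ?f = "\<lambda>x. poly (legendre l) (x \<bullet> \<xi>)" and ?k = "\<lambda>l::nat. real l * (real l + 1)"
  have 1: "has_rotation_laplacian ?f (\<lambda>x. - ?k l * ?f x)"
    using has_rotation_laplacian_zonal[OF \<xi>, of "legendre l"] unfolding legendre_ode by simp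
  have 2: "has_rotation_laplacian (Y l' m) (\<lambda>x. - ?k l' * Y l' m x)"
    using Y m by (intro has_sphere_laplacian_imp_rotation) (auto simp: real_spherical_harmonics_def)
  have "- ?k l * sphere_coeff Y ?f l' m = - ?k l' * sphere_coeff Y ?f l' m"
    using has_rotation_laplacian_self_adjoint[OF 1 2]
    unfolding sphere_coeff_def integral_mult_right_zero[symmetric] by (simp only: mult_ac)
  moreover have "?k l \<noteq> ?k l'"
  proof -
    have "l * (l + 1) \<noteq> l' * (l' + 1)"
      using \<open>l' \<noteq> l\<close> mult_strict_mono[of l l' "l + 1" "l' + 1"] mult_strict_mono[of l' l "l' + 1" "l + 1"]
      by (cases l l' rule: linorder_cases) auto
    then have "real (l * (l + 1)) \<noteq> real (l' * (l' + 1))" by (simp only: of_nat_eq_iff not_False_eq_True)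
    then show ?thesis by (simp add: algebra_simps)
  qed
  ultimately show ?thesis by simp
qed

text \<open>
  Boundedness, rather than square integrability, makes the products with harmonics integrable at once, and the waves
  have it.
\<close>

definition band_limited :: "(nat \<Rightarrow> int \<Rightarrow> real ^ 3 \<Rightarrow> real) \<Rightarrow> nat \<Rightarrow> (real ^ 3 \<Rightarrow> real) set" where
  "band_limited Y l = {f. f \<in> borel_measurable sphere_measure \<and> (\<exists>b. \<forall>x\<in>sphere 0 1. \<bar>f x\<bar> \<le> b) \<and>
     (\<forall>l'. \<forall>m\<in>{- int l'..int l'}. l' \<noteq> l \<longrightarrow> sphere_coeff Y f l' m = 0)}"

lemma integrable_bounded_mult_harmonic:
  assumes Y: "real_spherical_harmonics Y" and m: "m \<in> {- int l..int l}"
    and f: "f \<in> borel_measurable sphere_measure" "\<forall>x\<in>sphere 0 1. \<bar>f x\<bar> \<le> b"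
  shows "integrable sphere_measure (\<lambda>x. f x * Y l m x)"
proof (rule Bochner_Integration.integrable_bound)
  have c: "continuous_on (sphere 0 1) (Y l m)" by (rule real_spherical_harmonics_continuous[OF Y m])
  then show "integrable sphere_measure (\<lambda>x. b * Y l m x)"
    by (intro integrable_continuous_on_sphere continuous_intros)
  show "(\<lambda>x. f x * Y l m x) \<in> borel_measurable sphere_measure"
    using f(1) measurable_continuous_on_sphere[OF c] by (rule borel_measurable_times)
  show "AE x in sphere_measure. norm (f x * Y l m x) \<le> norm (b * Y l m x)"
  proof (rule AE_I2)
    fix x assume "x \<in> space sphere_measure"
    then have "\<bar>f x\<bar> \<le> b" using f(2) by simp
    then have "\<bar>f x\<bar> \<le> \<bar>b\<bar>" by linarith
    then show "norm (f x * Y l m x) \<le> norm (b * Y l m x)"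
      unfolding real_norm_def abs_mult by (rule mult_right_mono) simp
  qed
qed

lemma sphere_coeff_linear:
  assumes "real_spherical_harmonics Y" "m \<in> {- int l'..int l'}" "f \<in> band_limited Y l" "g \<in> band_limited Y l"
  shows "sphere_coeff Y (\<lambda>x. a * f x + b * g x) l' m = a * sphere_coeff Y f l' m + b * sphere_coeff Y g l' m"
proof -
  have "integrable sphere_measure (\<lambda>x. f x * Y l' m x)" "integrable sphere_measure (\<lambda>x. g x * Y l' m x)"
    using assms by (auto simp: band_limited_def intro: integrable_bounded_mult_harmonic)
  then show ?thesis
    by (simp add: sphere_coeff_def distrib_right mult.assoc)
qed

lemma band_limited_linear:
  assumes "real_spherical_harmonics Y" and f: "f \<in> band_limited Y l" and g: "g \<in> band_limited Y l"
  shows "(\<lambda>x. a * f x + b * g x) \<in> band_limited Y l"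
proof -
  obtain bf bg where b: "\<forall>x\<in>sphere 0 1. \<bar>f x\<bar> \<le> bf" "\<forall>x\<in>sphere 0 1. \<bar>g x\<bar> \<le> bg"
    using f g by (auto simp: band_limited_def)
  have "\<bar>a * f x + b * g x\<bar> \<le> \<bar>a\<bar> * bf + \<bar>b\<bar> * bg" if "x \<in> sphere 0 1" for x
    using b that by (intro order_trans[OF abs_triangle_ineq] add_mono) (auto simp: abs_mult intro!: mult_left_mono)
  then have "\<exists>c. \<forall>x\<in>sphere 0 1. \<bar>a * f x + b * g x\<bar> \<le> c" by blast
  moreover have "(\<lambda>x. a * f x + b * g x) \<in> borel_measurable sphere_measure"
    using f g by (auto simp: band_limited_def)
  moreover have "sphere_coeff Y (\<lambda>x. a * f x + b * g x) l' m = 0" if "m \<in> {- int l'..int l'}" "l' \<noteq> l" for l' m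
    using sphere_coeff_linear[OF assms(1) that(1) f g, of a b] f g that by (simp add: band_limited_def)
  ultimately show ?thesis by (simp add: band_limited_def)
qed

lemma band_limited_sobolev:
  assumes f: "f \<in> band_limited Y l"
  shows "f \<in> sobolev_functions Y \<alpha>"
    "sobolev_norm Y \<alpha> f = (1 + sqrt (real l * (real l + 1))) powr \<alpha> * sqrt (\<Sum>m\<in>{- int l..int l}. (sphere_coeff Y f l m)\<^sup>2)"
proof -
  obtain b where m: "f \<in> borel_measurable sphere_measure" and b: "\<forall>x\<in>sphere 0 1. \<bar>f x\<bar> \<le> b"
    using f by (auto simp: band_limited_def)
  have "integrable sphere_measure (\<lambda>x. (f x)\<^sup>2)"
  proof (rule finite_measure.integrable_const_bound[OF finite_sphere_measure, of _ "b\<^sup>2"])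
    show "AE x in sphere_measure. norm ((f x)\<^sup>2) \<le> b\<^sup>2"
    proof (rule AE_I2)
      fix x assume "x \<in> space sphere_measure"
      then have "\<bar>f x\<bar> \<le> b" using b by simp
      then have "\<bar>f x\<bar>\<^sup>2 \<le> b\<^sup>2" by (intro power_mono) auto
      then show "norm ((f x)\<^sup>2) \<le> b\<^sup>2" by simp
    qed
  qed (use m in measurable)
  then have L2: "f \<in> sphere_L2" using m by (simp add: sphere_L2_def)
  have t0: "sobolev_term Y \<alpha> f l' = 0" if "l' \<noteq> l" for l'
    using f that by (simp add: sobolev_term_def band_limited_def)
  have "summable (sobolev_term Y \<alpha> f)"
    using t0 by (intro summable_finite[of "{l}"]) auto
  then show "f \<in> sobolev_functions Y \<alpha>" using L2 by (simp add: sobolev_functions_def)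
  have "(\<Sum>l. sobolev_term Y \<alpha> f l) = sobolev_term Y \<alpha> f l"
    using t0 by (subst suminf_finite[of "{l}"]) auto
  also have "\<dots> = ((1 + sqrt (real l * (real l + 1))) powr \<alpha>)\<^sup>2 * (\<Sum>m\<in>{- int l..int l}. (sphere_coeff Y f l m)\<^sup>2)"
  proof -
    have "c powr (2 * \<alpha>) = (c powr \<alpha>)\<^sup>2" for c :: real
      by (simp add: power2_eq_square flip: powr_add)
    then show ?thesis by (simp add: sobolev_term_def sum_distrib_left)
  qed
  finally show "sobolev_norm Y \<alpha> f = (1 + sqrt (real l * (real l + 1))) powr \<alpha> * sqrt (\<Sum>m\<in>{- int l..int l}. (sphere_coeff Y f l m)\<^sup>2)"
    by (simp add: sobolev_norm_def real_sqrt_mult)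
qed

lemma bounded_continuous_on_sphere:
  fixes f :: "real ^ 3 \<Rightarrow> real"
  assumes "continuous_on (sphere 0 1) f"
  shows "\<exists>b. \<forall>x\<in>sphere 0 1. \<bar>f x\<bar> \<le> b"
proof -
  have "compact (f ` sphere 0 1)" using assms by (intro compact_continuous_image) auto
  then have "bounded (f ` sphere 0 1)" by (rule compact_imp_bounded)
  then show ?thesis by (auto simp: bounded_iff)
qed

lemma harmonic_band_limited:
  assumes Y: "real_spherical_harmonics Y" and m: "m \<in> {- int l..int l}"
  shows "Y l m \<in> band_limited Y l"
  using bounded_continuous_on_sphere[OF real_spherical_harmonics_continuous[OF Y m]]
    measurable_continuous_on_sphere[OF real_spherical_harmonics_continuous[OF Y m]] Y m
  by (auto simp: band_limited_def real_spherical_harmonics_def)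

lemma legendre_band_limited:
  assumes Y: "real_spherical_harmonics Y" and \<xi>: "norm \<xi> = 1"
  shows "(\<lambda>x. poly (legendre l) (x \<bullet> \<xi>)) \<in> band_limited Y l"
  using bounded_continuous_on_sphere[OF continuous_on_zonal] measurable_continuous_on_sphere[OF continuous_on_zonal]
    sphere_coeff_legendre_eq_0[OF Y _ _ \<xi>]
  by (auto simp: band_limited_def)

text \<open>
  The class of \<open>f\<close> is determined by its coefficients: the difference of \<open>f\<close> and its expansion in degree \<open>l\<close> has
  Sobolev norm zero.
\<close>

lemma class_map_band_limited:
  fixes J :: "(real ^ 3 \<Rightarrow> real) \<Rightarrow> 'k::real_inner"
  assumes Y: "real_spherical_harmonics Y" and J: "sobolev_class_map Y \<alpha> J" and f: "f \<in> band_limited Y l"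
  shows "J f = (\<Sum>m\<in>{- int l..int l}. sphere_coeff Y f l m *\<^sub>R J (Y l m))"
proof -
  let ?I = "{- int l..int l}"
  have Jlin: "J (\<lambda>x. a * f x + b * g x) = a *\<^sub>R J f + b *\<^sub>R J g"
    if "f \<in> band_limited Y l" "g \<in> band_limited Y l" for f g a b
    using J that band_limited_sobolev(1) by (auto simp: sobolev_class_map_def)
  let ?g = "\<lambda>F x. \<Sum>m\<in>F. sphere_coeff Y f l m * Y l m x"
  have g: "?g F \<in> band_limited Y l \<and> J (?g F) = (\<Sum>m\<in>F. sphere_coeff Y f l m *\<^sub>R J (Y l m)) \<and>
    (\<forall>m\<in>?I. sphere_coeff Y (?g F) l m = (if m \<in> F then sphere_coeff Y f l m else 0))" if "finite F" "F \<subseteq> ?I" for F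
    using that
  proof (induction F rule: finite_induct)
    case empty
    have eq: "(\<lambda>x. 0 * f x + 0 * f x) = ?g {}" by simp
    show ?case
      using band_limited_linear[OF Y f f, of 0 0] Jlin[OF f f, of 0 0] unfolding eq by (simp add: sphere_coeff_def)
  next
    case (insert m F)
    then have m: "m \<in> ?I" and IH: "?g F \<in> band_limited Y l" "J (?g F) = (\<Sum>m\<in>F. sphere_coeff Y f l m *\<^sub>R J (Y l m))"
      "\<And>m. m \<in> ?I \<Longrightarrow> sphere_coeff Y (?g F) l m = (if m \<in> F then sphere_coeff Y f l m else 0)" by auto
    note Ym = harmonic_band_limited[OF Y m]
    define G where "G = ?g F"
    have eq: "?g (insert m F) = (\<lambda>x. sphere_coeff Y f l m * Y l m x + 1 * G x)"
      using insert.hyps by (simp add: G_def)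
    have o: "sphere_coeff Y (Y l m) l m' = (if m = m' then 1 else 0)" if "m' \<in> ?I" for m'
      using Y m that by (auto simp: real_spherical_harmonics_def)
    note IH = IH[folded G_def]
    show ?case
      unfolding eq
    proof (intro conjI ballI)
      show "(\<lambda>x. sphere_coeff Y f l m * Y l m x + 1 * G x) \<in> band_limited Y l"
        by (rule band_limited_linear[OF Y Ym IH(1)])
      show "J (\<lambda>x. sphere_coeff Y f l m * Y l m x + 1 * G x) =
          (\<Sum>m\<in>insert m F. sphere_coeff Y f l m *\<^sub>R J (Y l m))"
        unfolding Jlin[OF Ym IH(1)] IH(2) using insert.hyps by simp
      show "sphere_coeff Y (\<lambda>x. sphere_coeff Y f l m * Y l m x + 1 * G x) l m' =
          (if m' \<in> insert m F then sphere_coeff Y f l m' else 0)" if "m' \<in> ?I" for m'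
        unfolding sphere_coeff_linear[OF Y that Ym IH(1)] IH(3)[OF that] o[OF that] using insert.hyps by auto
    qed
  qed
  from g[of ?I] have G: "?g ?I \<in> band_limited Y l" "J (?g ?I) = (\<Sum>m\<in>?I. sphere_coeff Y f l m *\<^sub>R J (Y l m))"
    "\<And>m. m \<in> ?I \<Longrightarrow> sphere_coeff Y (?g ?I) l m = sphere_coeff Y f l m" by auto
  let ?d = "\<lambda>x. 1 * f x + (- 1) * ?g ?I x"
  have d: "?d \<in> band_limited Y l" by (rule band_limited_linear[OF Y f G(1)])
  have "sphere_coeff Y ?d l m = 0" if "m \<in> ?I" for m
    using sphere_coeff_linear[OF Y that f G(1), of 1 "- 1"] G(3)[OF that] by simp
  then have "sobolev_norm Y \<alpha> ?d = 0"
    unfolding band_limited_sobolev(2)[OF d] by simp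
  then have "norm (J ?d) = 0"
    using J band_limited_sobolev(1)[OF d] by (simp add: sobolev_class_map_def)
  then show ?thesis
    using Jlin[OF f G(1), of 1 "- 1"] G(2) by simp
qed

text \<open>
  Bessel's inequality for the Legendre function, whose squared \<open>L\<^sup>2\<close> norm is \<open>4 pi / (2 l + 1)\<close>.
\<close>

lemma legendre_coeff_bessel:
  assumes Y: "real_spherical_harmonics Y" and \<xi>: "norm \<xi> = 1"
  shows "(\<Sum>m\<in>{- int l..int l}. (sphere_coeff Y (\<lambda>x. poly (legendre l) (x \<bullet> \<xi>)) l m)\<^sup>2) \<le> 4 * pi / (2 * real l + 1)"
proof -
  let ?I = "{- int l..int l}"
  define f where "f x = poly (legendre l) (x \<bullet> \<xi>)" for x
  define q where "q m = sphere_coeff Y f l m" for m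
  have cf: "continuous_on (sphere 0 1) f" unfolding f_def by (rule continuous_on_zonal)
  have cY: "continuous_on (sphere 0 1) (Y l m)" if "m \<in> ?I" for m
    by (rule real_spherical_harmonics_continuous[OF Y that])
  let ?g = "\<lambda>x. \<Sum>m\<in>?I. q m * Y l m x"
  have cg: "continuous_on (sphere 0 1) ?g" by (intro continuous_intros cY) auto
  note int = integrable_continuous_on_sphere
  have ff: "(\<integral>x. (f x)\<^sup>2 \<partial>sphere_measure) = 4 * pi / (2 * real l + 1)"
    unfolding f_def by (rule integral_legendre_square_zonal[OF \<xi>])
  have fg: "(\<integral>x. f x * ?g x \<partial>sphere_measure) = (\<Sum>m\<in>?I. (q m)\<^sup>2)"
  proof -
    have "(\<integral>x. f x * ?g x \<partial>sphere_measure) = (\<integral>x. (\<Sum>m\<in>?I. q m * (f x * Y l m x)) \<partial>sphere_measure)"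
      by (simp add: sum_distrib_left mult_ac)
    also have "\<dots> = (\<Sum>m\<in>?I. \<integral>x. q m * (f x * Y l m x) \<partial>sphere_measure)"
      by (intro Bochner_Integration.integral_sum int continuous_intros cf cY) auto
    finally show ?thesis by (simp add: q_def sphere_coeff_def power2_eq_square)
  qed
  have gg: "(\<integral>x. (?g x)\<^sup>2 \<partial>sphere_measure) = (\<Sum>m\<in>?I. (q m)\<^sup>2)"
  proof -
    have "(\<integral>x. (?g x)\<^sup>2 \<partial>sphere_measure) =
        (\<integral>x. (\<Sum>m\<in>?I. \<Sum>m'\<in>?I. (q m * q m') * (Y l m x * Y l m' x)) \<partial>sphere_measure)"
      by (simp add: power2_eq_square sum_product mult_ac)
    also have "\<dots> = (\<Sum>m\<in>?I. \<integral>x. (\<Sum>m'\<in>?I. (q m * q m') * (Y l m x * Y l m' x)) \<partial>sphere_measure)"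
      by (intro Bochner_Integration.integral_sum int continuous_intros cY) auto
    also have "\<dots> = (\<Sum>m\<in>?I. \<Sum>m'\<in>?I. \<integral>x. (q m * q m') * (Y l m x * Y l m' x) \<partial>sphere_measure)"
      by (intro sum.cong refl Bochner_Integration.integral_sum int continuous_intros cY) auto
    also have "\<dots> = (\<Sum>m\<in>?I. \<Sum>m'\<in>?I. (q m * q m') * sphere_coeff Y (Y l m) l m')"
      by (simp add: sphere_coeff_def)
    also have "\<dots> = (\<Sum>m\<in>?I. \<Sum>m'\<in>?I. if m = m' then (q m * q m') else 0)"
      using Y by (intro sum.cong refl) (auto simp: real_spherical_harmonics_def)
    finally show ?thesis by (simp add: power2_eq_square)
  qed
  have "0 \<le> (\<integral>x. (f x - ?g x)\<^sup>2 \<partial>sphere_measure)" by simp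
  also have "\<dots> = (\<integral>x. (f x)\<^sup>2 - 2 * (f x * ?g x) + (?g x)\<^sup>2 \<partial>sphere_measure)"
    by (intro Bochner_Integration.integral_cong) (auto simp: power2_diff)
  also have "\<dots> = (\<integral>x. (f x)\<^sup>2 \<partial>sphere_measure) - 2 * (\<integral>x. f x * ?g x \<partial>sphere_measure) + (\<integral>x. (?g x)\<^sup>2 \<partial>sphere_measure)"
  proof -
    have "integrable sphere_measure (\<lambda>x. (f x)\<^sup>2)" "integrable sphere_measure (\<lambda>x. f x * ?g x)"
      "integrable sphere_measure (\<lambda>x. (?g x)\<^sup>2)"
      by (intro int continuous_intros cf cg; simp)+
    then show ?thesis by simp
  qed
  finally show ?thesis unfolding ff fg gg by (simp add: q_def f_def[abs_def])
qed


lemma zonal_bounded: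
  obtains b where "\<And>x \<xi> :: real ^ 3. norm x = 1 \<Longrightarrow> norm \<xi> = 1 \<Longrightarrow> \<bar>poly p (x \<bullet> \<xi>)\<bar> \<le> b"
proof -
  have "compact (poly p ` {-1..1})" by (intro compact_continuous_image continuous_intros) auto
  then obtain b where b: "\<And>s. s \<in> {-1..1} \<Longrightarrow> norm (poly p s) \<le> b"
    by (meson bounded_iff compact_imp_bounded imageI)
  have "\<bar>poly p (x \<bullet> \<xi>)\<bar> \<le> b" if "norm x = 1" "norm \<xi> = 1" for x \<xi> :: "real ^ 3"
    using b[of "x \<bullet> \<xi>"] Cauchy_Schwarz_ineq2[of x \<xi>] that by (auto simp: abs_le_iff)
  then show ?thesis by (rule that)
qed

lemma measurable_id_sphere:
  assumes "sets Q = sets sphere_measure"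
  shows "(\<lambda>x. x) \<in> measurable Q borel"
  using assms measurable_restrict_space1[OF measurable_ident_sets[OF refl], of borel "sphere 0 1"]
  by (simp add: measurable_cong_sets[of Q "restrict_space borel (sphere 0 1)"] id_def)

section \<open>The Poisson wave as a Hilbert space valued integral\<close>

text \<open>
  Fubini's theorem for the integral over the points \<open>\<xi>\<close> and the scalar product with a harmonic.
\<close>

lemma legendre_wave_coefficients:
  fixes l :: nat
  assumes Y: "real_spherical_harmonics Y" and Q: "finite_measure Q" and sQ: "sets Q = sets sphere_measure"
  defines "g \<equiv> \<lambda>x. \<integral>\<xi>. poly (legendre l) (x \<bullet> \<xi>) \<partial>Q"
  shows "g \<in> band_limited Y l"
    and "m \<in> {- int l..int l} \<Longrightarrow> sphere_coeff Y g l m =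
      (\<integral>\<xi>. sphere_coeff Y (\<lambda>x. poly (legendre l) (x \<bullet> \<xi>)) l m \<partial>Q)"
proof -
  interpret Q: finite_measure Q by fact
  interpret S: finite_measure sphere_measure by (rule finite_sphere_measure)
  interpret P: pair_sigma_finite Q sphere_measure ..
  let ?k = "\<lambda>\<xi> x. poly (legendre l) (x \<bullet> \<xi>)"
  have spQ: "space Q = sphere 0 1" using sets_eq_imp_space_eq[OF sQ] by simp
  note idQ = measurable_id_sphere[OF sQ] and idS = measurable_id_sphere[OF refl]
  have poly_meas: "poly p \<in> borel_measurable borel" for p :: "real poly"
    by (intro borel_measurable_continuous_onI continuous_intros)
  have "(\<lambda>z. snd z \<bullet> fst z) \<in> borel_measurable (Q \<Otimes>\<^sub>M sphere_measure)"
    by (intro borel_measurable_inner measurable_compose[OF measurable_snd idS] measurable_compose[OF measurable_fst idQ])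
  from measurable_compose[OF this poly_meas[of "legendre l"]]
  have k_meas[measurable]: "(\<lambda>(\<xi>, x). ?k \<xi> x) \<in> borel_measurable (Q \<Otimes>\<^sub>M sphere_measure)"
    by (simp add: split_beta')
  obtain b where b: "\<And>x \<xi> :: real ^ 3. norm x = 1 \<Longrightarrow> norm \<xi> = 1 \<Longrightarrow> \<bar>poly (legendre l) (x \<bullet> \<xi>)\<bar> \<le> b"
    by (rule zonal_bounded[of "legendre l"]) (rule that)
  have coeff: "sphere_coeff Y g l' m = (\<integral>\<xi>. sphere_coeff Y (\<lambda>x. ?k \<xi> x) l' m \<partial>Q)"
    if m: "m \<in> {- int l'..int l'}" for l' m
  proof -
    have cY: "continuous_on (sphere 0 1) (Y l' m)" by (rule real_spherical_harmonics_continuous[OF Y m])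
    note [measurable] = measurable_continuous_on_sphere[OF cY]
    obtain b' where b': "\<forall>x\<in>sphere 0 1. \<bar>Y l' m x\<bar> \<le> b'" using bounded_continuous_on_sphere[OF cY] by blast
    have "integrable (Q \<Otimes>\<^sub>M sphere_measure) (\<lambda>(\<xi>, x). ?k \<xi> x * Y l' m x)"
    proof (rule finite_measure.integrable_const_bound)
      show "finite_measure (Q \<Otimes>\<^sub>M sphere_measure)"
        by (rule finite_measure_pair_measure) unfold_locales
      show "AE z in Q \<Otimes>\<^sub>M sphere_measure. norm (case z of (\<xi>, x) \<Rightarrow> ?k \<xi> x * Y l' m x) \<le> b * b'"
      proof (rule AE_I2)
        fix z assume "z \<in> space (Q \<Otimes>\<^sub>M sphere_measure)"
        then obtain \<xi> x where z: "z = (\<xi>, x)" "norm \<xi> = 1" "norm x = 1"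
          by (auto simp: space_pair_measure spQ)
        have "\<bar>?k \<xi> x\<bar> * \<bar>Y l' m x\<bar> \<le> b * b'"
          using b[OF z(3,2)] b' z(3) by (intro mult_mono) (auto intro: order_trans[OF abs_ge_zero])
        then show "norm (case z of (\<xi>, x) \<Rightarrow> ?k \<xi> x * Y l' m x) \<le> b * b'"
          by (simp add: z abs_mult)
      qed
    qed measurable
    from P.Fubini_integral[OF this] show ?thesis
      by (simp add: sphere_coeff_def g_def)
  qed
  then show "m \<in> {- int l..int l} \<Longrightarrow> sphere_coeff Y g l m = (\<integral>\<xi>. sphere_coeff Y (\<lambda>x. ?k \<xi> x) l m \<partial>Q)" .
  have "g \<in> borel_measurable sphere_measure"
    unfolding g_def using k_meas by (intro Q.borel_measurable_lebesgue_integral) (simp add: split_beta' measurable_pair_swap_iff[of _ sphere_measure Q])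
  moreover have "\<bar>g x\<bar> \<le> b * measure Q (space Q)" if x: "x \<in> sphere 0 1" for x
  proof -
    have "\<bar>g x\<bar> \<le> (\<integral>\<xi>. \<bar>?k \<xi> x\<bar> \<partial>Q)" unfolding g_def by (rule integral_abs_bound)
    also have "\<dots> \<le> (\<integral>\<xi>. b \<partial>Q)"
    proof (rule integral_mono)
      show "integrable Q (\<lambda>\<xi>. \<bar>?k \<xi> x\<bar>)"
        using b x by (intro integrable_abs Q.integrable_const_bound[of _ b]) (auto simp: spQ)
    qed (use b x in \<open>auto simp: spQ\<close>)
    finally show ?thesis by (simp add: mult.commute)
  qed
  moreover have "sphere_coeff Y g l' m = 0" if "m \<in> {- int l'..int l'}" "l' \<noteq> l" for l' m
  proof -
    have "(\<integral>\<xi>. sphere_coeff Y (\<lambda>x. ?k \<xi> x) l' m \<partial>Q) = (\<integral>\<xi>. 0 \<partial>Q)"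
      using sphere_coeff_legendre_eq_0[OF Y that]
      by (intro Bochner_Integration.integral_cong) (auto simp: spQ)
    then show ?thesis using coeff[OF that(1)] by simp
  qed
  ultimately show "g \<in> band_limited Y l"
    unfolding band_limited_def by (intro CollectI conjI allI ballI impI exI[of _ "b * measure Q (space Q)"])
qed

lemma continuous_on_legendre_coeff:
  assumes Y: "real_spherical_harmonics Y" and m: "m \<in> {- int l..int l}"
  shows "continuous_on (sphere 0 1) (\<lambda>\<xi>. sphere_coeff Y (\<lambda>x. poly (legendre l) (x \<bullet> \<xi>)) l m)"
  unfolding continuous_on_sequentially comp_def
proof (intro allI ballI impI, elim conjE)
  fix \<xi> :: "nat \<Rightarrow> real ^ 3" and \<xi>0 assume \<xi>0: "\<xi>0 \<in> sphere 0 1" and \<xi>: "\<forall>n. \<xi> n \<in> sphere 0 1" "\<xi> \<longlonglongrightarrow> \<xi>0"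
  obtain b where b: "\<And>x \<xi> :: real ^ 3. norm x = 1 \<Longrightarrow> norm \<xi> = 1 \<Longrightarrow> \<bar>poly (legendre l) (x \<bullet> \<xi>)\<bar> \<le> b"
    by (rule zonal_bounded[of "legendre l"]) (rule that)
  have cY: "continuous_on (sphere 0 1) (Y l m)" by (rule real_spherical_harmonics_continuous[OF Y m])
  have c: "continuous_on (sphere 0 1) (\<lambda>x. poly (legendre l) (x \<bullet> \<xi>) * Y l m x)" for \<xi>
    by (intro continuous_intros cY)
  show "(\<lambda>n. sphere_coeff Y (\<lambda>x. poly (legendre l) (x \<bullet> \<xi> n)) l m) \<longlonglongrightarrow>
      sphere_coeff Y (\<lambda>x. poly (legendre l) (x \<bullet> \<xi>0)) l m"
    unfolding sphere_coeff_def
  proof (rule integral_dominated_convergence)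
    show "integrable sphere_measure (\<lambda>x. b * \<bar>Y l m x\<bar>)"
      by (intro integrable_continuous_on_sphere continuous_intros cY)
    show "AE x in sphere_measure. (\<lambda>n. poly (legendre l) (x \<bullet> \<xi> n) * Y l m x) \<longlonglongrightarrow> poly (legendre l) (x \<bullet> \<xi>0) * Y l m x"
      by (intro AE_I2 tendsto_intros \<xi>(2))
    show "AE x in sphere_measure. norm (poly (legendre l) (x \<bullet> \<xi> n) * Y l m x) \<le> b * \<bar>Y l m x\<bar>" for n
      using \<xi>(1) by (intro AE_I2) (auto simp: abs_mult intro!: mult_right_mono b)
  qed (intro measurable_continuous_on_sphere c)+
qed

lemma integral_scale_measure:
  fixes f :: "'a \<Rightarrow> 'b :: {banach, second_countable_topology}"
  assumes "f \<in> borel_measurable M" "r \<ge> 0"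
  shows "(\<integral>x. f x \<partial>scale_measure (ennreal r) M) = r *\<^sub>R (\<integral>x. f x \<partial>M)"
proof -
  have "scale_measure (ennreal r) M = density M (\<lambda>_. ennreal r)"
    by (rule measure_eqI) (auto simp: emeasure_density_const)
  then show ?thesis
    using integral_density[OF assms(1), of "\<lambda>_. r"] assms(2) by simp
qed

text \<open>
  It remains to write \<open>T\<close> as the integral of \<open>\<phi>\<close> and to verify the hypotheses of the bound for Poisson integrals.
\<close>

theorem theorem2p12:
  fixes M :: "'a measure" and M' :: "'b measure"
    and \<nu> :: "real \<Rightarrow> real" and N :: "real \<Rightarrow> 'a \<Rightarrow> (real ^ 3) measure"
    and Y :: "nat \<Rightarrow> int \<Rightarrow> real ^ 3 \<Rightarrow> real"
    and J :: "(real ^ 3 \<Rightarrow> real) \<Rightarrow> 'k::{real_inner, banach, second_countable_topology}"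
    and T :: "'a \<Rightarrow> 'k" and Z :: "'b \<Rightarrow> 'k"
    and \<alpha> t :: real and l :: nat
  assumes "prob_space M" and "prob_space M'"
    and "\<alpha> > 0" and "l \<ge> 1" and "t > 0" and "\<nu> t > 0"
    and "real_spherical_harmonics Y" and "sobolev_class_map Y \<alpha> J"
    and "poisson_random_measure M (scale_measure (ennreal (\<nu> t)) sphere_measure) (N t)"
    and T: "\<And>\<omega>. T \<omega> = J (poisson_wave l (\<nu> t) (N t \<omega>))"
    and "centred_gaussian M' Z" and "integrable M' (\<lambda>\<omega>. (norm (Z \<omega>))\<^sup>2)"
    and "covariance_operator M' Z = covariance_operator M T"
  shows "d3 M T M' Z \<le>
    ennreal (sqrt pi * (1 + sqrt (real l * (real l + 1))) powr (2 * \<alpha>) / (2 * sqrt (\<nu> t))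
      + 2 * pi * (1 + sqrt (real l * (real l + 1))) powr (3 * \<alpha>) / sqrt (\<nu> t))"
proof -
  note Y = \<open>real_spherical_harmonics Y\<close> and J = \<open>sobolev_class_map Y \<alpha> J\<close>
  note prm = \<open>poisson_random_measure M (scale_measure (ennreal (\<nu> t)) sphere_measure) (N t)\<close>
  note \<nu> = \<open>\<nu> t > 0\<close>
  let ?L = "scale_measure (ennreal (\<nu> t)) sphere_measure"
  let ?I = "{- int l..int l}"
  define C where "C = (1 + sqrt (real l * (real l + 1))) powr \<alpha>"
  define a where "a = 1 / sqrt (\<nu> t) * sqrt ((2 * real l + 1) / (4 * pi))"
  define f where "f \<xi> = (\<lambda>x. poly (legendre l) (x \<bullet> \<xi>))" for \<xi> :: "real ^ 3"
  define q where "q m \<xi> = sphere_coeff Y (f \<xi>) l m" for m \<xi>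
  define \<phi> where "\<phi> \<xi> = (\<Sum>m\<in>?I. (a * q m \<xi>) *\<^sub>R J (Y l m))" for \<xi>
  have C0: "C \<ge> 0" by (simp add: C_def)
  have a0: "a \<ge> 0" using \<nu> by (simp add: a_def)
  have Jlin: "J (\<lambda>x. a * f x + b * g x) = a *\<^sub>R J f + b *\<^sub>R J g"
    if "f \<in> band_limited Y l" "g \<in> band_limited Y l" for f g a b
    using J that band_limited_sobolev(1) by (auto simp: sobolev_class_map_def)
  \<comment> \<open>The class map may be taken inside the integral, because the coefficients determine the class.\<close>
  have wave: "J (poisson_wave l (\<nu> t) Q) = (\<Sum>m\<in>?I. (a * (\<integral>\<xi>. q m \<xi> \<partial>Q)) *\<^sub>R J (Y l m))"
    if Q: "finite_measure Q" "sets Q = sets sphere_measure" for Q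
  proof -
    let ?g = "\<lambda>x. \<integral>\<xi>. poly (legendre l) (x \<bullet> \<xi>) \<partial>Q"
    note g = legendre_wave_coefficients(1)[OF Y Q, of l]
    have "poisson_wave l (\<nu> t) Q = (\<lambda>x. a * ?g x + 0 * ?g x)"
      by (simp add: fun_eq_iff poisson_wave_def a_def)
    then have "J (poisson_wave l (\<nu> t) Q) = a *\<^sub>R J ?g"
      using Jlin[OF g g, of a 0] by simp
    also have "J ?g = (\<Sum>m\<in>?I. (\<integral>\<xi>. q m \<xi> \<partial>Q) *\<^sub>R J (Y l m))"
      unfolding class_map_band_limited[OF Y J g] q_def f_def
      by (intro sum.cong refl) (simp add: legendre_wave_coefficients(2)[OF Y Q])
    finally show ?thesis by (simp add: scaleR_sum_right)
  qed
  have cq: "continuous_on (sphere 0 1) (q m)" if "m \<in> ?I" for m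
    unfolding q_def f_def by (rule continuous_on_legendre_coeff[OF Y that])
  have \<phi>_cont: "continuous_on (sphere 0 1) \<phi>"
    unfolding \<phi>_def[abs_def] by (intro continuous_intros cq) auto
  have \<phi>_int: "(\<integral>\<xi>. \<phi> \<xi> \<partial>Q) = (\<Sum>m\<in>?I. (a * (\<integral>\<xi>. q m \<xi> \<partial>Q)) *\<^sub>R J (Y l m))"
    if Q: "finite_measure Q" "sets Q = sets sphere_measure" for Q
  proof -
    have "integrable Q (q m)" if m: "m \<in> ?I" for m
    proof -
      obtain b where "\<forall>x\<in>sphere 0 1. \<bar>q m x\<bar> \<le> b"
        using bounded_continuous_on_sphere[OF cq[OF m]] by blast
      moreover have "q m \<in> borel_measurable Q"
        using measurable_continuous_on_sphere[OF cq[OF m]] by (simp only: measurable_cong_sets[OF Q(2) refl])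
      ultimately show ?thesis
        using sets_eq_imp_space_eq[OF Q(2)] by (intro finite_measure.integrable_const_bound[OF Q(1), of _ b]) auto
    qed
    then show ?thesis
      unfolding \<phi>_def by (subst Bochner_Integration.integral_sum) auto
  qed
  \<comment> \<open>The factor \<open>a\<close> normalises the Legendre function in \<open>L\<^sup>2\<close>, up to \<open>sqrt (\<nu> t)\<close>.\<close>
  have \<phi>_norm: "norm (\<phi> \<xi>) \<le> C / sqrt (\<nu> t)" if "\<xi> \<in> sphere 0 1" for \<xi>
  proof -
    have \<xi>: "norm \<xi> = 1" using that by simp
    have fb: "f \<xi> \<in> band_limited Y l" unfolding f_def by (rule legendre_band_limited[OF Y \<xi>])
    have "\<phi> \<xi> = a *\<^sub>R J (f \<xi>)"
      unfolding class_map_band_limited[OF Y J fb] \<phi>_def q_def by (simp add: scaleR_sum_right)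
    then have "norm (\<phi> \<xi>) = a * norm (J (f \<xi>))" using a0 by simp
    also have "norm (J (f \<xi>)) = C * sqrt (\<Sum>m\<in>?I. (q m \<xi>)\<^sup>2)"
      using J band_limited_sobolev[OF fb, of \<alpha>] by (simp add: sobolev_class_map_def C_def q_def)
    also have "\<dots> \<le> C * sqrt (4 * pi / (2 * real l + 1))"
      using C0 legendre_coeff_bessel[OF Y \<xi>, of l] unfolding q_def f_def
      by (intro mult_left_mono) auto
    finally have "norm (\<phi> \<xi>) \<le> a * (C * sqrt (4 * pi / (2 * real l + 1)))"
      using a0 by (simp add: mult_left_mono)
    also have "\<dots> = C / sqrt (\<nu> t) * sqrt (((2 * real l + 1) / (4 * pi)) * (4 * pi / (2 * real l + 1)))"
      unfolding a_def real_sqrt_mult by simp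
    also have "((2 * real l + 1) / (4 * pi)) * (4 * pi / (2 * real l + 1)) = 1"
      by simp
    finally show ?thesis by simp
  qed
  \<comment> \<open>The wave of the surface measure itself is the mean of a Legendre function, which is zero.\<close>
  have q_mean: "(\<integral>\<xi>. q m \<xi> \<partial>sphere_measure) = 0" if m: "m \<in> ?I" for m
  proof -
    have "(\<integral>\<xi>. q m \<xi> \<partial>sphere_measure) = sphere_coeff Y (\<lambda>x. \<integral>\<xi>. poly (legendre l) (x \<bullet> \<xi>) \<partial>sphere_measure) l m"
      unfolding q_def f_def by (rule legendre_wave_coefficients(2)[OF Y finite_sphere_measure refl m, symmetric])
    also have "\<dots> = (\<integral>x. 0 \<partial>sphere_measure)"
      unfolding sphere_coeff_def
    proof (intro Bochner_Integration.integral_cong refl)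
      fix x :: "real ^ 3" assume "x \<in> space sphere_measure"
      then show "(\<integral>\<xi>. poly (legendre l) (x \<bullet> \<xi>) \<partial>sphere_measure) * Y l m x = 0"
        using integral_legendre_zonal[of x l] \<open>l \<ge> 1\<close> by (simp add: inner_commute[of x])
    qed
    finally show ?thesis by simp
  qed
  have sL: "sets ?L = sets (restrict_space borel (sphere 0 1))" by simp
  have fL: "finite_measure ?L" using prm by (simp add: poisson_random_measure_def)
  have mean: "(\<integral>x. \<phi> x \<partial>?L) = 0"
  proof -
    have "(\<integral>x. \<phi> x \<partial>?L) = \<nu> t *\<^sub>R (\<integral>x. \<phi> x \<partial>sphere_measure)"
      using \<nu> measurable_continuous_on_sphere[OF \<phi>_cont] by (intro integral_scale_measure) auto
    also have "(\<integral>x. \<phi> x \<partial>sphere_measure) = 0"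
      unfolding \<phi>_int[OF finite_sphere_measure refl] by (simp add: q_mean)
    finally show ?thesis by simp
  qed
  have TN: "T \<omega> = (\<integral>x. \<phi> x \<partial>N t \<omega>)" if "\<omega> \<in> space M" for \<omega>
  proof -
    have Q: "finite_measure (N t \<omega>)" "sets (N t \<omega>) = sets sphere_measure"
      using prm that by (auto simp: poisson_random_measure_def)
    show ?thesis unfolding T wave[OF Q] \<phi>_int[OF Q] ..
  qed
  have mL: "measure ?L (sphere 0 1) = \<nu> t * (4 * pi)"
    using \<nu> by (simp add: measure_def emeasure_sphere_measure enn2real_mult)
  have span: "\<phi> \<xi> \<in> span ((\<lambda>m. J (Y l m)) ` ?I)" for \<xi>
    unfolding \<phi>_def by (intro span_sum span_scale span_base) auto
  let ?bound = "sqrt pi * (1 + sqrt (real l * (real l + 1))) powr (2 * \<alpha>) / (2 * sqrt (\<nu> t))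
      + 2 * pi * (1 + sqrt (real l * (real l + 1))) powr (3 * \<alpha>) / sqrt (\<nu> t)"
  have "\<bar>(\<integral>\<omega>. h (T \<omega>) \<partial>M) - (\<integral>\<omega>. h (Z \<omega>) \<partial>M')\<bar> \<le> ?bound"
    if h: "h \<in> Cb3" "Cb3_norm h \<le> 1" for h :: "'k \<Rightarrow> real"
  proof -
    note H = Cb3_bounds[OF h]
    have "\<bar>(\<integral>\<omega>. h (T \<omega>) \<partial>M) - (\<integral>\<omega>. h (Z \<omega>) \<partial>M')\<bar> \<le> pi / 8 * (measure ?L (sphere 0 1) * (C / sqrt (\<nu> t)) ^ 3)"
      by (rule poisson_gaussian_bound[OF \<open>prob_space M\<close> \<open>prob_space M'\<close> prm compact_sphere sL \<phi>_cont \<phi>_norm _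
          mean finite_imageI[OF finite_atLeastAtMost_int] span TN \<open>centred_gaussian M' Z\<close>
          \<open>integrable M' (\<lambda>\<omega>. (norm (Z \<omega>))\<^sup>2)\<close> \<open>covariance_operator M' Z = covariance_operator M T\<close> H])
        (use C0 \<nu> in auto)
    also have "\<dots> = pi * pi / 2 * (C ^ 3 / sqrt (\<nu> t))"
    proof -
      have "sqrt (\<nu> t) * sqrt (\<nu> t) = \<nu> t" using \<nu> by simp
      then have "\<nu> t * (C / sqrt (\<nu> t)) ^ 3 = C ^ 3 / sqrt (\<nu> t)"
        using \<nu> by (simp add: power3_eq_cube field_simps)
      then show ?thesis unfolding mL by simp
    qed
    also have "\<dots> \<le> 2 * pi * (C ^ 3 / sqrt (\<nu> t))"
      using pi_less_4 C0 \<nu> by (intro mult_right_mono) auto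
    also have "C ^ 3 = (1 + sqrt (real l * (real l + 1))) powr (3 * \<alpha>)"
      by (simp add: C_def power3_eq_cube flip: powr_add)
    also have "2 * pi * ((1 + sqrt (real l * (real l + 1))) powr (3 * \<alpha>) / sqrt (\<nu> t)) \<le> ?bound"
      using \<nu> by simp
    finally show ?thesis .
  qed
  then show ?thesis
    unfolding d3_def by (intro SUP_least ennreal_leI) auto
qed

end
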